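(* Let $k$ be a field and let $\mathcal{C}$ be a $k$-linear, Hom-finite, Krull-Schmidt, connected triangulated category whose Auslander-Reiten quiver has a finite stable component $\Gamma$. Then the tree class of $\Gamma$ is a Dynkin diagram, and $\Gamma$ contains every indecomposable object of $\mathcal{C}$ (up to isomorphism).
   Context: $\mathcal{C}$ is Hom-finite if $\dim_k\operatorname{Hom}_{\mathcal{C}}(X,Y)<\infty$ for all indecomposable $X,Y$. It is Krull-Schmidt if every object is a finite direct sum of indecomposable objects, each with local endomorphism ring. It is connected if the indecomposable objects cannot be partitioned into two (nonempty) classes with no non-zero homomorphisms, in either direction, between objects in different classes. Auslander-Reiten triangles: a distinguished triangle $U\to V\to W\xrightarrow{w}U[1]$ with $U,W$ indecomposable, $w\ne 0$, and such that every morphism $X\to W$ which is not a split epimorphism factors through $V\to W$ (equivalently, every morphism $U\to X$ which is not a split monomorphism factors through $U\to V$). One writes $U=\tau W$, $W=\tau^{-1}U$. Auslander-Reiten quiver: vertices are the isomorphism classes of indecomposable objects; there is an arrow $X\to Y$ if there is an irreducible morphism $X\to Y$. Where Auslander-Reiten triangles exist, the arrow $X\to Y$ is labelled by $(a,b)$, where $a$ is the multiplicity of $X$ as a summand of the middle term of the Auslander-Reiten triangle ending at $Y$, and $b$ is the multiplicity of $Y$ in the middle term of the one starting at $X$. A stable component $\Gamma$ is a connected component of the Auslander-Reiten quiver such that for every indecomposable $M\in\Gamma$: (1) for every $n\in\mathbb{Z}$, $\tau^nM$ is defined (the relevant Auslander-Reiten triangles exist) and lies in $\Gamma$; (2) every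 irreducible morphism beginning or ending at $M$ lies in $\Gamma$. It is finite if it has finitely many vertices. It is not assumed that $\Gamma$ is closed under shift, nor that Auslander-Reiten triangles exist elsewhere in $\mathcal{C}$. Tree class: for a tree $T$ whose edges carry valuations, choose an orientation; $\mathbb{Z}T$ has vertices $(n,x)$, $n\in\mathbb{Z}$, $x\in T_0$, and, for each arrow $x\to y$ of $T$ with valuation $(a,b)$, arrows $(n,x)\to(n,y)$ with valuation $(a,b)$ and $(n,y)\to(n+1,x)$ with valuation $(b,a)$; its translation is $\tau(n,x)=(n-1,x)$. By known theorems (Riedtmann; Xiao-Zhu) $\Gamma\cong\mathbb{Z}T/G$ for a valued tree $T$ and a group $G$ of automorphisms of $\mathbb{Z}T$, where $\mathbb{Z}T\to\Gamma$ is a covering (it commutes with $\tau$, preserves valuations, and is bijective on immediate successors and on immediate predecessors of each vertex). The valued tree $T$ is determined up to isomorphism by $\Gamma$ and is called the tree class of $\Gamma$. Dynkin diagrams: the finite valued trees $A_n, B_n, C_n, D_n, E_6, E_7, E_8, F_4, G_2$ (a double bond is an edge with valuation $(1,2)$ or $(2,1)$, a triple bond an edge with valuation $(1,3)$ or $(3,1)$, all other edges having valuation $(1,1)$). *)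

theory Defs
  imports "HOL-Algebra.Bij" "Jordan_Normal_Form.Missing_VectorSpace"
begin

section \<open>Linear categories\<close>

text \<open>
  Composition is written in the order of functions: \<open>g \<cdot>\<^bsub>C\<^esub> f\<close> means first \<open>f\<close>, then \<open>g\<close>.
  Only the module part of \<open>Hom C X Y\<close> is meaningful; its (junk) fields \<open>mult\<close> and \<open>one\<close> are
  never used. Hom spaces need not be disjoint, so predicates on morphisms carry the source and
  the target explicitly.
\<close>

record ('o, 'm, 'k) lin_cat =
  Ob :: "'o set"
  Hom :: "'o \<Rightarrow> 'o \<Rightarrow> ('k, 'm) module"
  Comp :: "'m \<Rightarrow> 'm \<Rightarrow> 'm"  (infixl "\<cdot>\<index>" 70)
  Idt :: "'o \<Rightarrow> 'm"

abbreviation Mor :: "('o, 'm, 'k, 'z) lin_cat_scheme \<Rightarrow> 'o \<Rightarrow> 'o \<Rightarrow> 'm set"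
  where "Mor C X Y \<equiv> carrier (Hom C X Y)"

abbreviation zero_mor :: "('o, 'm, 'k, 'z) lin_cat_scheme \<Rightarrow> 'o \<Rightarrow> 'o \<Rightarrow> 'm"
  where "zero_mor C X Y \<equiv> \<zero>\<^bsub>Hom C X Y\<^esub>"

locale linear_category =
  fixes K :: "('k, 'r) ring_scheme" and C :: "('o, 'm, 'k, 'z) lin_cat_scheme"
  assumes field: "field K"
    and vectorspace_Hom: "\<lbrakk>X \<in> Ob C; Y \<in> Ob C\<rbrakk> \<Longrightarrow> vectorspace K (Hom C X Y)"
    and id_in_Mor: "X \<in> Ob C \<Longrightarrow> Idt C X \<in> Mor C X X"
    and comp_linear_right:
      "\<lbrakk>X \<in> Ob C; Y \<in> Ob C; Z \<in> Ob C; g \<in> Mor C Y Z\<rbrakk>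
        \<Longrightarrow> linear_map K (Hom C X Y) (Hom C X Z) (\<lambda>f. g \<cdot>\<^bsub>C\<^esub> f)"
    and comp_linear_left:
      "\<lbrakk>X \<in> Ob C; Y \<in> Ob C; Z \<in> Ob C; f \<in> Mor C X Y\<rbrakk>
        \<Longrightarrow> linear_map K (Hom C Y Z) (Hom C X Z) (\<lambda>g. g \<cdot>\<^bsub>C\<^esub> f)"
    and comp_assoc:
      "\<lbrakk>W \<in> Ob C; X \<in> Ob C; Y \<in> Ob C; Z \<in> Ob C;
        f \<in> Mor C W X; g \<in> Mor C X Y; h \<in> Mor C Y Z\<rbrakk> \<Longrightarrow> h \<cdot>\<^bsub>C\<^esub> (g \<cdot>\<^bsub>C\<^esub> f) = (h \<cdot>\<^bsub>C\<^esub> g) \<cdot>\<^bsub>C\<^esub> f"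
    and comp_id_right:
      "\<lbrakk>X \<in> Ob C; Y \<in> Ob C; f \<in> Mor C X Y\<rbrakk> \<Longrightarrow> f \<cdot>\<^bsub>C\<^esub> Idt C X = f"
    and comp_id_left:
      "\<lbrakk>X \<in> Ob C; Y \<in> Ob C; f \<in> Mor C X Y\<rbrakk> \<Longrightarrow> Idt C Y \<cdot>\<^bsub>C\<^esub> f = f"


definition zero_object :: "('o, 'm, 'k, 'z) lin_cat_scheme \<Rightarrow> 'o \<Rightarrow> bool"
  where "zero_object C Z \<longleftrightarrow> Z \<in> Ob C \<and>
    (\<forall>X\<in>Ob C. (\<exists>!f. f \<in> Mor C X Z) \<and> (\<exists>!f. f \<in> Mor C Z X))"

definition is_iso :: "('o, 'm, 'k, 'z) lin_cat_scheme \<Rightarrow> 'o \<Rightarrow> 'o \<Rightarrow> 'm \<Rightarrow> bool"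
  where "is_iso C X Y f \<longleftrightarrow> f \<in> Mor C X Y \<and>
    (\<exists>g\<in>Mor C Y X. g \<cdot>\<^bsub>C\<^esub> f = Idt C X \<and> f \<cdot>\<^bsub>C\<^esub> g = Idt C Y)"

definition isomorphic :: "('o, 'm, 'k, 'z) lin_cat_scheme \<Rightarrow> 'o \<Rightarrow> 'o \<Rightarrow> bool"
  where "isomorphic C X Y \<longleftrightarrow> (\<exists>f. is_iso C X Y f)"

definition iso_class :: "('o, 'm, 'k, 'z) lin_cat_scheme \<Rightarrow> 'o \<Rightarrow> 'o set"
  where "iso_class C X = {Y \<in> Ob C. isomorphic C X Y}"

definition split_mono :: "('o, 'm, 'k, 'z) lin_cat_scheme \<Rightarrow> 'o \<Rightarrow> 'o \<Rightarrow> 'm \<Rightarrow> bool"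
  where "split_mono C X Y f \<longleftrightarrow> f \<in> Mor C X Y \<and> (\<exists>r\<in>Mor C Y X. r \<cdot>\<^bsub>C\<^esub> f = Idt C X)"

definition split_epi :: "('o, 'm, 'k, 'z) lin_cat_scheme \<Rightarrow> 'o \<Rightarrow> 'o \<Rightarrow> 'm \<Rightarrow> bool"
  where "split_epi C X Y f \<longleftrightarrow> f \<in> Mor C X Y \<and> (\<exists>s\<in>Mor C Y X. f \<cdot>\<^bsub>C\<^esub> s = Idt C Y)"

definition irreducible_mor :: "('o, 'm, 'k, 'z) lin_cat_scheme \<Rightarrow> 'o \<Rightarrow> 'o \<Rightarrow> 'm \<Rightarrow> bool"
  where "irreducible_mor C X Y f \<longleftrightarrow> f \<in> Mor C X Y \<and> \<not> split_mono C X Y f \<and> \<not> split_epi C X Y f \<and>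
    (\<forall>Z\<in>Ob C. \<forall>g\<in>Mor C X Z. \<forall>h\<in>Mor C Z Y.
      f = h \<cdot>\<^bsub>C\<^esub> g \<longrightarrow> split_mono C X Z g \<or> split_epi C Z Y h)"

text \<open>
  \<open>V\<close> is the (bi)product of the list \<open>Xs\<close>. For \<open>Xs = []\<close> this says that the identity of \<open>V\<close>
  vanishes, i.e. that \<open>V\<close> is a zero object.
\<close>

definition direct_sum :: "('o, 'm, 'k, 'z) lin_cat_scheme \<Rightarrow> 'o \<Rightarrow> 'o list \<Rightarrow> bool"
  where "direct_sum C V Xs \<longleftrightarrow> V \<in> Ob C \<and> set Xs \<subseteq> Ob C \<and>
    (\<exists>inj prj.
      (\<forall>i<length Xs. inj i \<in> Mor C (Xs ! i) V \<and> prj i \<in> Mor C V (Xs ! i)) \<and>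
      (\<forall>i<length Xs. \<forall>j<length Xs. prj i \<cdot>\<^bsub>C\<^esub> inj j =
        (if i = j then Idt C (Xs ! i) else zero_mor C (Xs ! j) (Xs ! i))) \<and>
      finsum (Hom C V V) (\<lambda>i. inj i \<cdot>\<^bsub>C\<^esub> prj i) {..<length Xs} = Idt C V)"

definition indecomposable :: "('o, 'm, 'k, 'z) lin_cat_scheme \<Rightarrow> 'o \<Rightarrow> bool"
  where "indecomposable C X \<longleftrightarrow> X \<in> Ob C \<and> \<not> zero_object C X \<and>
    (\<forall>A B. direct_sum C X [A, B] \<longrightarrow> zero_object C A \<or> zero_object C B)"

definition End_ring :: "('o, 'm, 'k, 'z) lin_cat_scheme \<Rightarrow> 'o \<Rightarrow> 'm ring"
  where "End_ring C X =
    \<lparr>carrier = Mor C X X, mult = Comp C, one = Idt C X,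
     zero = zero_mor C X X, add = add (Hom C X X)\<rparr>"

definition local_ring :: "('a, 'b) ring_scheme \<Rightarrow> bool"
  where "local_ring R \<longleftrightarrow> ring R \<and> \<one>\<^bsub>R\<^esub> \<noteq> \<zero>\<^bsub>R\<^esub> \<and>
    (\<forall>a\<in>carrier R - Units R. \<forall>b\<in>carrier R - Units R. a \<oplus>\<^bsub>R\<^esub> b \<notin> Units R)"

definition hom_finite :: "('k, 'r) ring_scheme \<Rightarrow> ('o, 'm, 'k, 'z) lin_cat_scheme \<Rightarrow> bool"
  where "hom_finite K C \<longleftrightarrow>
    (\<forall>X Y. indecomposable C X \<longrightarrow> indecomposable C Y \<longrightarrow> vectorspace.fin_dim K (Hom C X Y))"

definition krull_schmidt :: "('o, 'm, 'k, 'z) lin_cat_scheme \<Rightarrow> bool"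
  where "krull_schmidt C \<longleftrightarrow> (\<forall>V\<in>Ob C. \<exists>Xs. direct_sum C V Xs \<and>
    (\<forall>X\<in>set Xs. indecomposable C X \<and> local_ring (End_ring C X)))"

definition connected_category :: "('o, 'm, 'k, 'z) lin_cat_scheme \<Rightarrow> bool"
  where "connected_category C \<longleftrightarrow> \<not> (\<exists>P Q. P \<noteq> {} \<and> Q \<noteq> {} \<and> P \<inter> Q = {} \<and>
    P \<union> Q = {X. indecomposable C X} \<and>
    (\<forall>X\<in>P. \<forall>Y\<in>Q. Mor C X Y = {zero_mor C X Y} \<and> Mor C Y X = {zero_mor C Y X}))"

text \<open>
  \<open>multiplicity_in C X V n\<close>: in a decomposition of \<open>V\<close> into indecomposables, \<open>n\<close> of the summands
  are isomorphic to \<open>X\<close>. In a Krull-Schmidt category there is exactly one such \<open>n\<close>.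
\<close>

definition multiplicity_in :: "('o, 'm, 'k, 'z) lin_cat_scheme \<Rightarrow> 'o \<Rightarrow> 'o \<Rightarrow> nat \<Rightarrow> bool"
  where "multiplicity_in C X V n \<longleftrightarrow> (\<exists>Xs. direct_sum C V Xs \<and>
    (\<forall>Y\<in>set Xs. indecomposable C Y) \<and> n = length (filter (isomorphic C X) Xs))"

section \<open>Triangulated categories\<close>

text \<open>
  \<open>(X, Y, Z, u, v, w)\<close> stands for the triangle \<open>X \<rightarrow> Y \<rightarrow> Z \<rightarrow> X[1]\<close> with maps \<open>u\<close>, \<open>v\<close>, \<open>w\<close>.
\<close>

type_synonym ('o, 'm) triangle = "'o \<times> 'o \<times> 'o \<times> 'm \<times> 'm \<times> 'm"

record ('o, 'm, 'k) tri_cat = "('o, 'm, 'k) lin_cat" +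
  Sh :: "'o \<Rightarrow> 'o"
  ShM :: "'o \<Rightarrow> 'o \<Rightarrow> 'm \<Rightarrow> 'm"
  Tri :: "('o, 'm) triangle set"

text \<open>
  The shift may be any \<open>K\<close>-linear self-equivalence (full, faithful, dense); an automorphism is
  not required. The axioms TR1 to TR4 are Verdier's.
\<close>

locale triangulated_category = linear_category K C
  for K :: "('k, 'r) ring_scheme" and C :: "('o, 'm, 'k, 'z) tri_cat_scheme" +
  assumes additive: "set Xs \<subseteq> Ob C \<Longrightarrow> \<exists>V. direct_sum C V Xs"
    and Sh_Ob: "X \<in> Ob C \<Longrightarrow> Sh C X \<in> Ob C"
    and Sh_linear: "\<lbrakk>X \<in> Ob C; Y \<in> Ob C\<rbrakk>
      \<Longrightarrow> linear_map K (Hom C X Y) (Hom C (Sh C X) (Sh C Y)) (ShM C X Y)"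
    and Sh_id: "X \<in> Ob C \<Longrightarrow> ShM C X X (Idt C X) = Idt C (Sh C X)"
    and Sh_comp: "\<lbrakk>X \<in> Ob C; Y \<in> Ob C; Z \<in> Ob C; f \<in> Mor C X Y; g \<in> Mor C Y Z\<rbrakk>
      \<Longrightarrow> ShM C X Z (g \<cdot>\<^bsub>C\<^esub> f) = ShM C Y Z g \<cdot>\<^bsub>C\<^esub> ShM C X Y f"
    and Sh_fully_faithful: "\<lbrakk>X \<in> Ob C; Y \<in> Ob C\<rbrakk>
      \<Longrightarrow> bij_betw (ShM C X Y) (Mor C X Y) (Mor C (Sh C X) (Sh C Y))"
    and Sh_dense: "Y \<in> Ob C \<Longrightarrow> \<exists>X\<in>Ob C. isomorphic C (Sh C X) Y"
    and triangle_type: "(X, Y, Z, u, v, w) \<in> Tri C \<Longrightarrow> X \<in> Ob C \<and> Y \<in> Ob C \<and> Z \<in> Ob C \<and>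
      u \<in> Mor C X Y \<and> v \<in> Mor C Y Z \<and> w \<in> Mor C Z (Sh C X)"
    and TR1_iso: "\<lbrakk>(X, Y, Z, u, v, w) \<in> Tri C; X' \<in> Ob C; Y' \<in> Ob C; Z' \<in> Ob C;
        u' \<in> Mor C X' Y'; v' \<in> Mor C Y' Z'; w' \<in> Mor C Z' (Sh C X');
        is_iso C X X' f; is_iso C Y Y' g; is_iso C Z Z' h;
        g \<cdot>\<^bsub>C\<^esub> u = u' \<cdot>\<^bsub>C\<^esub> f; h \<cdot>\<^bsub>C\<^esub> v = v' \<cdot>\<^bsub>C\<^esub> g; ShM C X X' f \<cdot>\<^bsub>C\<^esub> w = w' \<cdot>\<^bsub>C\<^esub> h\<rbrakk>
      \<Longrightarrow> (X', Y', Z', u', v', w') \<in> Tri C"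
    and TR1_id: "\<lbrakk>X \<in> Ob C; zero_object C Z\<rbrakk>
      \<Longrightarrow> (X, X, Z, Idt C X, zero_mor C X Z, zero_mor C Z (Sh C X)) \<in> Tri C"
    and TR1_cone: "\<lbrakk>X \<in> Ob C; Y \<in> Ob C; u \<in> Mor C X Y\<rbrakk>
      \<Longrightarrow> \<exists>Z v w. (X, Y, Z, u, v, w) \<in> Tri C"
    and TR2: "\<lbrakk>X \<in> Ob C; Y \<in> Ob C; Z \<in> Ob C;
        u \<in> Mor C X Y; v \<in> Mor C Y Z; w \<in> Mor C Z (Sh C X)\<rbrakk>
      \<Longrightarrow> (X, Y, Z, u, v, w) \<in> Tri C \<longleftrightarrow>
          (Y, Z, Sh C X, v, w, \<ominus>\<^bsub>Hom C (Sh C X) (Sh C Y)\<^esub> ShM C X Y u) \<in> Tri C"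
    and TR3: "\<lbrakk>(X, Y, Z, u, v, w) \<in> Tri C; (X', Y', Z', u', v', w') \<in> Tri C;
        f \<in> Mor C X X'; g \<in> Mor C Y Y'; g \<cdot>\<^bsub>C\<^esub> u = u' \<cdot>\<^bsub>C\<^esub> f\<rbrakk>
      \<Longrightarrow> \<exists>h\<in>Mor C Z Z'. h \<cdot>\<^bsub>C\<^esub> v = v' \<cdot>\<^bsub>C\<^esub> g \<and> ShM C X X' f \<cdot>\<^bsub>C\<^esub> w = w' \<cdot>\<^bsub>C\<^esub> h"
    and TR4: "\<lbrakk>(X, Y, Z', f, i, i') \<in> Tri C; (Y, Z, X', g, j, j') \<in> Tri C;
        (X, Z, Y', g \<cdot>\<^bsub>C\<^esub> f, k, k') \<in> Tri C\<rbrakk>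
      \<Longrightarrow> \<exists>a\<in>Mor C Z' Y'. \<exists>b\<in>Mor C Y' X'.
        (Z', Y', X', a, b, ShM C Y Z' i \<cdot>\<^bsub>C\<^esub> j') \<in> Tri C \<and>
        a \<cdot>\<^bsub>C\<^esub> i = k \<cdot>\<^bsub>C\<^esub> g \<and> k' \<cdot>\<^bsub>C\<^esub> a = i' \<and> b \<cdot>\<^bsub>C\<^esub> k = j \<and> j' \<cdot>\<^bsub>C\<^esub> b = ShM C X Y f \<cdot>\<^bsub>C\<^esub> k'"

definition AR_triangle :: "('o, 'm, 'k, 'z) tri_cat_scheme \<Rightarrow> ('o, 'm) triangle \<Rightarrow> bool"
  where "AR_triangle C = (\<lambda>(U, V, W, u, v, w). (U, V, W, u, v, w) \<in> Tri C \<and>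
    indecomposable C U \<and> indecomposable C W \<and> w \<noteq> zero_mor C W (Sh C U) \<and>
    (\<forall>X\<in>Ob C. \<forall>f\<in>Mor C X W. \<not> split_epi C X W f \<longrightarrow> (\<exists>g\<in>Mor C X V. f = v \<cdot>\<^bsub>C\<^esub> g)))"

section \<open>Valued quivers with translation\<close>

text \<open>
  \<open>(x, y, a, b) \<in> qlab Q\<close> means that the arrow \<open>x \<rightarrow> y\<close> has valuation \<open>(a, b)\<close>, and
  \<open>(x, y) \<in> qtau Q\<close> means \<open>y = \<tau> x\<close>. Both may be partial, since Auslander-Reiten triangles
  need not exist everywhere.
\<close>

record 'v quiver =
  qverts :: "'v set"
  qarr :: "('v \<times> 'v) set"
  qlab :: "('v \<times> 'v \<times> nat \<times> nat) set"
  qtau :: "('v \<times> 'v) set"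

definition tau_pow :: "'v quiver \<Rightarrow> int \<Rightarrow> ('v \<times> 'v) set"
  where "tau_pow Q n = (if n \<ge> 0 then qtau Q ^^ nat n else ((qtau Q)\<inverse>) ^^ nat (- n))"

definition full_subquiver :: "'v quiver \<Rightarrow> 'v set \<Rightarrow> 'v quiver"
  where "full_subquiver Q S =
    \<lparr>qverts = qverts Q \<inter> S, qarr = qarr Q \<inter> (S \<times> S),
     qlab = qlab Q \<inter> (S \<times> S \<times> UNIV), qtau = qtau Q \<inter> (S \<times> S)\<rparr>"

definition quiver_component :: "'v quiver \<Rightarrow> 'v set \<Rightarrow> bool"
  where "quiver_component Q S \<longleftrightarrow> (\<exists>x\<in>qverts Q. S = (qarr Q \<union> (qarr Q)\<inverse>)\<^sup>* `` {x})"

definition quiver_iso :: "'v quiver \<Rightarrow> 'w quiver \<Rightarrow> ('v \<Rightarrow> 'w) \<Rightarrow> bool"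
  where "quiver_iso Q R \<phi> \<longleftrightarrow> bij_betw \<phi> (qverts Q) (qverts R) \<and>
    (\<forall>x\<in>qverts Q. \<forall>y\<in>qverts Q.
      ((x, y) \<in> qarr Q \<longleftrightarrow> (\<phi> x, \<phi> y) \<in> qarr R) \<and>
      ((x, y) \<in> qtau Q \<longleftrightarrow> (\<phi> x, \<phi> y) \<in> qtau R) \<and>
      (\<forall>a b. (x, y, a, b) \<in> qlab Q \<longleftrightarrow> (\<phi> x, \<phi> y, a, b) \<in> qlab R))"

definition quiver_covering :: "'v quiver \<Rightarrow> 'w quiver \<Rightarrow> ('v \<Rightarrow> 'w) \<Rightarrow> bool"
  where "quiver_covering Q R \<pi> \<longleftrightarrow> \<pi> ` qverts Q = qverts R \<and>
    (\<forall>x y. (x, y) \<in> qarr Q \<longrightarrow> (\<pi> x, \<pi> y) \<in> qarr R) \<and>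
    (\<forall>x y. (x, y) \<in> qtau Q \<longrightarrow> (\<pi> x, \<pi> y) \<in> qtau R) \<and>
    (\<forall>x y a b. (x, y, a, b) \<in> qlab Q \<longrightarrow> (\<pi> x, \<pi> y, a, b) \<in> qlab R) \<and>
    (\<forall>x\<in>qverts Q.
      bij_betw \<pi> {y. (x, y) \<in> qarr Q} {y. (\<pi> x, y) \<in> qarr R} \<and>
      bij_betw \<pi> {y. (y, x) \<in> qarr Q} {y. (y, \<pi> x) \<in> qarr R})"

definition automorphism_group :: "'v quiver \<Rightarrow> ('v \<Rightarrow> 'v) set \<Rightarrow> bool"
  where "automorphism_group Q G \<longleftrightarrow>
    subgroup G (BijGroup (qverts Q)) \<and> (\<forall>g\<in>G. quiver_iso Q Q g)"

definition orbit_of :: "('v \<Rightarrow> 'v) set \<Rightarrow> 'v \<Rightarrow> 'v set"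
  where "orbit_of G x = (\<lambda>g. g x) ` G"

definition orbit_quiver :: "'v quiver \<Rightarrow> ('v \<Rightarrow> 'v) set \<Rightarrow> 'v set quiver"
  where "orbit_quiver Q G =
    \<lparr>qverts = orbit_of G ` qverts Q,
     qarr = {(orbit_of G x, orbit_of G y) | x y. (x, y) \<in> qarr Q},
     qlab = {(orbit_of G x, orbit_of G y, a, b) | x y a b. (x, y, a, b) \<in> qlab Q},
     qtau = {(orbit_of G x, orbit_of G y) | x y. (x, y) \<in> qtau Q}\<rparr>"

section \<open>Valued trees and tree class\<close>

text \<open>
  An edge between \<open>x\<close> and \<open>y\<close>, read from \<open>x\<close> to \<open>y\<close>, has valuation \<open>(vd T x y, vd T y x)\<close>;
  the value \<open>0\<close> encodes that there is no edge.
\<close>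

record 'v valued_graph =
  vverts :: "'v set"
  vd :: "'v \<Rightarrow> 'v \<Rightarrow> nat"

definition vadj :: "'v valued_graph \<Rightarrow> ('v \<times> 'v) set"
  where "vadj T = {(x, y). vd T x y \<noteq> 0}"

definition valued_tree :: "'v valued_graph \<Rightarrow> bool"
  where "valued_tree T \<longleftrightarrow> vverts T \<noteq> {} \<and> vadj T \<subseteq> vverts T \<times> vverts T \<and>
    sym (vadj T) \<and> irrefl (vadj T) \<and>
    (\<forall>x\<in>vverts T. \<forall>y\<in>vverts T. (x, y) \<in> (vadj T)\<^sup>*) \<and>
    \<not> (\<exists>p. length p \<ge> 3 \<and> distinct p \<and>
        (\<forall>i. Suc i < length p \<longrightarrow> (p ! i, p ! Suc i) \<in> vadj T) \<and> (last p, hd p) \<in> vadj T)"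

definition orientation :: "'v valued_graph \<Rightarrow> ('v \<times> 'v) set \<Rightarrow> bool"
  where "orientation T A \<longleftrightarrow> A \<inter> A\<inverse> = {} \<and> A \<union> A\<inverse> = vadj T"

definition Z_quiver :: "'v valued_graph \<Rightarrow> ('v \<times> 'v) set \<Rightarrow> (int \<times> 'v) quiver"
  where "Z_quiver T A =
    \<lparr>qverts = UNIV \<times> vverts T,
     qarr = {((n, x), (n, y)) | n x y. (x, y) \<in> A} \<union> {((n, y), (n + 1, x)) | n x y. (x, y) \<in> A},
     qlab = {((n, x), (n, y), vd T x y, vd T y x) | n x y. (x, y) \<in> A} \<union>
            {((n, y), (n + 1, x), vd T y x, vd T x y) | n x y. (x, y) \<in> A},
     qtau = {((n, x), (n - 1, x)) | n x. x \<in> vverts T}\<rparr>"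

definition tree_class :: "'w quiver \<Rightarrow> 'v valued_graph \<Rightarrow> bool"
  where "tree_class Q T \<longleftrightarrow> valued_tree T \<and>
    (\<exists>A G \<phi>. orientation T A \<and> automorphism_group (Z_quiver T A) G \<and>
      quiver_iso (orbit_quiver (Z_quiver T A) G) Q \<phi> \<and>
      quiver_covering (Z_quiver T A) Q (\<phi> \<circ> orbit_of G))"

section \<open>Dynkin diagrams\<close>

definition simply_laced :: "nat \<Rightarrow> (nat \<times> nat) set \<Rightarrow> nat valued_graph"
  where "simply_laced n E =
    \<lparr>vverts = {1..n}, vd = (\<lambda>x y. if (x, y) \<in> E \<or> (y, x) \<in> E then 1 else 0)\<rparr>"

definition revalue :: "nat valued_graph \<Rightarrow> nat \<Rightarrow> nat \<Rightarrow> nat \<times> nat \<Rightarrow> nat valued_graph"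
  where "revalue T x y = (\<lambda>(a, b). T\<lparr>vd := \<lambda>p q.
    if (p, q) = (x, y) then a else if (p, q) = (y, x) then b else vd T p q\<rparr>)"

definition path_edges :: "nat \<Rightarrow> (nat \<times> nat) set"
  where "path_edges n = {(i, Suc i) | i. 1 \<le> i \<and> i < n}"

definition dynkin_A :: "nat \<Rightarrow> nat valued_graph"
  where "dynkin_A n = simply_laced n (path_edges n)"

definition dynkin_B :: "nat \<Rightarrow> nat valued_graph"
  where "dynkin_B n = revalue (dynkin_A n) (n - 1) n (1, 2)"

definition dynkin_C :: "nat \<Rightarrow> nat valued_graph"
  where "dynkin_C n = revalue (dynkin_A n) (n - 1) n (2, 1)"

definition dynkin_D :: "nat \<Rightarrow> nat valued_graph"
  where "dynkin_D n = simply_laced n (insert (n - 2, n) (path_edges (n - 1)))"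

definition dynkin_E :: "nat \<Rightarrow> nat valued_graph"
  where "dynkin_E n = simply_laced n (insert (3, n) (path_edges (n - 1)))"

definition dynkin_F4 :: "nat valued_graph"
  where "dynkin_F4 = revalue (dynkin_A 4) 2 3 (1, 2)"

definition dynkin_G2 :: "nat valued_graph"
  where "dynkin_G2 = revalue (dynkin_A 2) 1 2 (1, 3)"

definition valued_graph_iso :: "'v valued_graph \<Rightarrow> 'w valued_graph \<Rightarrow> bool"
  where "valued_graph_iso S T \<longleftrightarrow> (\<exists>\<phi>. bij_betw \<phi> (vverts S) (vverts T) \<and>
    (\<forall>x\<in>vverts S. \<forall>y\<in>vverts S. vd T (\<phi> x) (\<phi> y) = vd S x y))"

definition dynkin_diagram :: "'v valued_graph \<Rightarrow> bool"
  where "dynkin_diagram T \<longleftrightarrow> (\<exists>D. valued_graph_iso T D \<and>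
    (D \<in> {dynkin_A n | n. n \<ge> 1} \<union> {dynkin_B n | n. n \<ge> 2} \<union> {dynkin_C n | n. n \<ge> 3} \<union>
      {dynkin_D n | n. n \<ge> 4} \<union> {dynkin_E 6, dynkin_E 7, dynkin_E 8, dynkin_F4, dynkin_G2}))"

section \<open>The Auslander-Reiten quiver\<close>

text \<open>
  The valuation \<open>(a, b)\<close> of an arrow \<open>X \<rightarrow> Y\<close> is read off the Auslander-Reiten triangles ending
  at \<open>Y\<close> (for \<open>a\<close>) and starting at \<open>X\<close> (for \<open>b\<close>).
\<close>

definition AR_quiver :: "('o, 'm, 'k, 'z) tri_cat_scheme \<Rightarrow> 'o set quiver"
  where "AR_quiver C =
    \<lparr>qverts = {iso_class C X | X. indecomposable C X},
     qarr = {(iso_class C X, iso_class C Y) | X Y.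
       indecomposable C X \<and> indecomposable C Y \<and> (\<exists>f. irreducible_mor C X Y f)},
     qlab = {(iso_class C X, iso_class C Y, a, b) | X Y a b.
       indecomposable C X \<and> indecomposable C Y \<and> (\<exists>f. irreducible_mor C X Y f) \<and>
       (\<exists>U V u v w. AR_triangle C (U, V, Y, u, v, w) \<and> multiplicity_in C X V a) \<and>
       (\<exists>V W u v w. AR_triangle C (X, V, W, u, v, w) \<and> multiplicity_in C Y V b)},
     qtau = {(iso_class C W, iso_class C U) | U W.
       \<exists>V u v w. AR_triangle C (U, V, W, u, v, w)}\<rparr>"

definition stable_component :: "('o, 'm, 'k, 'z) tri_cat_scheme \<Rightarrow> 'o set set \<Rightarrow> bool"
  where "stable_component C \<Gamma> \<longleftrightarrow> quiver_component (AR_quiver C) \<Gamma> \<and>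
    (\<forall>M. indecomposable C M \<longrightarrow> iso_class C M \<in> \<Gamma> \<longrightarrow>
      (\<forall>n::int. \<exists>N\<in>\<Gamma>. (iso_class C M, N) \<in> tau_pow (AR_quiver C) n) \<and>
      (\<forall>X f. indecomposable C X \<longrightarrow> irreducible_mor C M X f \<or> irreducible_mor C X M f \<longrightarrow>
        iso_class C X \<in> \<Gamma>))"

end

theory Submission
  imports Defs "HOL-Combinatorics.Cycles" "HOL-Library.Countable_Set"
begin

text \<open>On an Auslander-Reiten triangle \<open>U \<rightarrow> V \<rightarrow> W\<close> in \<open>\<Gamma>\<close> the functor \<open>Hom(X, -)\<close> is exact in the
  middle, and for \<open>X = W\<close> the identity of \<open>W\<close> does not lift to \<open>V\<close>; summing over \<open>X\<close> in the finite set
  \<open>\<Gamma>\<close> gives a positive function \<open>g\<close> with \<open>g V < g U + g W\<close> at every triangle. Its sum along \<open>\<tau>\<close>-orbits is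
  \<open>\<tau>\<close>-invariant, hence descends along the covering \<open>\<int>T \<rightarrow> \<Gamma>\<close> to a bounded strictly subadditive function
  on the tree \<open>T\<close>. Pairing it with the null roots excludes every extended Dynkin subgraph, and its
  boundedness excludes infinite paths, so \<open>T\<close> is Dynkin. A tree class exists because multiplicities
  in middle terms are dimensions of \<open>rad/rad\<^sup>2\<close> over residue division rings, which makes \<open>\<Gamma>\<close> a valued
  translation quiver; \<open>T\<close> is its tree of reduced walks and \<open>G\<close> the deck group.
  Finally, if \<open>Y\<close> is an indecomposable outside \<open>\<Gamma>\<close>, every morphism from \<open>Y\<close> to an object of \<open>\<Gamma>\<close> factors
  through the middle term of an Auslander-Reiten triangle, so the restriction of \<open>Hom(Y, -)\<close> to \<open>\<Gamma>\<close> equals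
  its own radical and vanishes by Nakayama's lemma; dually for \<open>Hom(-, Y)\<close>, and connectedness puts every
  indecomposable into \<open>\<Gamma>\<close>.\<close>

section \<open>Linear algebra\<close>

text \<open>Positive additive functions exist on the extended Dynkin diagrams, so plain
  subadditivity could not exclude them; strictness comes from the identity of W, which does not lift
  to V. Along a path of the tree a strictly subadditive function is strictly concave, and bounded
  natural numbers allow only finitely many such steps. Since \<Gamma> need not be closed under the
  shift, long exact sequences leave \<Gamma>; exactness in the middle stays inside. An
  Auslander-Reiten triangle is defined by its right-hand factorisation only. The left-hand one is
  derived once in the triangulated category; afterwards both halves are kept without the shift, as
  \<open>ras\<close> and \<open>las\<close>, and are exchanged by dualising the linear structure
  alone. The two labels of an arrow from X to Y divide one and the same dimension, that of rad/rad^2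
  (X, Y), by the dimensions of the residue rings of X and of Y. These residue dimensions agree at
  the two ends of a triangle, and this is why the labels change places under \<tau>.\<close>

definition sdim :: "('k, 'r) ring_scheme \<Rightarrow> ('k, 'm, 'z) module_scheme \<Rightarrow> 'm set \<Rightarrow> nat"
  where "sdim K V S = vectorspace.dim K (V\<lparr>carrier := S\<rparr>)"

text \<open>Independence in the subspace is independence in V, which bounds the independent subsets
  of S; a maximal one is a basis of S. With \<open>dim\<close> elements it is a basis of V as well,
  and S is everything.\<close>

lemma (in vectorspace) subspace_fin_dim:
  assumes fd: "fin_dim" and S: "subspace K S V"
  shows "vectorspace.fin_dim K (vs S)" "sdim K V S \<le> dim"
    "sdim K V S = dim \<Longrightarrow> S = carrier V"
proof -
  interpret S: vectorspace K "vs S" using S by (rule subspace_is_vs)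
  have sub: "submodule K S V" using S by (simp add: subspace_def)
  have SV: "S \<subseteq> carrier V" using sub by (simp add: submodule_def)
  have li: "lin_indpt B" if "B \<subseteq> S" "S.lin_indpt B" for B
    using span_li_not_depend(2)[OF that(1) sub] that(2) by simp
  have bd: "finite B \<and> card B \<le> dim" if "B \<subseteq> S \<and> S.lin_indpt B" for B
    using li_le_dim[OF fd _ li] that SV by blast
  have "S.lin_indpt {}" by (auto simp: S.lin_dep_def)
  then obtain B where B: "finite B" "maximal B (\<lambda>B. B \<subseteq> S \<and> S.lin_indpt B)"
    using maximal_exists[of "\<lambda>B. B \<subseteq> S \<and> S.lin_indpt B" dim "{}"] bd by auto
  have bas: "S.basis B" using S.max_li_is_basis B by simp
  then show fdS: "S.fin_dim" using B(1) unfolding S.fin_dim_def S.basis_def by blast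
  have d: "S.dim = card B" using S.dim_basis[OF B(1)] bas by simp
  have B': "B \<subseteq> S \<and> S.lin_indpt B" using bas by (simp add: S.basis_def)
  show "sdim K V S \<le> dim" using bd[OF B'] d by (simp add: sdim_def)
  assume "sdim K V S = dim"
  then have "dim \<le> card B" using d by (simp add: sdim_def)
  then have "basis B" using dim_li_is_basis[OF fd B(1)] li B' SV by blast
  then have "span B = carrier V" by (simp add: basis_def)
  moreover have "span B \<subseteq> S" using span_is_subset[OF _ sub] B' by blast
  ultimately show "S = carrier V" using SV by blast
qed

lemma subspaceI:
  assumes "vectorspace K V" "S \<subseteq> carrier V" "\<zero>\<^bsub>V\<^esub> \<in> S"
    "\<And>v w. \<lbrakk>v \<in> S; w \<in> S\<rbrakk> \<Longrightarrow> v \<oplus>\<^bsub>V\<^esub> w \<in> S" "\<And>c v. \<lbrakk>c \<in> carrier K; v \<in> S\<rbrakk> \<Longrightarrow> c \<odot>\<^bsub>V\<^esub> v \<in> S"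
  shows "subspace K S V"
  using assms unfolding subspace_def submodule_def vectorspace_def by auto

lemma subspaceD:
  assumes "subspace K S V"
  shows "S \<subseteq> carrier V" "\<zero>\<^bsub>V\<^esub> \<in> S"
    "\<And>v w. \<lbrakk>v \<in> S; w \<in> S\<rbrakk> \<Longrightarrow> v \<oplus>\<^bsub>V\<^esub> w \<in> S" "\<And>c v. \<lbrakk>c \<in> carrier K; v \<in> S\<rbrakk> \<Longrightarrow> c \<odot>\<^bsub>V\<^esub> v \<in> S"
  using assms unfolding subspace_def submodule_def by auto

lemma (in vectorspace) sdim_mono:
  assumes fd: "fin_dim" and S: "subspace K S V" and S': "subspace K S' V" and "S \<subseteq> S'"
  shows "sdim K V S \<le> sdim K V S'" "sdim K V S = sdim K V S' \<Longrightarrow> S = S'"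
proof -
  interpret S': vectorspace K "vs S'" using S' by (rule subspace_is_vs)
  have sub: "subspace K S (vs S')"
    using subspaceD[OF S] subspaceD[OF S'] \<open>S \<subseteq> S'\<close>
    by (intro subspaceI) (auto intro: S'.vectorspace_axioms)
  have fd': "S'.fin_dim" using subspace_fin_dim[OF fd S'] by simp
  show "sdim K V S \<le> sdim K V S'" "sdim K V S = sdim K V S' \<Longrightarrow> S = S'"
    using S'.subspace_fin_dim(2,3)[OF fd' sub] by (simp_all add: sdim_def)
qed

lemma (in vectorspace) sdim_zero: "sdim K V {\<zero>\<^bsub>V\<^esub>} = 0"
proof -
  have "subspace K {\<zero>\<^bsub>V\<^esub>} V" by (intro subspaceI vectorspace_axioms) auto
  then interpret S: vectorspace K "vs {\<zero>\<^bsub>V\<^esub>}" by (rule subspace_is_vs)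
  have "S.dim \<le> 0"
    using S.gen_ge_dim[of "{}"] S.span_empty by simp
  then show ?thesis by (simp add: sdim_def)
qed

text \<open>Rank-nullity for the restriction of T to S, the source of the dimension counts below.
  Image and kernel are delivered as subspaces of the ambient spaces so that counts can be
  chained.\<close>

lemma (in linear_map) sdim_image_kernel:
  assumes fd: "V.fin_dim" and S: "subspace K S V"
  shows "subspace K (T ` S) W" "subspace K {v \<in> S. T v = \<zero>\<^bsub>W\<^esub>} V"
    "sdim K V S = sdim K W (T ` S) + sdim K V {v \<in> S. T v = \<zero>\<^bsub>W\<^esub>}"
proof -
  interpret S: vectorspace K "V\<lparr>carrier := S\<rparr>" using S by (rule V.subspace_is_vs)
  have SV: "S \<subseteq> carrier V" using subspaceD(1)[OF S] .
  have hom: "T \<in> module_hom K (V\<lparr>carrier := S\<rparr>) W"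
    using f_hom SV unfolding module_hom_def by (simp add: Pi_iff subset_iff)
  interpret R: linear_map K "V\<lparr>carrier := S\<rparr>" W T
    by (intro linear_map.intro mod_hom.intro mod_hom_axioms.intro hom S.vectorspace_axioms
        W.vectorspace_axioms S.vectorspace_axioms[THEN vectorspace.axioms(1)]
        W.vectorspace_axioms[THEN vectorspace.axioms(1)])
  have fdS: "S.fin_dim" using V.subspace_fin_dim[OF fd S] by simp
  have im: "R.im = T ` S" by (simp add: R.im_def)
  have ker: "R.ker = {v \<in> S. T v = \<zero>\<^bsub>W\<^esub>}" by (simp add: R.ker_def)
  show "subspace K (T ` S) W" using R.imT_is_subspace im by simp
  show "subspace K {v \<in> S. T v = \<zero>\<^bsub>W\<^esub>} V"
    using subspaceD[OF S] by (intro subspaceI V.vectorspace_axioms) (auto simp: subset_iff)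
  show "sdim K V S = sdim K W (T ` S) + sdim K V {v \<in> S. T v = \<zero>\<^bsub>W\<^esub>}"
    using R.rank_nullity[OF fdS] by (simp add: sdim_def im ker)
qed

lemma linear_mapD:
  assumes "linear_map K V W T"
  shows "v \<in> carrier V \<Longrightarrow> T v \<in> carrier W"
    "\<lbrakk>v \<in> carrier V; w \<in> carrier V\<rbrakk> \<Longrightarrow> T (v \<oplus>\<^bsub>V\<^esub> w) = T v \<oplus>\<^bsub>W\<^esub> T w"
    "\<lbrakk>v \<in> carrier V; w \<in> carrier V\<rbrakk> \<Longrightarrow> T (v \<ominus>\<^bsub>V\<^esub> w) = T v \<ominus>\<^bsub>W\<^esub> T w"
    "\<lbrakk>c \<in> carrier K; v \<in> carrier V\<rbrakk> \<Longrightarrow> T (c \<odot>\<^bsub>V\<^esub> v) = c \<odot>\<^bsub>W\<^esub> T v"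
    "T \<zero>\<^bsub>V\<^esub> = \<zero>\<^bsub>W\<^esub>"
proof -
  interpret linear_map K V W T by fact
  show "v \<in> carrier V \<Longrightarrow> T v \<in> carrier W"
    "\<lbrakk>v \<in> carrier V; w \<in> carrier V\<rbrakk> \<Longrightarrow> T (v \<oplus>\<^bsub>V\<^esub> w) = T v \<oplus>\<^bsub>W\<^esub> T w"
    "\<lbrakk>v \<in> carrier V; w \<in> carrier V\<rbrakk> \<Longrightarrow> T (v \<ominus>\<^bsub>V\<^esub> w) = T v \<ominus>\<^bsub>W\<^esub> T w"
    "\<lbrakk>c \<in> carrier K; v \<in> carrier V\<rbrakk> \<Longrightarrow> T (c \<odot>\<^bsub>V\<^esub> v) = c \<odot>\<^bsub>W\<^esub> T v"
    "T \<zero>\<^bsub>V\<^esub> = \<zero>\<^bsub>W\<^esub>"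
    by simp_all
qed

lemma linear_map_finsum:
  assumes "linear_map K V W T" "finite A" "g \<in> A \<rightarrow> carrier V"
  shows "T (finsum V g A) = finsum W (\<lambda>a. T (g a)) A"
proof -
  interpret linear_map K V W T by fact
  have V: "abelian_monoid V" and W: "abelian_monoid W"
    using V.vectorspace_axioms W.vectorspace_axioms
    by (simp_all add: vectorspace_def module_def abelian_group_def)
  show ?thesis
    using assms(2,3)
  proof (induct A rule: finite_induct)
    case (insert a A)
    then have "finsum W (\<lambda>a. T (g a)) (insert a A) = T (g a) \<oplus>\<^bsub>W\<^esub> finsum W (\<lambda>a. T (g a)) A"
      by (intro abelian_monoid.finsum_insert[OF W]) auto
    with insert show ?case by (simp add: abelian_monoid.finsum_insert[OF V] Pi_iff)
  qed (simp add: abelian_monoid.finsum_empty V W)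
qed

lemma (in abelian_monoid) finsum_mem:
  assumes "finite A" "S \<subseteq> carrier G" "\<zero> \<in> S" "\<And>v w. \<lbrakk>v \<in> S; w \<in> S\<rbrakk> \<Longrightarrow> v \<oplus> w \<in> S" "g \<in> A \<rightarrow> S"
  shows "finsum G g A \<in> S"
  using assms(1,5)
proof (induct A rule: finite_induct)
  case (insert a A)
  then have "finsum G g (insert a A) = g a \<oplus> finsum G g A"
    using assms(2) by (intro finsum_insert) auto
  with insert assms show ?case by (simp add: Pi_iff)
qed (simp add: assms)

section \<open>Linear categories\<close>

text \<open>Only the linear structure is dualised; triangles are first reduced to the shift-free
  \<open>ras\<close> and \<open>las\<close>, which dualise into each other.\<close>

definition op_cat :: "('o, 'm, 'k, 'z) lin_cat_scheme \<Rightarrow> ('o, 'm, 'k) lin_cat"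
  where "op_cat C = \<lparr>Ob = Ob C, Hom = \<lambda>X Y. Hom C Y X, Comp = \<lambda>g f. f \<cdot>\<^bsub>C\<^esub> g, Idt = Idt C\<rparr>"

lemma op_cat_simps [simp]:
  "Ob (op_cat C) = Ob C" "Hom (op_cat C) X Y = Hom C Y X"
  "Comp (op_cat C) g f = Comp C f g" "Idt (op_cat C) = Idt C"
  by (simp_all add: op_cat_def)

context linear_category
begin

abbreviation cmp (infixl "\<star>" 70) where "cmp \<equiv> Comp C"
abbreviation zr where "zr X Y \<equiv> zero_mor C X Y"
abbreviation pls where "pls X Y f g \<equiv> f \<oplus>\<^bsub>Hom C X Y\<^esub> g"
abbreviation mns where "mns X Y f g \<equiv> f \<ominus>\<^bsub>Hom C X Y\<^esub> g"

text \<open>A typing judgement: as Hom spaces may overlap, source and target are carried along, and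
  bundling their membership in \<open>Ob C\<close> lets composition rules apply by matching
  alone.\<close>

definition ar where "ar X Y f \<longleftrightarrow> X \<in> Ob C \<and> Y \<in> Ob C \<and> f \<in> Mor C X Y"

lemma op_linear_category: "linear_category K (op_cat C)"
  by (rule linear_category.intro) (simp_all add: field vectorspace_Hom id_in_Mor comp_linear_left
      comp_linear_right comp_assoc comp_id_left comp_id_right)

lemma ar_op: "linear_category.ar (op_cat C) X Y f \<longleftrightarrow> ar Y X f"
  by (auto simp: linear_category.ar_def[OF op_linear_category] ar_def)

lemma arD: "ar X Y f \<Longrightarrow> X \<in> Ob C" "ar X Y f \<Longrightarrow> Y \<in> Ob C" "ar X Y f \<Longrightarrow> f \<in> Mor C X Y"
  by (auto simp: ar_def)

lemma lin_r: "\<lbrakk>X \<in> Ob C; ar Y Z g\<rbrakk> \<Longrightarrow> linear_map K (Hom C X Y) (Hom C X Z) (\<lambda>f. g \<star> f)"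
  using comp_linear_right by (auto simp: ar_def)

lemma lin_l: "\<lbrakk>Z \<in> Ob C; ar X Y f\<rbrakk> \<Longrightarrow> linear_map K (Hom C Y Z) (Hom C X Z) (\<lambda>g. g \<star> f)"
  using comp_linear_left by (auto simp: ar_def)

lemma vs: "\<lbrakk>X \<in> Ob C; Y \<in> Ob C\<rbrakk> \<Longrightarrow> vectorspace K (Hom C X Y)"
  using vectorspace_Hom .

lemma Hom_module: "\<lbrakk>X \<in> Ob C; Y \<in> Ob C\<rbrakk> \<Longrightarrow> module K (Hom C X Y)"
  using vectorspace_Hom by (simp add: vectorspace_def)

lemma Hom_group: "\<lbrakk>X \<in> Ob C; Y \<in> Ob C\<rbrakk> \<Longrightarrow> abelian_group (Hom C X Y)"
  using Hom_module by (simp add: module_def)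

lemma ar_cmp [intro]: "\<lbrakk>ar Y Z g; ar X Y f\<rbrakk> \<Longrightarrow> ar X Z (g \<star> f)"
  using linear_mapD(1)[OF lin_r[of X Y Z g]] by (auto simp: ar_def)

lemma ar_id [intro, simp]: "X \<in> Ob C \<Longrightarrow> ar X X (Idt C X)"
  by (simp add: ar_def id_in_Mor)

lemma ar_zr [intro, simp]: "\<lbrakk>X \<in> Ob C; Y \<in> Ob C\<rbrakk> \<Longrightarrow> ar X Y (zr X Y)"
  using abelian_monoid.zero_closed[OF abelian_group.axioms(1)[OF Hom_group]] by (simp add: ar_def)

lemma ar_pls [intro]: "\<lbrakk>ar X Y f; ar X Y g\<rbrakk> \<Longrightarrow> ar X Y (pls X Y f g)"
  using abelian_monoid.a_closed[OF abelian_group.axioms(1)[OF Hom_group]] by (simp add: ar_def)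

lemma ar_mns [intro]: "\<lbrakk>ar X Y f; ar X Y g\<rbrakk> \<Longrightarrow> ar X Y (mns X Y f g)"
  using abelian_group.minus_closed[OF Hom_group] by (simp add: ar_def)

lemma ar_smult [intro]: "\<lbrakk>c \<in> carrier K; ar X Y f\<rbrakk> \<Longrightarrow> ar X Y (c \<odot>\<^bsub>Hom C X Y\<^esub> f)"
  using module.smult_closed[OF Hom_module] by (simp add: ar_def)

lemma cmp_assoc: "\<lbrakk>ar W X f; ar X Y g; ar Y Z h\<rbrakk> \<Longrightarrow> h \<star> g \<star> f = h \<star> (g \<star> f)"
  by (rule comp_assoc[of W X Y Z f g h, symmetric]) (auto dest: arD)

lemma id_l [simp]: "ar X Y f \<Longrightarrow> Idt C Y \<star> f = f"
  by (rule comp_id_left[of X Y f]) (auto dest: arD)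

lemma id_r [simp]: "ar X Y f \<Longrightarrow> f \<star> Idt C X = f"
  by (rule comp_id_right[of X Y f]) (auto dest: arD)

lemma cmp_add_r: "\<lbrakk>ar Y Z g; ar X Y f; ar X Y f'\<rbrakk> \<Longrightarrow> g \<star> pls X Y f f' = pls X Z (g \<star> f) (g \<star> f')"
  by (rule linear_mapD(2)[OF lin_r]) (auto dest: arD)

lemma cmp_add_l: "\<lbrakk>ar X Y f; ar Y Z g; ar Y Z g'\<rbrakk> \<Longrightarrow> pls Y Z g g' \<star> f = pls X Z (g \<star> f) (g' \<star> f)"
  by (rule linear_mapD(2)[OF lin_l]) (auto dest: arD)

lemma cmp_minus_r: "\<lbrakk>ar Y Z g; ar X Y f; ar X Y f'\<rbrakk> \<Longrightarrow> g \<star> mns X Y f f' = mns X Z (g \<star> f) (g \<star> f')"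
  by (rule linear_mapD(3)[OF lin_r]) (auto dest: arD)

lemma cmp_minus_l: "\<lbrakk>ar X Y f; ar Y Z g; ar Y Z g'\<rbrakk> \<Longrightarrow> mns Y Z g g' \<star> f = mns X Z (g \<star> f) (g' \<star> f)"
  by (rule linear_mapD(3)[OF lin_l]) (auto dest: arD)

lemma cmp_smult_l:
  "\<lbrakk>c \<in> carrier K; ar X Y f; ar Y Z g\<rbrakk> \<Longrightarrow> (c \<odot>\<^bsub>Hom C Y Z\<^esub> g) \<star> f = c \<odot>\<^bsub>Hom C X Z\<^esub> (g \<star> f)"
  by (rule linear_mapD(4)[OF lin_l]) (auto dest: arD)

lemma cmp_zr_r: "\<lbrakk>ar Y Z g; X \<in> Ob C\<rbrakk> \<Longrightarrow> g \<star> zr X Y = zr X Z"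
  by (rule linear_mapD(5)[OF lin_r]) (auto dest: arD)

lemma cmp_zr_l: "\<lbrakk>ar X Y f; Z \<in> Ob C\<rbrakk> \<Longrightarrow> zr Y Z \<star> f = zr X Z"
  by (rule linear_mapD(5)[OF lin_l]) (auto dest: arD)

lemma add_zr [simp]: "ar X Y f \<Longrightarrow> pls X Y f (zr X Y) = f" "ar X Y f \<Longrightarrow> pls X Y (zr X Y) f = f"
  using abelian_monoid.r_zero[OF abelian_group.axioms(1)[OF Hom_group]]
    abelian_monoid.l_zero[OF abelian_group.axioms(1)[OF Hom_group]] by (simp_all add: ar_def)

lemma add_mns [simp]: "\<lbrakk>ar X Y f; ar X Y g\<rbrakk> \<Longrightarrow> pls X Y f (mns X Y g f) = g"
proof -
  assume a: "ar X Y f" "ar X Y g"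
  then interpret abelian_group "Hom C X Y" by (intro Hom_group arD)
  show ?thesis using a by (simp add: ar_def minus_eq) (metis a_comm a_inv_closed r_neg1 add.inv_closed add.m_lcomm r_neg r_zero)
qed

lemma mns_self [simp]: "ar X Y f \<Longrightarrow> mns X Y f f = zr X Y"
  using abelian_group.r_neg[OF Hom_group] by (simp add: ar_def a_minus_def)

lemma mns_eq_zrD: "\<lbrakk>ar X Y f; ar X Y g; mns X Y f g = zr X Y\<rbrakk> \<Longrightarrow> f = g"
proof -
  assume a: "ar X Y f" "ar X Y g" "mns X Y f g = zr X Y"
  then interpret abelian_group "Hom C X Y" by (intro Hom_group arD)
  show ?thesis using a minus_other_side[of f g] by (simp add: ar_def)
qed

lemma zero_object_iff: "zero_object C Z \<longleftrightarrow> Z \<in> Ob C \<and> Idt C Z = zr Z Z"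
proof
  assume "zero_object C Z"
  then show "Z \<in> Ob C \<and> Idt C Z = zr Z Z"
    unfolding zero_object_def using id_in_Mor ar_zr arD(3) by blast
next
  assume *: "Z \<in> Ob C \<and> Idt C Z = zr Z Z"
  have "f = zr X Z" if "ar X Z f" for X f
    using id_l[OF that] * cmp_zr_l[OF that] by simp
  moreover have "f = zr Z X" if "ar Z X f" for X f
    using id_r[OF that] * cmp_zr_r[OF that] by simp
  ultimately show "zero_object C Z"
    unfolding zero_object_def using * ar_zr unfolding ar_def by metis
qed

lemma zero_object_ar: "\<lbrakk>zero_object C Z; ar X Z f\<rbrakk> \<Longrightarrow> f = zr X Z" "\<lbrakk>zero_object C Z; ar Z X g\<rbrakk> \<Longrightarrow> g = zr Z X"
  unfolding zero_object_def using ar_zr unfolding ar_def by metis+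

lemma indecD: "indecomposable C X \<Longrightarrow> X \<in> Ob C" "indecomposable C X \<Longrightarrow> Idt C X \<noteq> zr X X"
  using zero_object_iff by (auto simp: indecomposable_def)

subsection \<open>Isomorphisms\<close>

lemma is_isoI: "\<lbrakk>ar X Y f; ar Y X g; g \<star> f = Idt C X; f \<star> g = Idt C Y\<rbrakk> \<Longrightarrow> is_iso C X Y f"
  by (auto simp: is_iso_def ar_def)

lemma is_isoE:
  assumes "is_iso C X Y f" "X \<in> Ob C" "Y \<in> Ob C"
  obtains g where "ar X Y f" "ar Y X g" "g \<star> f = Idt C X" "f \<star> g = Idt C Y" "is_iso C Y X g"
  using assms by (auto simp: is_iso_def ar_def)

lemma is_iso_id: "X \<in> Ob C \<Longrightarrow> is_iso C X X (Idt C X)"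
  by (rule is_isoI[OF ar_id ar_id]) (simp_all add: id_l[OF ar_id])

lemma is_iso_cmp:
  assumes "is_iso C X Y f" "is_iso C Y Z g" "X \<in> Ob C" "Y \<in> Ob C" "Z \<in> Ob C"
  shows "is_iso C X Z (g \<star> f)"
proof -
  obtain f' where f: "ar X Y f" "ar Y X f'" "f' \<star> f = Idt C X" "f \<star> f' = Idt C Y"
    using assms is_isoE by metis
  obtain g' where g: "ar Y Z g" "ar Z Y g'" "g' \<star> g = Idt C Y" "g \<star> g' = Idt C Z"
    using assms is_isoE by metis
  have "(f' \<star> g') \<star> (g \<star> f) = f' \<star> ((g' \<star> g) \<star> f)"
    by (simp add: cmp_assoc[OF ar_cmp[OF g(1) f(1)] g(2) f(2)] cmp_assoc[OF f(1) g(1,2)])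
  then have "(f' \<star> g') \<star> (g \<star> f) = Idt C X"
    using f g by simp
  moreover have "(g \<star> f) \<star> (f' \<star> g') = g \<star> ((f \<star> f') \<star> g')"
    by (simp add: cmp_assoc[OF ar_cmp[OF f(2) g(2)] f(1) g(1)] cmp_assoc[OF g(2) f(2,1)])
  then have "(g \<star> f) \<star> (f' \<star> g') = Idt C Z"
    using f g by simp
  ultimately show ?thesis
    using f g by (intro is_isoI[where g = "f' \<star> g'"]) auto
qed

lemma isomorphic_refl: "X \<in> Ob C \<Longrightarrow> isomorphic C X X"
  using is_iso_id isomorphic_def by metis

lemma isomorphic_sym: "\<lbrakk>isomorphic C X Y; X \<in> Ob C; Y \<in> Ob C\<rbrakk> \<Longrightarrow> isomorphic C Y X"
  using is_isoE isomorphic_def by metis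

lemma isomorphic_trans:
  "\<lbrakk>isomorphic C X Y; isomorphic C Y Z; X \<in> Ob C; Y \<in> Ob C; Z \<in> Ob C\<rbrakk> \<Longrightarrow> isomorphic C X Z"
  using is_iso_cmp isomorphic_def by metis

lemma iso_class_eq_iff:
  "\<lbrakk>X \<in> Ob C; Y \<in> Ob C\<rbrakk> \<Longrightarrow> iso_class C X = iso_class C Y \<longleftrightarrow> isomorphic C X Y"
  unfolding iso_class_def using isomorphic_refl isomorphic_sym isomorphic_trans by blast

lemma split_monoI: "\<lbrakk>ar X Y f; ar Y X r; r \<star> f = Idt C X\<rbrakk> \<Longrightarrow> split_mono C X Y f"
  by (auto simp: split_mono_def ar_def)

lemma split_monoE:
  assumes "split_mono C X Y f" "X \<in> Ob C" "Y \<in> Ob C"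
  obtains r where "ar X Y f" "ar Y X r" "r \<star> f = Idt C X"
  using assms by (auto simp: split_mono_def ar_def)

lemma split_epiI: "\<lbrakk>ar X Y f; ar Y X r; f \<star> r = Idt C Y\<rbrakk> \<Longrightarrow> split_epi C X Y f"
  by (auto simp: split_epi_def ar_def)

lemma split_epiE:
  assumes "split_epi C X Y f" "X \<in> Ob C" "Y \<in> Ob C"
  obtains r where "ar X Y f" "ar Y X r" "f \<star> r = Idt C Y"
  using assms by (auto simp: split_epi_def ar_def)

lemma split_op: "split_mono (op_cat C) X Y f \<longleftrightarrow> split_epi C Y X f"
  "split_epi (op_cat C) X Y f \<longleftrightarrow> split_mono C Y X f"
  by (auto simp: split_mono_def split_epi_def)

lemma is_iso_op: "is_iso (op_cat C) X Y f \<longleftrightarrow> is_iso C Y X f"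
  by (auto simp: is_iso_def)

lemma isomorphic_op: "\<lbrakk>X \<in> Ob C; Y \<in> Ob C\<rbrakk> \<Longrightarrow> isomorphic (op_cat C) X Y \<longleftrightarrow> isomorphic C X Y"
  using isomorphic_sym by (auto simp: isomorphic_def is_iso_op)

subsection \<open>Biproducts\<close>

text \<open>\<open>direct_sum\<close> with injections and projections named, since dualising makes
  them change places.\<close>

definition biprod where
  "biprod V Xs i p \<longleftrightarrow> V \<in> Ob C \<and> set Xs \<subseteq> Ob C \<and>
    (\<forall>k<length Xs. ar (Xs ! k) V (i k) \<and> ar V (Xs ! k) (p k)) \<and>
    (\<forall>k<length Xs. \<forall>j<length Xs. p k \<star> i j = (if k = j then Idt C (Xs ! k) else zr (Xs ! j) (Xs ! k))) \<and>
    finsum (Hom C V V) (\<lambda>k. i k \<star> p k) {..<length Xs} = Idt C V"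

lemma direct_sum_iff: "direct_sum C V Xs \<longleftrightarrow> (\<exists>i p. biprod V Xs i p)"
  unfolding direct_sum_def biprod_def ar_def
  by (auto simp: subset_iff; intro exI conjI; assumption)

lemma biprod_op: "linear_category.biprod (op_cat C) V Xs i p \<longleftrightarrow> biprod V Xs p i"
  unfolding linear_category.biprod_def[OF op_linear_category] biprod_def
  by (auto simp: ar_op)

lemma direct_sum_op: "direct_sum (op_cat C) V Xs \<longleftrightarrow> direct_sum C V Xs"
  unfolding direct_sum_iff linear_category.direct_sum_iff[OF op_linear_category] biprod_op by blast

lemma zero_object_op: "zero_object (op_cat C) X \<longleftrightarrow> zero_object C X"
  by (auto simp: zero_object_def)

lemma indecomposable_op: "indecomposable (op_cat C) X \<longleftrightarrow> indecomposable C X"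
  unfolding indecomposable_def direct_sum_op zero_object_op by simp

lemma biprodD:
  assumes "biprod V Xs i p"
  shows "V \<in> Ob C" "set Xs \<subseteq> Ob C" "k < length Xs \<Longrightarrow> ar (Xs ! k) V (i k)" "k < length Xs \<Longrightarrow> ar V (Xs ! k) (p k)"
    "k < length Xs \<Longrightarrow> p k \<star> i k = Idt C (Xs ! k)"
    "\<lbrakk>k < length Xs; j < length Xs; j \<noteq> k\<rbrakk> \<Longrightarrow> p k \<star> i j = zr (Xs ! j) (Xs ! k)"
  using assms unfolding biprod_def by auto

text \<open>Rests on f being the sum of the i_k p_k f. The closure form keeps finite sums out of
  later proofs: S = 0 gives uniqueness of maps into a biproduct, a linear span gives finite
  dimension, and a generated subfunctor gives the step in Nakayama's lemma.\<close>

lemma biprod_mem: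
  assumes b: "biprod V Xs i p" and f: "ar Y V f" and S: "S \<subseteq> Mor C Y V" "zr Y V \<in> S"
    "\<And>v w. \<lbrakk>v \<in> S; w \<in> S\<rbrakk> \<Longrightarrow> pls Y V v w \<in> S"
    and m: "\<And>k. k < length Xs \<Longrightarrow> i k \<star> (p k \<star> f) \<in> S"
  shows "f \<in> S"
proof -
  have YV: "Y \<in> Ob C" "V \<in> Ob C" using f arD by auto
  interpret L: linear_map K "Hom C V V" "Hom C Y V" "\<lambda>g. g \<star> f" using lin_l[OF YV(2) f] .
  have "f = Idt C V \<star> f" using f by simp
  also have "\<dots> = finsum (Hom C V V) (\<lambda>k. i k \<star> p k) {..<length Xs} \<star> f"
    using b by (simp add: biprod_def)
  also have "\<dots> = finsum (Hom C Y V) (\<lambda>k. (i k \<star> p k) \<star> f) {..<length Xs}"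
    using biprodD[OF b] by (intro linear_map_finsum[OF L.linear_map_axioms]) (auto intro!: arD(3)[OF ar_cmp])
  also have "\<dots> \<in> S"
    using m cmp_assoc[OF f biprodD(4)[OF b] biprodD(3)[OF b]]
    by (intro abelian_monoid.finsum_mem[OF abelian_group.axioms(1)[OF Hom_group[OF YV]]] S) auto
  finally show ?thesis .
qed

lemma biprod_eqI:
  assumes b: "biprod V Xs i p" and f: "ar Y V f" "ar Y V g" and e: "\<And>k. k < length Xs \<Longrightarrow> p k \<star> f = p k \<star> g"
  shows "f = g"
proof -
  have YV: "Y \<in> Ob C" "V \<in> Ob C" using f arD by auto
  have "mns Y V f g \<in> {zr Y V}"
  proof (rule biprod_mem[OF b])
    fix k assume k: "k < length Xs"
    have "p k \<star> mns Y V f g = zr Y (Xs ! k)"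
      using cmp_minus_r[OF biprodD(4)[OF b k] f] e[OF k] mns_self ar_cmp[OF biprodD(4)[OF b k] f(2)] by simp
    then show "i k \<star> (p k \<star> mns Y V f g) \<in> {zr Y V}"
      using cmp_zr_r[OF biprodD(3)[OF b k] YV(1)] by simp
  qed (use f YV in \<open>auto simp: arD(3)[OF ar_zr]\<close>)
  then show ?thesis using mns_eq_zrD[OF f] by simp
qed

lemma biprod_pair:
  assumes b: "biprod V Xs i p" and Y: "Y \<in> Ob C" and h: "\<And>k. k < length Xs \<Longrightarrow> ar Y (Xs ! k) (h k)"
  shows "\<exists>f. ar Y V f \<and> (\<forall>k<length Xs. p k \<star> f = h k)"
proof -
  have V: "V \<in> Ob C" using biprodD(1)[OF b] .
  interpret YV: abelian_group "Hom C Y V" using Hom_group[OF Y V] .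
  define f where "f = finsum (Hom C Y V) (\<lambda>k. i k \<star> h k) {..<length Xs}"
  have c: "(\<lambda>k. i k \<star> h k) \<in> {..<length Xs} \<rightarrow> Mor C Y V"
    using biprodD(3)[OF b] h by (auto intro!: arD(3)[OF ar_cmp])
  have f: "ar Y V f" unfolding f_def using c Y V by (auto simp: ar_def)
  moreover have "p k \<star> f = h k" if k: "k < length Xs" for k
  proof -
    have L: "linear_map K (Hom C Y V) (Hom C Y (Xs ! k)) (\<lambda>g. p k \<star> g)"
      using lin_r[OF Y biprodD(4)[OF b k]] .
    have W: "abelian_monoid (Hom C Y (Xs ! k))"
      using Hom_group[OF Y arD(2)[OF h[OF k]]] by (simp add: abelian_group_def)
    have "p k \<star> f = finsum (Hom C Y (Xs ! k)) (\<lambda>j. p k \<star> (i j \<star> h j)) {..<length Xs}"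
      unfolding f_def using c by (intro linear_map_finsum[OF L]) auto
    also have "\<dots> = finsum (Hom C Y (Xs ! k)) (\<lambda>j. if k = j then h j else zr Y (Xs ! k)) {..<length Xs}"
    proof (rule abelian_monoid.finsum_cong'[OF W])
      fix j assume j: "j \<in> {..<length Xs}"
      then have "p k \<star> (i j \<star> h j) = (p k \<star> i j) \<star> h j"
        using cmp_assoc biprodD(3)[OF b, of j] biprodD(4)[OF b k] h[of j] by simp
      then show "p k \<star> (i j \<star> h j) = (if k = j then h j else zr Y (Xs ! k))"
        using biprodD(5,6)[OF b] k j h[of j] cmp_zr_l[OF h[of j]] arD(2)[OF h[OF k]] by auto
    qed (use h k abelian_monoid.zero_closed[OF W] in \<open>auto simp: ar_def\<close>)
    also have "\<dots> = h k"
      using abelian_monoid.finsum_singleton[OF W, of k "{..<length Xs}" "\<lambda>j. if k = j then h j else zr Y (Xs ! k)"]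
        k arD(3)[OF h[OF k]] abelian_monoid.zero_closed[OF W]
      by (simp add: Pi_iff cong: if_cong)
    finally show ?thesis .
  qed
  ultimately show ?thesis by blast
qed

lemma biprod_copair:
  assumes b: "biprod V Xs i p" and Y: "Y \<in> Ob C" and h: "\<And>k. k < length Xs \<Longrightarrow> ar (Xs ! k) Y (h k)"
  shows "\<exists>f. ar V Y f \<and> (\<forall>k<length Xs. f \<star> i k = h k)"
  using linear_category.biprod_pair[OF op_linear_category, of V Xs p i Y h] assms
  by (simp add: biprod_op ar_op)

lemma biprod_coeqI:
  assumes b: "biprod V Xs i p" and f: "ar V Y f" "ar V Y g" and e: "\<And>k. k < length Xs \<Longrightarrow> f \<star> i k = g \<star> i k"
  shows "f = g"
  using linear_category.biprod_eqI[OF op_linear_category, of V Xs p i Y f g] assms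
  by (simp add: biprod_op ar_op)

end

section \<open>Krull-Schmidt categories\<close>

text \<open>All axioms are self-dual, so each lemma of the locale can be read in
  \<open>op_cat C\<close>. Finite dimension of all Hom spaces and locality of \<open>End X\<close>
  for every indecomposable X are extracted from the hypotheses in
  \<open>ks_categoryI\<close>.\<close>

locale ks_category = linear_category +
  assumes fin_dim_Hom: "\<lbrakk>X \<in> Ob C; Y \<in> Ob C\<rbrakk> \<Longrightarrow> vectorspace.fin_dim K (Hom C X Y)"
    and decomp: "V \<in> Ob C \<Longrightarrow> \<exists>Xs. direct_sum C V Xs \<and> (\<forall>X\<in>set Xs. indecomposable C X)"
    and local_End: "\<lbrakk>indecomposable C X; ar X X f; ar X X g; is_iso C X X (pls X X f g)\<rbrakk>
      \<Longrightarrow> is_iso C X X f \<or> is_iso C X X g"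
begin

lemma op_ks: "ks_category K (op_cat C)"
  by (intro ks_category.intro op_linear_category ks_category_axioms.intro)
    (simp_all add: fin_dim_Hom decomp direct_sum_op indecomposable_op is_iso_op
      linear_category.ar_def[OF op_linear_category] local_End ar_def)

text \<open>Locality applied to a + (1 - a) = 1. This is the form in which locality drives the
  idempotent argument, Nakayama's lemma and the left factorisation of Auslander-Reiten
  triangles.\<close>

lemma one_minus_iso:
  assumes X: "indecomposable C X" and a: "ar X X a" "\<not> is_iso C X X a"
  shows "is_iso C X X (mns X X (Idt C X) a)"
proof -
  have i: "ar X X (Idt C X)" using indecD(1)[OF X] by simp
  then have "is_iso C X X (pls X X a (mns X X (Idt C X) a))"
    using add_mns[OF a(1) i] is_iso_id[OF indecD(1)[OF X]] by simp
  then show ?thesis using local_End[OF X a(1) ar_mns[OF i a(1)]] a(2) by blast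
qed

text \<open>With a retraction r, the endomorphism e = f r of Z is idempotent. In a local ring either
  e is a unit, hence 1, or 1 - e is a unit, hence e = 0; the latter would make the identity of X
  vanish.\<close>

lemma split_mono_iso:
  assumes X: "indecomposable C X" and Z: "indecomposable C Z" and f: "split_mono C X Z f"
  shows "is_iso C X Z f"
proof -
  have o: "X \<in> Ob C" "Z \<in> Ob C" using X Z indecD by auto
  obtain r where r: "ar X Z f" "ar Z X r" "r \<star> f = Idt C X"
    using split_monoE[OF f o] .
  define e where "e = f \<star> r"
  have e: "ar Z Z e" unfolding e_def using r by auto
  have i: "ar Z Z (Idt C Z)" using o by simp
  have ef: "e \<star> f = f" unfolding e_def using cmp_assoc[OF r(1,2,1)] r by simp
  have ee: "e \<star> e = e"
    using cmp_assoc[OF r(2,1) e] ef unfolding e_def by simp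
  show ?thesis
  proof (cases "is_iso C Z Z e")
    case True
    then obtain g where g: "ar Z Z g" "g \<star> e = Idt C Z" using is_isoE[OF True o(2,2)] by metis
    have "e = (g \<star> e) \<star> e" using g e by simp
    also have "\<dots> = Idt C Z" using cmp_assoc[OF e e g(1)] ee g by simp
    finally show ?thesis using r unfolding e_def by (intro is_isoI[OF r(1,2)]) auto
  next
    case False
    then have "is_iso C Z Z (mns Z Z (Idt C Z) e)" using one_minus_iso[OF Z e] by simp
    then obtain g where g: "ar Z Z g" "g \<star> mns Z Z (Idt C Z) e = Idt C Z"
      using is_isoE[OF _ o(2,2)] by metis
    have "mns Z Z (Idt C Z) e \<star> e = zr Z Z"
      using cmp_minus_l[OF e i e] id_l[OF e] ee mns_self[OF e] by simp
    then have "e = g \<star> zr Z Z"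
      using cmp_assoc[OF e ar_mns[OF i e] g(1)] g(2) id_l[OF e] by simp
    then have "e = zr Z Z" using cmp_zr_r[OF g(1) o(2)] by simp
    then have "f = zr X Z" using ef cmp_zr_l[OF r(1) o(2)] by simp
    then have "Idt C X = zr X X" using r(3) cmp_zr_r[OF r(2) o(1)] by simp
    then show ?thesis using indecD(2)[OF X] by simp
  qed
qed

lemma split_epi_iso:
  assumes "indecomposable C X" "indecomposable C Z" "split_epi C X Z f"
  shows "is_iso C X Z f"
  using ks_category.split_mono_iso[OF op_ks, of Z X f] assms
  by (simp add: indecomposable_op split_op is_iso_op)

lemma iso_split: "is_iso C X Z f \<Longrightarrow> split_mono C X Z f" "is_iso C X Z f \<Longrightarrow> split_epi C X Z f"
  by (auto simp: is_iso_def split_mono_def split_epi_def)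

lemma split_iff_iso:
  assumes "indecomposable C X" "indecomposable C Z"
  shows "split_mono C X Z f \<longleftrightarrow> is_iso C X Z f" "split_epi C X Z f \<longleftrightarrow> is_iso C X Z f"
  using split_mono_iso split_epi_iso iso_split assms by blast+

text \<open>The radical morphisms, \<open>RM\<close> for indecomposable source and \<open>RE\<close> for indecomposable target; if both
  ends decompose, neither set need be closed under addition.\<close>

definition RM where "RM X Z = {f. ar X Z f \<and> \<not> split_mono C X Z f}"
definition RE where "RE X Z = {f. ar X Z f \<and> \<not> split_epi C X Z f}"

lemma RE_op: "ks_category.RM (op_cat C) X Z = RE Z X" "ks_category.RE (op_cat C) X Z = RM Z X"
  unfolding ks_category.RM_def[OF op_ks] ks_category.RE_def[OF op_ks] RM_def RE_def
  by (auto simp: ar_op split_op)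

lemma RM_RE: "\<lbrakk>indecomposable C X; indecomposable C Z\<rbrakk> \<Longrightarrow> RE X Z = RM X Z"
  unfolding RM_def RE_def using split_iff_iso by blast

lemma RM_cmp: "\<lbrakk>f \<in> RM X Z; ar Z Z' g\<rbrakk> \<Longrightarrow> g \<star> f \<in> RM X Z'"
proof -
  assume f: "f \<in> RM X Z" and g: "ar Z Z' g"
  have f': "ar X Z f" using f by (simp add: RM_def)
  have "\<not> split_mono C X Z' (g \<star> f)"
  proof
    assume "split_mono C X Z' (g \<star> f)"
    then obtain r where r: "ar Z' X r" "r \<star> (g \<star> f) = Idt C X"
      using split_monoE arD[OF f'] arD[OF g] by metis
    then have "(r \<star> g) \<star> f = Idt C X" using cmp_assoc[OF f' g r(1)] by simp
    then have "split_mono C X Z f" using split_monoI[OF f' ar_cmp[OF r(1) g]] by simp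
    then show False using f by (simp add: RM_def)
  qed
  then show ?thesis using f' g by (auto simp: RM_def)
qed

text \<open>If f k were a split monomorphism, so would be k; between indecomposables k is then
  invertible, and cancelling it makes f split. Indecomposability of both W and X enters
  here.\<close>

lemma RM_precmp:
  assumes "indecomposable C W" "indecomposable C X" "f \<in> RM X Z" "ar W X k"
  shows "f \<star> k \<in> RM W Z"
proof -
  have f': "ar X Z f" using assms by (simp add: RM_def)
  have "\<not> split_mono C W Z (f \<star> k)"
  proof
    assume "split_mono C W Z (f \<star> k)"
    then obtain r where r: "ar Z W r" "r \<star> (f \<star> k) = Idt C W"
      using split_monoE arD[OF f'] arD[OF assms(4)] by metis
    then have rf: "(r \<star> f) \<star> k = Idt C W" using cmp_assoc[OF assms(4) f' r(1)] by simp
    then have "split_mono C W X k" using split_monoI[OF assms(4) ar_cmp[OF r(1) f']] by simp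
    then have "is_iso C W X k" using split_mono_iso assms by blast
    then obtain k' where k': "ar X W k'" "k \<star> k' = Idt C X"
      using is_isoE[OF _ arD(1,2)[OF assms(4)]] by metis
    have "r \<star> f = ((r \<star> f) \<star> k) \<star> k'"
      using cmp_assoc[OF k'(1) assms(4) ar_cmp[OF r(1) f']] k'(2) id_r[OF ar_cmp[OF r(1) f']] by simp
    then have "r \<star> f = k'" using rf id_l[OF k'(1)] by simp
    then have "(k \<star> r) \<star> f = Idt C X" using cmp_assoc[OF f' r(1) assms(4)] k'(2) by simp
    then have "split_mono C X Z f" using split_monoI[OF f' ar_cmp[OF assms(4) r(1)]] by simp
    then show False using assms by (simp add: RM_def)
  qed
  then show ?thesis using f' assms(4) by (auto simp: RM_def)
qed

text \<open>A retraction r of v + w gives r v + r w = 1 in the local ring \<open>End X\<close>, so r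
  v or r w is invertible and v or w already splits. Scalars act as composition with a multiple of
  the identity of Z.\<close>

lemma RM_subspace:
  assumes X: "indecomposable C X" and Z: "Z \<in> Ob C"
  shows "subspace K (RM X Z) (Hom C X Z)"
proof (rule subspaceI)
  have o: "X \<in> Ob C" using X indecD by blast
  show "vectorspace K (Hom C X Z)" using vs o Z .
  show "RM X Z \<subseteq> Mor C X Z" by (auto simp: RM_def ar_def)
  show "zr X Z \<in> RM X Z"
  proof -
    have "\<not> split_mono C X Z (zr X Z)"
      using split_monoE[OF _ o Z] cmp_zr_r[OF _ o] indecD(2)[OF X] by metis
    then show ?thesis using o Z by (simp add: RM_def)
  qed
  fix v w assume vw: "v \<in> RM X Z" "w \<in> RM X Z"
  then have a: "ar X Z v" "ar X Z w" by (auto simp: RM_def)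
  have "\<not> split_mono C X Z (pls X Z v w)"
  proof
    assume "split_mono C X Z (pls X Z v w)"
    then obtain r where r: "ar Z X r" "r \<star> pls X Z v w = Idt C X"
      using split_monoE[OF _ o Z] by metis
    then have "is_iso C X X (pls X X (r \<star> v) (r \<star> w))"
      using cmp_add_r[OF r(1) a] is_iso_id[OF o] by simp
    then have "is_iso C X X (r \<star> v) \<or> is_iso C X X (r \<star> w)"
      using local_End[OF X ar_cmp[OF r(1) a(1)] ar_cmp[OF r(1) a(2)]] by simp
    moreover have "r \<star> v \<in> RM X X" "r \<star> w \<in> RM X X" using RM_cmp vw r by auto
    ultimately show False using iso_split by (auto simp: RM_def)
  qed
  then show "pls X Z v w \<in> RM X Z" using a by (auto simp: RM_def)
next
  have o: "X \<in> Ob C" using X indecD by blast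
  fix c v assume c: "c \<in> carrier K" and v: "v \<in> RM X Z"
  have z: "ar Z Z (c \<odot>\<^bsub>Hom C Z Z\<^esub> Idt C Z)" using c Z by auto
  have "c \<odot>\<^bsub>Hom C X Z\<^esub> v = (c \<odot>\<^bsub>Hom C Z Z\<^esub> Idt C Z) \<star> v"
    using cmp_smult_l[OF c, of X Z v Z "Idt C Z"] v Z id_l[of X Z v] by (simp add: RM_def)
  then show "c \<odot>\<^bsub>Hom C X Z\<^esub> v \<in> RM X Z" using RM_cmp[OF v z] by simp
qed

lemma Mor_subspace: "\<lbrakk>X \<in> Ob C; Z \<in> Ob C\<rbrakk> \<Longrightarrow> subspace K (Mor C X Z) (Hom C X Z)"
proof -
  assume o: "X \<in> Ob C" "Z \<in> Ob C"
  interpret vectorspace K "Hom C X Z" using vs o .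
  show ?thesis by (rule subspaceI) (auto intro: vectorspace_axioms)
qed

section \<open>Dimensions of Hom spaces and radicals\<close>

definition sd where "sd X Y S = sdim K (Hom C X Y) S"
definition hd where "hd X Y = sd X Y (Mor C X Y)"
definition rd where "rd X Y = sd X Y (RM X Y)"
text \<open>The dimension of the residue division ring of \<open>End X\<close>, that is of
  \<open>End X\<close> modulo its radical.\<close>

definition dl where "dl X = hd X X - rd X X"

lemma sd_post:
  assumes "ar Y Z g" "subspace K S (Hom C X Y)" "X \<in> Ob C"
  shows "subspace K ((\<lambda>f. g \<star> f) ` S) (Hom C X Z)"
    "subspace K {f \<in> S. g \<star> f = zr X Z} (Hom C X Y)"
    "sd X Y S = sd X Z ((\<lambda>f. g \<star> f) ` S) + sd X Y {f \<in> S. g \<star> f = zr X Z}"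
  using linear_map.sdim_image_kernel[OF lin_r[OF assms(3,1)] fin_dim_Hom assms(2)] assms arD
  unfolding sd_def by auto

lemma sd_mono:
  assumes "X \<in> Ob C" "Y \<in> Ob C" "subspace K S (Hom C X Y)" "subspace K S' (Hom C X Y)" "S \<subseteq> S'"
  shows "sd X Y S \<le> sd X Y S'" "sd X Y S = sd X Y S' \<Longrightarrow> S = S'"
  using vectorspace.sdim_mono[OF vs fin_dim_Hom] assms unfolding sd_def by blast+

lemma sd_zr: "\<lbrakk>X \<in> Ob C; Y \<in> Ob C\<rbrakk> \<Longrightarrow> sd X Y {zr X Y} = 0"
  unfolding sd_def using vectorspace.sdim_zero[OF vs] .

lemma rd_le_hd: "\<lbrakk>indecomposable C X; Y \<in> Ob C\<rbrakk> \<Longrightarrow> rd X Y \<le> hd X Y"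
  unfolding rd_def hd_def
  by (intro sd_mono(1) RM_subspace Mor_subspace indecD(1)[of X]) (auto simp: RM_def ar_def)

lemma dl_pos: "indecomposable C X \<Longrightarrow> dl X > 0"
proof -
  assume X: "indecomposable C X"
  have o: "X \<in> Ob C" using X indecD by blast
  have "RM X X \<noteq> Mor C X X"
    using iso_split(1)[OF is_iso_id[OF o]] id_in_Mor[OF o] unfolding RM_def by blast
  then have "rd X X \<noteq> hd X X"
    unfolding rd_def hd_def using sd_mono(2)[OF o o RM_subspace[OF X o] Mor_subspace[OF o o]] subspaceD(1)[OF RM_subspace[OF X o]] by blast
  then show ?thesis using rd_le_hd[OF X o] unfolding dl_def by simp
qed

text \<open>The common kernels T k of the first k projections filter S V, and the k-th projection
  maps T k onto S (Xs ! k), because S is closed under composition with the injections. It is applied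
  to S = all morphisms and to S = the radical.\<close>

lemma sd_sum:
  assumes b: "biprod V Xs i p" and X: "X \<in> Ob C"
    and S: "\<And>Z. Z \<in> Ob C \<Longrightarrow> subspace K (S Z) (Hom C X Z)"
    and cl: "\<And>Y Z f g. \<lbrakk>f \<in> S Y; ar Y Z g\<rbrakk> \<Longrightarrow> g \<star> f \<in> S Z"
  shows "sd X V (S V) = (\<Sum>k<length Xs. sd X (Xs ! k) (S (Xs ! k)))"
proof -
  note bD = biprodD[OF b]
  have V: "V \<in> Ob C" using bD(1) .
  define T where "T k = {f \<in> S V. \<forall>j<k. p j \<star> f = zr X (Xs ! j)}" for k
  have Sar: "ar X Z f" if "f \<in> S Z" "Z \<in> Ob C" for f Z
    using subspaceD(1)[OF S[OF that(2)]] that X by (auto simp: ar_def)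
  have main: "subspace K (T k) (Hom C X V) \<and>
    sd X V (S V) = (\<Sum>j<k. sd X (Xs ! j) (S (Xs ! j))) + sd X V (T k)" if "k \<le> length Xs" for k
    using that
  proof (induct k)
    case 0
    have "T 0 = S V" by (auto simp: T_def)
    then show ?case using S[OF V] by simp
  next
    case (Suc k)
    then have k: "k < length Xs" and sub: "subspace K (T k) (Hom C X V)" by auto
    have ker: "{f \<in> T k. p k \<star> f = zr X (Xs ! k)} = T (Suc k)"
      by (auto simp: T_def less_Suc_eq)
    have im: "(\<lambda>f. p k \<star> f) ` T k = S (Xs ! k)"
    proof
      show "(\<lambda>f. p k \<star> f) ` T k \<subseteq> S (Xs ! k)" using cl[OF _ bD(4)[OF k]] by (auto simp: T_def)
      show "S (Xs ! k) \<subseteq> (\<lambda>f. p k \<star> f) ` T k"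
      proof
        fix g assume g: "g \<in> S (Xs ! k)"
        have gX: "ar X (Xs ! k) g" using Sar[OF g] arD(2)[OF bD(4)[OF k]] by simp
        have "p k \<star> (i k \<star> g) = g" using cmp_assoc[OF gX bD(3)[OF k] bD(4)[OF k]] bD(5)[OF k] gX by simp
        moreover have "p j \<star> (i k \<star> g) = zr X (Xs ! j)" if "j < k" for j
        proof -
          have j: "j < length Xs" using that k by simp
          show ?thesis using cmp_assoc[OF gX bD(3)[OF k] bD(4)[OF j]] bD(6)[OF j k] that
              cmp_zr_l[OF gX arD(2)[OF bD(4)[OF j]]] by simp
        qed
        ultimately show "g \<in> (\<lambda>f. p k \<star> f) ` T k"
          using cl[OF g bD(3)[OF k]] by (intro image_eqI[where x = "i k \<star> g"]) (auto simp: T_def)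
      qed
    qed
    show ?case
      using sd_post[OF bD(4)[OF k] sub X] Suc k unfolding ker im by simp
  qed
  have "T (length Xs) = {zr X V}"
  proof -
    have "f = zr X V" if f: "f \<in> T (length Xs)" for f
    proof (rule biprod_eqI[OF b])
      show "ar X V f" using f Sar[OF _ V] by (simp add: T_def)
      show "ar X V (zr X V)" using X V by simp
      show "p k \<star> f = p k \<star> zr X V" if "k < length Xs" for k
        using f that cmp_zr_r[OF bD(4)[OF that] X] by (simp add: T_def)
    qed
    moreover have "zr X V \<in> T (length Xs)"
      using subspaceD(2)[OF S[OF V]] cmp_zr_r[OF bD(4) X] by (simp add: T_def)
    ultimately show ?thesis by blast
  qed
  then show ?thesis using main[of "length Xs"] sd_zr[OF X V] by simp
qed

lemma hd_sum:
  assumes "biprod V Xs i p" "X \<in> Ob C"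
  shows "hd X V = (\<Sum>k<length Xs. hd X (Xs ! k))"
  unfolding hd_def
proof (rule sd_sum[OF assms, where S = "Mor C X"])
  show "g \<star> f \<in> Mor C X Z" if "f \<in> Mor C X Y" "ar Y Z g" for Y Z f g
    using arD(3)[OF ar_cmp[OF that(2), of X f]] that arD[OF that(2)] assms(2) by (simp add: ar_def)
qed (rule Mor_subspace[OF assms(2)])

lemma rd_sum:
  assumes "biprod V Xs i p" "indecomposable C X"
  shows "rd X V = (\<Sum>k<length Xs. rd X (Xs ! k))"
  unfolding rd_def
proof (rule sd_sum[OF assms(1) indecD(1)[OF assms(2)], where S = "RM X"])
  show "g \<star> f \<in> RM X Z" if "f \<in> RM X Y" "ar Y Z g" for Y Z f g
    using that by (rule RM_cmp)
qed (rule RM_subspace[OF assms(2)])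

lemma hd_post_iso:
  assumes "is_iso C Y Z g" "X \<in> Ob C" "Y \<in> Ob C" "Z \<in> Ob C"
    and S: "subspace K S (Hom C X Y)"
  shows "sd X Z ((\<lambda>f. g \<star> f) ` S) = sd X Y S"
proof -
  obtain g' where g: "ar Y Z g" "ar Z Y g'" "g' \<star> g = Idt C Y"
    using is_isoE[OF assms(1,3,4)] by metis
  have "f = zr X Y" if "f \<in> S" "g \<star> f = zr X Z" for f
  proof -
    have f: "ar X Y f" using subspaceD(1)[OF S] that assms by (auto simp: ar_def)
    then have "f = g' \<star> (g \<star> f)" using cmp_assoc[OF f g(1,2)] g by simp
    then show ?thesis using that cmp_zr_r[OF g(2) assms(2)] by simp
  qed
  then have "{f \<in> S. g \<star> f = zr X Z} = {zr X Y}"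
    using subspaceD(2)[OF S] cmp_zr_r[OF g(1) assms(2)] by blast
  then show ?thesis using sd_post(3)[OF g(1) S assms(2)] sd_zr assms by simp
qed

lemma iso_image:
  assumes g: "is_iso C Y Z g" "Y \<in> Ob C" "Z \<in> Ob C" and X: "X \<in> Ob C"
  shows "(\<lambda>f. g \<star> f) ` Mor C X Y = Mor C X Z"
    "(\<lambda>f. g \<star> f) ` RM X Y = RM X Z"
proof -
  obtain g' where h: "ar Y Z g" "ar Z Y g'" "g' \<star> g = Idt C Y" "g \<star> g' = Idt C Z"
    using is_isoE[OF g] by metis
  have e: "f = g \<star> (g' \<star> f)" if "ar X Z f" for f
    using cmp_assoc[OF that h(2,1)] h that by simp
  show "(\<lambda>f. g \<star> f) ` Mor C X Y = Mor C X Z"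
  proof (intro equalityI subsetI)
    fix f assume "f \<in> Mor C X Z"
    then have f: "ar X Z f" using X g(3) by (simp add: ar_def)
    show "f \<in> (\<lambda>f. g \<star> f) ` Mor C X Y"
      using e[OF f] arD(3)[OF ar_cmp[OF h(2) f]] by (rule image_eqI)
  next
    fix f assume "f \<in> (\<lambda>f. g \<star> f) ` Mor C X Y"
    then obtain k where "k \<in> Mor C X Y" "f = g \<star> k" by blast
    then show "f \<in> Mor C X Z" using arD(3)[OF ar_cmp[OF h(1), of X k]] X g(2) by (simp add: ar_def)
  qed
  show "(\<lambda>f. g \<star> f) ` RM X Y = RM X Z"
  proof (intro equalityI subsetI)
    fix f assume f: "f \<in> RM X Z"
    then have "ar X Z f" by (simp add: RM_def)
    from e[OF this] RM_cmp[OF f h(2)] show "f \<in> (\<lambda>f. g \<star> f) ` RM X Y"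
      by (rule image_eqI)
  qed (use RM_cmp[OF _ h(1)] in blast)
qed

lemma hd_iso: "\<lbrakk>isomorphic C Y Z; X \<in> Ob C; Y \<in> Ob C; Z \<in> Ob C\<rbrakk> \<Longrightarrow> hd X Z = hd X Y"
  using hd_post_iso[OF _ _ _ _ Mor_subspace, of Y Z _ X] iso_image(1)[of Y Z _ X]
  unfolding isomorphic_def hd_def by force

lemma rd_iso: "\<lbrakk>isomorphic C Y Z; indecomposable C X; Y \<in> Ob C; Z \<in> Ob C\<rbrakk> \<Longrightarrow> rd X Z = rd X Y"
  using hd_post_iso[OF _ _ _ _ RM_subspace, of Y Z _ X] iso_image(2)[of Y Z _ X] indecD(1)[of X]
  unfolding isomorphic_def rd_def by force

lemma RM_noniso: "\<lbrakk>indecomposable C X; indecomposable C Y; \<not> isomorphic C X Y\<rbrakk> \<Longrightarrow> RM X Y = Mor C X Y"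
  using split_iff_iso indecD(1) unfolding RM_def isomorphic_def ar_def by blast

lemma hd_rd_indec:
  assumes X: "indecomposable C X" and Y: "indecomposable C Y"
  shows "hd X Y = rd X Y + (if isomorphic C X Y then dl X else 0)"
proof (cases "isomorphic C X Y")
  case True
  have o: "X \<in> Ob C" "Y \<in> Ob C" using X Y indecD by auto
  show ?thesis using True hd_iso[OF True o(1,1,2)] rd_iso[OF True X o] rd_le_hd[OF X o(1)]
    by (simp add: dl_def)
next
  case False
  then show ?thesis using RM_noniso[OF X Y] by (simp add: hd_def rd_def)
qed

text \<open>Hom modulo radical vanishes between non-isomorphic indecomposables, so only the summands
  isomorphic to X contribute, each with \<open>dl X\<close>. As \<open>dl X\<close> is positive, the
  multiplicity does not depend on the decomposition used to count it.\<close>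

lemma hd_rd_mult:
  assumes X: "indecomposable C X" and m: "multiplicity_in C X V n"
  shows "hd X V = rd X V + n * dl X"
proof -
  obtain Xs i p where Xs: "biprod V Xs i p" "\<forall>Y\<in>set Xs. indecomposable C Y"
    "n = length (filter (isomorphic C X) Xs)"
    using m unfolding multiplicity_in_def direct_sum_iff by blast
  have "hd X V = (\<Sum>k<length Xs. rd X (Xs ! k) + (if isomorphic C X (Xs ! k) then dl X else 0))"
    unfolding hd_sum[OF Xs(1) indecD(1)[OF X]] using hd_rd_indec[OF X] Xs(2) by (intro sum.cong) auto
  also have "\<dots> = rd X V + (\<Sum>k<length Xs. if isomorphic C X (Xs ! k) then dl X else 0)"
    by (simp add: sum.distrib rd_sum[OF Xs(1) X])
  also have "(\<Sum>k<length Xs. if isomorphic C X (Xs ! k) then dl X else 0) = n * dl X"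
    unfolding Xs(3) by (simp add: length_filter_conv_card sum.If_cases Int_def conj_commute)
  finally show ?thesis .
qed

lemma multiplicity_ex: "V \<in> Ob C \<Longrightarrow> \<exists>n. multiplicity_in C X V n"
  using decomp unfolding multiplicity_in_def by blast

lemma multiplicity_op: "\<lbrakk>X \<in> Ob C\<rbrakk> \<Longrightarrow> multiplicity_in (op_cat C) X V n \<longleftrightarrow> multiplicity_in C X V n"
proof -
  assume X: "X \<in> Ob C"
  have "length (filter (isomorphic (op_cat C) X) Xs) = length (filter (isomorphic C X) Xs)"
    if "\<forall>Y\<in>set Xs. indecomposable C Y" for Xs
    using that isomorphic_op[OF X] indecD(1) by (intro arg_cong[where f = length] filter_cong) auto
  then show ?thesis unfolding multiplicity_in_def direct_sum_op indecomposable_op by metis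
qed

end

section \<open>Radical square and the two almost split properties\<close>

context ks_category
begin

text \<open>Sums of composites need no separate closure, as the middle object may decompose.\<close>

definition rad2 where "rad2 X Y = {h \<star> g | Z g h. g \<in> RM X Z \<and> h \<in> RE Z Y}"
definition irr where "irr X Y = rd X Y - sd X Y (rad2 X Y)"

text \<open>The two halves of the defining property of an Auslander-Reiten triangle, freed from the shift and
  interchanged by passing to the opposite category.\<close>

definition ras where
  "ras U V W u v \<longleftrightarrow> indecomposable C U \<and> indecomposable C W \<and> u \<in> RM U V \<and> v \<in> RE V W \<and> v \<star> u = zr U W \<and>
    (\<forall>X. \<forall>f\<in>RE X W. \<exists>g. ar X V g \<and> f = v \<star> g) \<and>
    (\<forall>X g. ar X V g \<longrightarrow> v \<star> g = zr X W \<longrightarrow> (\<exists>h. ar X U h \<and> g = u \<star> h))"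

definition las where
  "las U V W u v \<longleftrightarrow> indecomposable C U \<and> indecomposable C W \<and> u \<in> RM U V \<and> v \<in> RE V W \<and> v \<star> u = zr U W \<and>
    (\<forall>X. \<forall>f\<in>RM U X. \<exists>g. ar V X g \<and> f = g \<star> u) \<and>
    (\<forall>X g. ar V X g \<longrightarrow> g \<star> u = zr U X \<longrightarrow> (\<exists>h. ar W X h \<and> g = h \<star> v))"

lemma rasD:
  assumes "ras U V W u v"
  shows "indecomposable C U" "indecomposable C W" "ar U V u" "ar V W v" "v \<star> u = zr U W"
    "U \<in> Ob C" "V \<in> Ob C" "W \<in> Ob C"
    "\<And>X f. f \<in> RE X W \<Longrightarrow> \<exists>g. ar X V g \<and> f = v \<star> g"
    "\<And>X g. \<lbrakk>ar X V g; v \<star> g = zr X W\<rbrakk> \<Longrightarrow> \<exists>h. ar X U h \<and> g = u \<star> h"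
    "u \<in> RM U V" "v \<in> RE V W"
  using assms arD unfolding ras_def RM_def RE_def by auto

lemma ras_op: "ks_category.ras (op_cat C) W V U v u \<longleftrightarrow> las U V W u v"
  unfolding ks_category.ras_def[OF op_ks] las_def RE_op indecomposable_op ar_op by auto

lemma hd_op: "ks_category.hd K (op_cat C) X Y = hd Y X"
  by (simp add: hd_def sd_def ks_category.hd_def[OF op_ks] ks_category.sd_def[OF op_ks])

lemma rd_op: "\<lbrakk>indecomposable C X; indecomposable C Y\<rbrakk> \<Longrightarrow> ks_category.rd K (op_cat C) X Y = rd Y X"
  by (simp add: rd_def sd_def ks_category.rd_def[OF op_ks] ks_category.sd_def[OF op_ks] RE_op RM_RE)

lemma dl_op: "indecomposable C X \<Longrightarrow> ks_category.dl K (op_cat C) X = dl X"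
  by (simp add: dl_def ks_category.dl_def[OF op_ks] hd_op rd_op)

lemma rad2_op: "ks_category.rad2 (op_cat C) X Y = rad2 Y X"
  unfolding rad2_def ks_category.rad2_def[OF op_ks] RE_op by auto

lemma irr_op: "\<lbrakk>indecomposable C X; indecomposable C Y\<rbrakk> \<Longrightarrow> ks_category.irr K (op_cat C) X Y = irr Y X"
  by (simp add: irr_def ks_category.irr_def[OF op_ks] rd_op rad2_op sd_def ks_category.sd_def[OF op_ks])

text \<open>Composition with v carries Hom(X, V) onto the radical and the radical onto its square,
  with the same kernel both times: a morphism killed by v factors through the radical morphism u.
  Hence rad/rad^2 (X, W) is Hom/rad (X, V).\<close>

lemma ras_images:
  assumes r: "ras U V W u v" and X: "indecomposable C X"
  shows "(\<lambda>f. v \<star> f) ` Mor C X V = RM X W" "(\<lambda>f. v \<star> f) ` RM X V = rad2 X W"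
    "{f \<in> Mor C X V. v \<star> f = zr X W} = {f \<in> RM X V. v \<star> f = zr X W}"
proof -
  note D = rasD[OF r]
  have o: "X \<in> Ob C" using X indecD by blast
  have vne: "\<not> split_epi C V W v" using D(12) by (simp add: RE_def)
  have vf: "v \<star> f \<in> RE X W" if "ar X V f" for f
  proof -
    have "\<not> split_epi C X W (v \<star> f)"
    proof
      assume "split_epi C X W (v \<star> f)"
      then obtain s where s: "ar W X s" "(v \<star> f) \<star> s = Idt C W" using split_epiE[OF _ o D(8)] by metis
      then have "v \<star> (f \<star> s) = Idt C W" using cmp_assoc[OF s(1) that D(4)] by simp
      then show False using vne split_epiI[OF D(4) ar_cmp[OF that s(1)]] by blast
    qed
    then show ?thesis using ar_cmp[OF D(4) that] by (simp add: RE_def)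
  qed
  show "(\<lambda>f. v \<star> f) ` Mor C X V = RM X W"
  proof (intro equalityI subsetI)
    fix f assume "f \<in> RM X W"
    then obtain g where "ar X V g" "f = v \<star> g" using D(9) RM_RE[OF X D(2)] by blast
    then show "f \<in> (\<lambda>f. v \<star> f) ` Mor C X V" using arD(3) by blast
  next
    fix f assume "f \<in> (\<lambda>f. v \<star> f) ` Mor C X V"
    then show "f \<in> RM X W" using vf RM_RE[OF X D(2)] o D(7) by (auto simp: ar_def)
  qed
  show "(\<lambda>f. v \<star> f) ` RM X V = rad2 X W"
  proof (intro equalityI subsetI)
    fix f assume "f \<in> rad2 X W"
    then obtain Z g h where gh: "f = h \<star> g" "g \<in> RM X Z" "h \<in> RE Z W" unfolding rad2_def by blast
    then obtain k where k: "ar Z V k" "h = v \<star> k" using D(9) by blast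
    have "ar X Z g" using gh by (simp add: RM_def)
    from cmp_assoc[OF this k(1) D(4)] have "f = v \<star> (k \<star> g)" using gh k by simp
    then show "f \<in> (\<lambda>f. v \<star> f) ` RM X V" using RM_cmp[OF gh(2) k(1)] by blast
  next
    fix f assume "f \<in> (\<lambda>f. v \<star> f) ` RM X V"
    then show "f \<in> rad2 X W" unfolding rad2_def using D(12) by blast
  qed
  have "f \<in> RM X V" if f: "f \<in> Mor C X V" "v \<star> f = zr X W" for f
  proof -
    have fa: "ar X V f" using f(1) o D(7) by (simp add: ar_def)
    obtain h where h: "ar X U h" "f = u \<star> h" using D(10)[OF fa f(2)] by blast
    then show ?thesis using RM_precmp[OF X D(1) D(11) h(1)] by simp
  qed
  then show "{f \<in> Mor C X V. v \<star> f = zr X W} = {f \<in> RM X V. v \<star> f = zr X W}"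
    by (auto simp: RM_def ar_def)
qed

text \<open>Rank-nullity for Hom(X, V) and for rad(X, V), whose kernels coincide by
  \<open>ras_images\<close>. That \<open>rad2 X W\<close> is closed under addition comes from its
  being the image of a subspace.\<close>

lemma ras_rad2:
  assumes r: "ras U V W u v" and X: "indecomposable C X"
  shows "subspace K (rad2 X W) (Hom C X W)" "rad2 X W \<subseteq> RM X W"
    "hd X V + sd X W (rad2 X W) = rd X V + rd X W"
proof -
  note D = rasD[OF r]
  have o: "X \<in> Ob C" using X indecD by blast
  show "subspace K (rad2 X W) (Hom C X W)"
    using sd_post(1)[OF D(4) RM_subspace[OF X D(7)] o] ras_images(2)[OF r X] by simp
  show "rad2 X W \<subseteq> RM X W"
  proof -
    have "RM X V \<subseteq> Mor C X V" by (auto simp: RM_def ar_def)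
    then have "(\<lambda>f. v \<star> f) ` RM X V \<subseteq> (\<lambda>f. v \<star> f) ` Mor C X V" by (rule image_mono)
    then show ?thesis unfolding ras_images(1,2)[OF r X] .
  qed
  have "hd X V = rd X W + sd X V {f \<in> Mor C X V. v \<star> f = zr X W}"
    using sd_post(3)[OF D(4) Mor_subspace[OF o D(7)] o] ras_images(1)[OF r X]
    by (simp add: hd_def rd_def)
  moreover have "rd X V = sd X W (rad2 X W) + sd X V {f \<in> RM X V. v \<star> f = zr X W}"
    using sd_post(3)[OF D(4) RM_subspace[OF X D(7)] o] ras_images(2)[OF r X]
    by (simp add: rd_def)
  ultimately show "hd X V + sd X W (rad2 X W) = rd X V + rd X W"
    using ras_images(3)[OF r X] by simp
qed

lemma ras_irr:
  assumes "ras U V W u v" "indecomposable C X" "multiplicity_in C X V n"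
  shows "irr X W = n * dl X"
  using ras_rad2(3)[OF assms(1,2)] hd_rd_mult[OF assms(2,3)] unfolding irr_def by simp

text \<open>Together with \<open>ras_irr\<close> it computes the same number \<open>irr X Y\<close>
  from both sides: for an arrow with label (a, b) it is a times \<open>dl X\<close> and also b times
  \<open>dl Y\<close>.\<close>

lemma las_irr:
  assumes l: "las U V W u v" and X: "indecomposable C X" and m: "multiplicity_in C X V n"
  shows "irr U X = n * dl X"
proof -
  have U: "indecomposable C U" using l by (simp add: las_def)
  have "ks_category.irr K (op_cat C) X U = n * ks_category.dl K (op_cat C) X"
    using ks_category.ras_irr[OF op_ks, of W V U v u X n] l X m
    by (simp add: ras_op indecomposable_op multiplicity_op indecD(1))
  then show ?thesis by (simp add: irr_op[OF X U] dl_op[OF X])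
qed

lemma irreducible_iff:
  assumes "indecomposable C X" "indecomposable C Y"
  shows "irreducible_mor C X Y f \<longleftrightarrow> f \<in> RM X Y - rad2 X Y"
proof -
  have o: "X \<in> Ob C" "Y \<in> Ob C" using assms indecD by auto
  have "(\<exists>Z\<in>Ob C. \<exists>g\<in>Mor C X Z. \<exists>h\<in>Mor C Z Y. f = h \<star> g \<and> \<not> split_mono C X Z g \<and> \<not> split_epi C Z Y h) \<longleftrightarrow>
      f \<in> rad2 X Y"
    unfolding rad2_def RM_def RE_def ar_def using o by blast
  moreover have "f \<in> Mor C X Y \<and> \<not> split_mono C X Y f \<and> \<not> split_epi C X Y f \<longleftrightarrow> f \<in> RM X Y"
    using RM_RE[OF assms] o unfolding RM_def RE_def ar_def by blast
  ultimately show ?thesis unfolding irreducible_mor_def by blast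
qed

lemma irr_pos_iff:
  assumes X: "indecomposable C X" and r: "ras U V W u v"
  shows "irr X W \<noteq> 0 \<longleftrightarrow> (\<exists>f. irreducible_mor C X W f)"
proof -
  note D = rasD[OF r]
  have o: "X \<in> Ob C" using X indecD by blast
  note R = ras_rad2[OF r X]
  have "sd X W (rad2 X W) \<le> rd X W" "sd X W (rad2 X W) = rd X W \<Longrightarrow> rad2 X W = RM X W"
    using sd_mono[OF o D(8) R(1) RM_subspace[OF X D(8)] R(2)] unfolding rd_def by auto
  then have "irr X W \<noteq> 0 \<longleftrightarrow> rad2 X W \<noteq> RM X W"
    unfolding irr_def rd_def by auto
  then show ?thesis using R(2) irreducible_iff[OF X D(2)] by blast
qed

lemma ras_subadditive:
  assumes r: "ras U V W u v" and M: "M \<in> Ob C"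
  shows "hd M V \<le> hd M U + hd M W" "M = W \<Longrightarrow> hd M V < hd M U + hd M W"
proof -
  note D = rasD[OF r]
  note MV = Mor_subspace[OF M D(7)] and MU = Mor_subspace[OF M D(6)] and MW = Mor_subspace[OF M D(8)]
  note V = sd_post[OF D(4) MV M] and U = sd_post[OF D(3) MU M]
  have "{f \<in> Mor C M V. v \<star> f = zr M W} \<subseteq> (\<lambda>f. u \<star> f) ` Mor C M U"
  proof
    fix f assume "f \<in> {f \<in> Mor C M V. v \<star> f = zr M W}"
    then obtain h where "ar M U h" "f = u \<star> h" using D(7,10) M by (auto simp: ar_def)
    then show "f \<in> (\<lambda>f. u \<star> f) ` Mor C M U" using arD(3) by blast
  qed
  then have 1: "sd M V {f \<in> Mor C M V. v \<star> f = zr M W} \<le> hd M U"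
    using sd_mono(1)[OF M D(7) V(2) U(1)] U(3) unfolding hd_def by simp
  have sub: "(\<lambda>f. v \<star> f) ` Mor C M V \<subseteq> Mor C M W"
    using ar_cmp[OF D(4)] M D(7) unfolding ar_def by blast
  then have 2: "sd M W ((\<lambda>f. v \<star> f) ` Mor C M V) \<le> hd M W"
    using sd_mono(1)[OF M D(8) V(1) MW] unfolding hd_def by simp
  show "hd M V \<le> hd M U + hd M W" using 1 2 V(3) unfolding hd_def by simp
  assume MW': "M = W"
  have "Idt C W \<notin> (\<lambda>f. v \<star> f) ` Mor C W V"
  proof
    assume "Idt C W \<in> (\<lambda>f. v \<star> f) ` Mor C W V"
    then obtain s where "ar W V s" "v \<star> s = Idt C W" using D(7,8) by (auto simp: ar_def)
    then show False using split_epiI[OF D(4)] D(12) by (simp add: RE_def)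
  qed
  then have "(\<lambda>f. v \<star> f) ` Mor C M V \<noteq> Mor C M W" using MW' id_in_Mor[OF M] by blast
  then have "sd M W ((\<lambda>f. v \<star> f) ` Mor C M V) < hd M W"
    using sd_mono(2)[OF M D(8) V(1) MW sub] 2 unfolding hd_def by fastforce
  then show "hd M V < hd M U + hd M W" using 1 V(3) unfolding hd_def by simp
qed

text \<open>A triangle is given for one representative of an isomorphism class only. Its end term is
  moved to any other representative while U, V and u stay fixed.\<close>

lemma ras_iso:
  assumes r: "ras U V W u v" and i: "isomorphic C W W'" and W': "indecomposable C W'"
  shows "\<exists>v'. ras U V W' u v'"
proof -
  note D = rasD[OF r]
  have o: "W' \<in> Ob C" using W' indecD by blast
  obtain t where "is_iso C W W' t" using i unfolding isomorphic_def by blast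
  then obtain s where t: "ar W W' t" "ar W' W s" "s \<star> t = Idt C W" "t \<star> s = Idt C W'"
    using is_isoE[OF _ D(8) o] by metis
  have st: "s \<star> (t \<star> f) = f" if "ar X W f" for X f using cmp_assoc[OF that t(1,2)] t that by simp
  have ts: "t \<star> (s \<star> f) = f" if "ar X W' f" for X f using cmp_assoc[OF that t(2,1)] t that by simp
  have E: "s \<star> f \<in> RE X W" if f: "f \<in> RE X W'" for X f
  proof -
    have fa: "ar X W' f" using f by (simp add: RE_def)
    have "\<not> split_epi C X W (s \<star> f)"
    proof
      assume "split_epi C X W (s \<star> f)"
      then obtain q where q: "ar W X q" "(s \<star> f) \<star> q = Idt C W"
        using split_epiE[OF _ arD(1)[OF fa] D(8)] by metis
      have "s \<star> (f \<star> q) = Idt C W" using cmp_assoc[OF q(1) fa t(2)] q(2) by simp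
      then have "f \<star> q = t" using ts[OF ar_cmp[OF fa q(1)]] id_r[OF t(1)] by simp
      then have "f \<star> (q \<star> s) = Idt C W'" using cmp_assoc[OF t(2) q(1) fa] t(4) by simp
      then show False using split_epiI[OF fa ar_cmp[OF q(1) t(2)]] f by (simp add: RE_def)
    qed
    then show ?thesis using ar_cmp[OF t(2) fa] by (simp add: RE_def)
  qed
  have "ras U V W' u (t \<star> v)"
    unfolding ras_def
  proof (intro conjI allI ballI impI)
    show "t \<star> v \<in> RE V W'"
    proof -
      have "\<not> split_epi C V W' (t \<star> v)"
      proof
        assume "split_epi C V W' (t \<star> v)"
        then obtain q where q: "ar W' V q" "(t \<star> v) \<star> q = Idt C W'"
          using split_epiE[OF _ D(7) o] by metis
        have "t \<star> (v \<star> q) = Idt C W'" using cmp_assoc[OF q(1) D(4) t(1)] q(2) by simp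
        then have "v \<star> q = s" using st[OF ar_cmp[OF D(4) q(1)]] id_r[OF t(2)] by simp
        then have "v \<star> (q \<star> t) = Idt C W" using cmp_assoc[OF t(1) q(1) D(4)] t(3) by simp
        then show False using split_epiI[OF D(4) ar_cmp[OF q(1) t(1)]] D(12) by (simp add: RE_def)
      qed
      then show ?thesis using ar_cmp[OF t(1) D(4)] by (simp add: RE_def)
    qed
    show "t \<star> v \<star> u = zr U W'"
      using cmp_assoc[OF D(3,4) t(1)] D(5) cmp_zr_r[OF t(1) D(6)] by simp
    fix X f assume f: "f \<in> RE X W'"
    then have fa: "ar X W' f" by (simp add: RE_def)
    obtain g where g: "ar X V g" "s \<star> f = v \<star> g" using D(9)[OF E[OF f]] by blast
    then have "f = t \<star> v \<star> g" using ts[OF fa] cmp_assoc[OF g(1) D(4) t(1)] by simp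
    then show "\<exists>g. ar X V g \<and> f = t \<star> v \<star> g" using g by blast
  next
    fix X g assume g: "ar X V g" "t \<star> v \<star> g = zr X W'"
    then have "v \<star> g = zr X W"
      using st[OF ar_cmp[OF D(4) g(1)]] cmp_assoc[OF g(1) D(4) t(1)] cmp_zr_r[OF t(2) arD(1)[OF g(1)]] by simp
    then show "\<exists>h. ar X U h \<and> g = u \<star> h" using D(10) g by blast
  qed (use D W' in auto)
  then show ?thesis by blast
qed

lemma las_iso:
  assumes l: "las U V W u v" and i: "isomorphic C U U'" and U': "indecomposable C U'"
  shows "\<exists>u'. las U' V W u' v"
proof -
  have "isomorphic (op_cat C) U U'"
    using i isomorphic_op l U' indecD(1) by (simp add: las_def)
  then show ?thesis
    using ks_category.ras_iso[OF op_ks, of W V U v u U'] l U' by (simp add: ras_op indecomposable_op)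
qed

lemma multiplicity_iso:
  assumes "multiplicity_in C X V n" "isomorphic C X X'" "X \<in> Ob C" "X' \<in> Ob C"
  shows "multiplicity_in C X' V n"
proof -
  have "isomorphic C X Y = isomorphic C X' Y" if "indecomposable C Y" for Y
    using assms(2-4) indecD(1)[OF that] isomorphic_sym isomorphic_trans by blast
  then have "filter (isomorphic C X) Xs = filter (isomorphic C X') Xs" if "\<forall>Y\<in>set Xs. indecomposable C Y" for Xs
    using that by (intro filter_cong) auto
  then show ?thesis using assms(1) unfolding multiplicity_in_def by metis
qed

subsection \<open>A Nakayama lemma\<close>

text \<open>The subfunctor of Hom(Y, -) generated by the morphisms of a list, each paired with its
  target. Recursion on the list isolates the coefficient of the head, the generator that Nakayama's
  argument removes.\<close>

primrec spn where
  "spn Y [] Z = {zr Y Z}"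
| "spn Y (x # G) Z = {pls Y Z (a \<star> snd x) s | a s. ar (fst x) Z a \<and> s \<in> spn Y G Z}"

lemma spn_ar:
  assumes "Y \<in> Ob C" "\<forall>x\<in>set G. ar Y (fst x) (snd x)" "Z \<in> Ob C" "s \<in> spn Y G Z"
  shows "ar Y Z s"
  using assms by (induct G arbitrary: s) auto

lemma spn_zr:
  assumes "Y \<in> Ob C" "\<forall>x\<in>set G. ar Y (fst x) (snd x)" "Z \<in> Ob C"
  shows "zr Y Z \<in> spn Y G Z"
  using assms
proof (induct G)
  case (Cons x G)
  then have "zr Y Z = pls Y Z (zr (fst x) Z \<star> snd x) (zr Y Z)"
    using cmp_zr_l[of Y "fst x" "snd x" Z] by simp
  moreover have "ar (fst x) Z (zr (fst x) Z)" using Cons arD(2)[of Y "fst x" "snd x"] by simp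
  ultimately show ?case using Cons by auto
qed simp

lemma spn_pls:
  assumes "Y \<in> Ob C" "\<forall>x\<in>set G. ar Y (fst x) (snd x)" "Z \<in> Ob C" "s \<in> spn Y G Z" "t \<in> spn Y G Z"
  shows "pls Y Z s t \<in> spn Y G Z"
  using assms
proof (induct G arbitrary: s t)
  case (Cons x G)
  obtain a s' b t' where st: "s = pls Y Z (a \<star> snd x) s'" "ar (fst x) Z a" "s' \<in> spn Y G Z"
    "t = pls Y Z (b \<star> snd x) t'" "ar (fst x) Z b" "t' \<in> spn Y G Z"
    using Cons(5,6) by auto
  have x: "ar Y (fst x) (snd x)" using Cons by simp
  have ok: "\<forall>x\<in>set G. ar Y (fst x) (snd x)" using Cons(3) by simp
  have s't': "ar Y Z s'" "ar Y Z t'"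
    using spn_ar[OF Cons(2) ok Cons(4) st(3)] spn_ar[OF Cons(2) ok Cons(4) st(6)] .
  interpret abelian_group "Hom C Y Z" using Hom_group Cons by blast
  have "pls Y Z s t = pls Y Z (pls (fst x) Z a b \<star> snd x) (pls Y Z s' t')"
    using st cmp_add_l[OF x st(2,5)] s't' ar_cmp[OF st(2) x] ar_cmp[OF st(5) x]
    by (simp add: ar_def a_ac)
  moreover have "ar (fst x) Z (pls (fst x) Z a b)" using st by auto
  moreover have "pls Y Z s' t' \<in> spn Y G Z" using Cons(1)[OF Cons(2) ok Cons(4) st(3,6)] .
  ultimately show ?case by auto
qed simp

lemma spn_cmp:
  assumes "Y \<in> Ob C" "\<forall>x\<in>set G. ar Y (fst x) (snd x)" "s \<in> spn Y G Z" "ar Z Z' g"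
  shows "g \<star> s \<in> spn Y G Z'"
  using assms
proof (induct G arbitrary: s)
  case (Cons x G)
  obtain a s' where s: "s = pls Y Z (a \<star> snd x) s'" "ar (fst x) Z a" "s' \<in> spn Y G Z"
    using Cons(4) by auto
  have x: "ar Y (fst x) (snd x)" using Cons by simp
  have ok: "\<forall>x\<in>set G. ar Y (fst x) (snd x)" using Cons(3) by simp
  have s': "ar Y Z s'" using spn_ar[OF Cons(2) ok arD(1)[OF Cons(5)] s(3)] .
  have "g \<star> s = pls Y Z' ((g \<star> a) \<star> snd x) (g \<star> s')"
    using s cmp_add_r[OF Cons(5) ar_cmp[OF s(2) x] s'] cmp_assoc[OF x s(2) Cons(5)] by simp
  moreover have "ar (fst x) Z' (g \<star> a)" using ar_cmp[OF Cons(5) s(2)] .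
  moreover have "g \<star> s' \<in> spn Y G Z'" using Cons(1)[OF Cons(2) ok s(3) Cons(5)] .
  ultimately show ?case by auto
qed (use cmp_zr_r in simp)

lemma spn_gen:
  assumes "Y \<in> Ob C" "\<forall>x\<in>set G. ar Y (fst x) (snd x)" "(Z, g) \<in> set G"
  shows "g \<in> spn Y G Z"
  using assms
proof (induct G)
  case (Cons x G)
  have x: "ar Y (fst x) (snd x)" using Cons by simp
  have g: "ar Y Z g" using Cons(3,4) by force
  have Z: "Z \<in> Ob C" using g arD by blast
  show ?case
  proof (cases "x = (Z, g)")
    case True
    then have "g = pls Y Z (Idt C Z \<star> snd x) (zr Y Z)" using g by simp
    moreover have "zr Y Z \<in> spn Y G Z" using spn_zr Cons Z by simp
    moreover have "ar (fst x) Z (Idt C Z)" using True Z by simp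
    ultimately show ?thesis by auto
  next
    case False
    then have "g \<in> spn Y G Z" using Cons by simp
    moreover have "g = pls Y Z (zr (fst x) Z \<star> snd x) g"
      using cmp_zr_l[OF x Z] g by simp
    moreover have "ar (fst x) Z (zr (fst x) Z)" using x Z arD(2) by blast
    ultimately show ?thesis by auto
  qed
qed simp

lemma mns_pls: "\<lbrakk>ar X Y f; ar X Y g\<rbrakk> \<Longrightarrow> mns X Y (pls X Y f g) f = g"
proof -
  assume a: "ar X Y f" "ar X Y g"
  then interpret abelian_group "Hom C X Y" by (intro Hom_group arD)
  have "f \<oplus>\<^bsub>Hom C X Y\<^esub> g \<ominus>\<^bsub>Hom C X Y\<^esub> f = g \<oplus>\<^bsub>Hom C X Y\<^esub> (f \<ominus>\<^bsub>Hom C X Y\<^esub> f)"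
    using a by (simp add: ar_def minus_eq a_ac)
  then show ?thesis using a mns_self[OF a(1)] by simp
qed

text \<open>Generators are eliminated one by one. The head g' factors as v g, and g = a g' + s with
  s in the span of the others, so (1 - v a) g' = v s. As v is no split epimorphism, v a is not
  invertible and 1 - v a is, whence g' lies in the span of the others.\<close>

lemma nakayama_list:
  assumes Y: "Y \<in> Ob C" and P: "\<And>Z. Z \<in> P \<Longrightarrow> indecomposable C Z"
    and fac: "\<And>Z. Z \<in> P \<Longrightarrow> \<exists>V Xs v. direct_sum C V Xs \<and> set Xs \<subseteq> P \<and> v \<in> RE V Z \<and>
      (\<forall>f. ar Y Z f \<longrightarrow> (\<exists>g. ar Y V g \<and> f = v \<star> g))"
    and G: "\<And>x. x \<in> set G \<Longrightarrow> fst x \<in> P \<and> ar Y (fst x) (snd x)"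
    and gen: "\<And>Z f. \<lbrakk>Z \<in> P; ar Y Z f\<rbrakk> \<Longrightarrow> f \<in> spn Y G Z"
    and f: "Z \<in> P" "ar Y Z f"
  shows "f = zr Y Z"
  using G gen
proof (induct G)
  case Nil
  then show ?case using f by auto
next
  case (Cons x G)
  let ?Z = "fst x" and ?g = "snd x"
  have x: "?Z \<in> P" "ar Y ?Z ?g" and okx: "\<forall>y\<in>set (x # G). ar Y (fst y) (snd y)"
    and ok: "\<forall>y\<in>set G. ar Y (fst y) (snd y)"
    using Cons by auto
  have Z: "?Z \<in> Ob C" using x arD by blast
  obtain V Xs v where V: "direct_sum C V Xs" "set Xs \<subseteq> P" "v \<in> RE V ?Z"
    "\<forall>f. ar Y ?Z f \<longrightarrow> (\<exists>g. ar Y V g \<and> f = v \<star> g)"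
    using fac[OF x(1)] by blast
  obtain i p where b: "biprod V Xs i p" using V(1) direct_sum_iff by blast
  obtain g where g: "ar Y V g" "?g = v \<star> g" using V(4) x(2) by blast
  have v: "ar V ?Z v" "\<not> split_epi C V ?Z v" using V(3) by (auto simp: RE_def)
  have Vo: "V \<in> Ob C" using v arD by blast
  \<comment> \<open>V itself need not belong to P, so generation is applied to the components of g,
    whose targets do.\<close>
  have "g \<in> spn Y (x # G) V"
  proof (rule biprod_mem[OF b g(1)])
    show "spn Y (x # G) V \<subseteq> Mor C Y V" using spn_ar[OF Y okx Vo] arD(3) by blast
    show "zr Y V \<in> spn Y (x # G) V" using spn_zr[OF Y okx Vo] .
    show "pls Y V s t \<in> spn Y (x # G) V" if "s \<in> spn Y (x # G) V" "t \<in> spn Y (x # G) V" for s t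
      using spn_pls[OF Y okx Vo] that .
    fix k assume k: "k < length Xs"
    have "p k \<star> g \<in> spn Y (x # G) (Xs ! k)"
    proof (rule Cons(3)[OF _ ar_cmp[OF biprodD(4)[OF b k] g(1)]])
      show "Xs ! k \<in> P" using V(2) nth_mem[OF k] by blast
    qed
    then show "i k \<star> (p k \<star> g) \<in> spn Y (x # G) V"
      using spn_cmp[OF Y okx _ biprodD(3)[OF b k]] by blast
  qed
  then obtain a s where as: "g = pls Y V (a \<star> ?g) s" "ar ?Z V a" "s \<in> spn Y G V" by auto
  have s: "ar Y V s" using spn_ar[OF Y ok Vo as(3)] .
  have ba: "ar ?Z ?Z (v \<star> a)" and i: "ar ?Z ?Z (Idt C ?Z)" using v as Z by auto
  have "\<not> is_iso C ?Z ?Z (v \<star> a)"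
  proof
    assume "is_iso C ?Z ?Z (v \<star> a)"
    then obtain q where q: "ar ?Z ?Z q" "(v \<star> a) \<star> q = Idt C ?Z" using is_isoE[OF _ Z Z] by metis
    then have "v \<star> (a \<star> q) = Idt C ?Z" using cmp_assoc[OF q(1) as(2) v(1)] by simp
    then show False using split_epiI[OF v(1) ar_cmp[OF as(2) q(1)]] v(2) by blast
  qed
  then have "is_iso C ?Z ?Z (mns ?Z ?Z (Idt C ?Z) (v \<star> a))" using one_minus_iso[OF P[OF x(1)] ba] by simp
  then obtain q where q: "ar ?Z ?Z q" "q \<star> mns ?Z ?Z (Idt C ?Z) (v \<star> a) = Idt C ?Z"
    using is_isoE[OF _ Z Z] by metis
  have gg: "?g = pls Y ?Z ((v \<star> a) \<star> ?g) (v \<star> s)"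
  proof -
    have "?g = v \<star> pls Y V (a \<star> ?g) s" by (rule trans[OF g(2) arg_cong[OF as(1), of "\<lambda>g. v \<star> g"]])
    also have "\<dots> = pls Y ?Z ((v \<star> a) \<star> ?g) (v \<star> s)"
      using cmp_add_r[OF v(1) ar_cmp[OF as(2) x(2)] s] cmp_assoc[OF x(2) as(2) v(1)] by simp
    finally show ?thesis .
  qed
  have "mns ?Z ?Z (Idt C ?Z) (v \<star> a) \<star> ?g = mns Y ?Z ?g ((v \<star> a) \<star> ?g)"
    using cmp_minus_l[OF x(2) i ba] x(2) by simp
  also have "\<dots> = v \<star> s"
    using mns_pls[OF ar_cmp[OF ba x(2)] ar_cmp[OF v(1) s]] gg by simp
  finally have "q \<star> (v \<star> s) = ?g"
    using cmp_assoc[OF x(2) ar_mns[OF i ba] q(1)] q(2) x(2) by simp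
  then have gG: "?g \<in> spn Y G ?Z"
    using spn_cmp[OF Y ok spn_cmp[OF Y ok as(3) v(1)] q(1)] by simp
  show ?case
  proof (rule Cons(1))
    fix Z' f' assume Z': "Z' \<in> P" "ar Y Z' f'"
    then obtain a' s' where "f' = pls Y Z' (a' \<star> ?g) s'" "ar ?Z Z' a'" "s' \<in> spn Y G Z'"
      using Cons(3)[OF Z'] by auto
    then show "f' \<in> spn Y G Z'"
      using spn_pls[OF Y ok _ spn_cmp[OF Y ok gG]] arD(2) by metis
  qed (use Cons in auto)
qed

text \<open>Finite generation comes from finitely many representatives: spanning sets of the spaces
  Hom(Y, Z), with Z in R, generate the functor on all of P.\<close>

lemma nakayama:
  assumes Y: "Y \<in> Ob C" and P: "\<And>Z. Z \<in> P \<Longrightarrow> indecomposable C Z"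
    and fac: "\<And>Z. Z \<in> P \<Longrightarrow> \<exists>V Xs v. direct_sum C V Xs \<and> set Xs \<subseteq> P \<and> v \<in> RE V Z \<and>
      (\<forall>f. ar Y Z f \<longrightarrow> (\<exists>g. ar Y V g \<and> f = v \<star> g))"
    and R: "finite R" "R \<subseteq> P" "\<And>Z. Z \<in> P \<Longrightarrow> \<exists>Z'\<in>R. isomorphic C Z' Z"
    and Z: "Z \<in> P"
  shows "Mor C Y Z = {zr Y Z}"
proof -
  have "\<exists>A. finite A \<and> A \<subseteq> Mor C Y Z \<and> module.span K (Hom C Y Z) A = Mor C Y Z" if "Z \<in> R" for Z
  proof -
    have o: "Z \<in> Ob C" using that R(2) indecD(1)[OF P] by blast
    show ?thesis using fin_dim_Hom[OF Y o] vectorspace.fin_dim_def[OF vs[OF Y o]] by simp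
  qed
  then obtain A where A: "\<And>Z. Z \<in> R \<Longrightarrow> finite (A Z)" "\<And>Z. Z \<in> R \<Longrightarrow> A Z \<subseteq> Mor C Y Z"
    "\<And>Z. Z \<in> R \<Longrightarrow> module.span K (Hom C Y Z) (A Z) = Mor C Y Z"
    by metis
  have "finite (Sigma R A)" using R(1) A(1) by auto
  then obtain G where G: "set G = Sigma R A" using finite_list by blast
  have ok: "\<forall>x\<in>set G. ar Y (fst x) (snd x)"
    using A(2) R(2) P indecD(1) Y by (fastforce simp: G ar_def)
  have *: "f \<in> spn Y G Z" if that: "Z \<in> P" "ar Y Z f" for Z f
  proof -
    obtain Z' t where Z': "Z' \<in> R" "is_iso C Z' Z t"
      using R(3)[OF \<open>Z \<in> P\<close>] unfolding isomorphic_def by blast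
    have o: "Z' \<in> Ob C" "Z \<in> Ob C" using indecD(1)[OF P] R(2) Z'(1) that(1) by auto
    obtain s where t: "ar Z' Z t" "ar Z Z' s" "t \<star> s = Idt C Z" using is_isoE[OF Z'(2) o] by metis
    have "A Z' \<subseteq> spn Y G Z'" using spn_gen[OF Y ok] Z' G by auto
    moreover have "subspace K (spn Y G Z') (Hom C Y Z')"
    proof (rule subspaceI[OF vs[OF Y o(1)]])
      show "spn Y G Z' \<subseteq> Mor C Y Z'" using spn_ar[OF Y ok o(1)] arD(3) by blast
      show "c \<odot>\<^bsub>Hom C Y Z'\<^esub> v \<in> spn Y G Z'" if "c \<in> carrier K" "v \<in> spn Y G Z'" for c v
      proof -
        have "c \<odot>\<^bsub>Hom C Y Z'\<^esub> v = (c \<odot>\<^bsub>Hom C Z' Z'\<^esub> Idt C Z') \<star> v"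
          using cmp_smult_l[OF that(1) spn_ar[OF Y ok o(1) that(2)] ar_id[OF o(1)]]
            spn_ar[OF Y ok o(1) that(2)] by simp
        then show ?thesis
          using spn_cmp[OF Y ok that(2) ar_smult[OF that(1) ar_id[OF o(1)]]] by simp
      qed
    qed (use spn_zr[OF Y ok o(1)] spn_pls[OF Y ok o(1)] in auto)
    ultimately have "module.span K (Hom C Y Z') (A Z') \<subseteq> spn Y G Z'"
      using module.span_is_subset[OF Hom_module[OF Y o(1)]] by (auto simp: subspace_def)
    then have "s \<star> f \<in> spn Y G Z'" using A(3)[OF Z'(1)] arD(3)[OF ar_cmp[OF t(2) that(2)]] by blast
    then have "t \<star> (s \<star> f) \<in> spn Y G Z" using spn_cmp[OF Y ok _ t(1)] by blast
    then show ?thesis using cmp_assoc[OF that(2) t(2,1)] t(3) that(2) by simp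
  qed
  have "f = zr Y Z" if "f \<in> Mor C Y Z" for f
  proof (rule nakayama_list[OF Y P fac _ * Z])
    show "fst x \<in> P \<and> ar Y (fst x) (snd x)" if "x \<in> set G" for x
      using that ok G R(2) by auto
    show "ar Y Z f" using that Y P[OF Z] indecD(1) by (simp add: ar_def)
  qed
  moreover have "zr Y Z \<in> Mor C Y Z" using ar_zr[OF Y indecD(1)[OF P[OF Z]]] arD(3) by blast
  ultimately show ?thesis by blast
qed

end

section \<open>Auslander-Reiten triangles\<close>

lemma linear_mapI:
  assumes "vectorspace K V" "vectorspace K W" "\<And>v. v \<in> carrier V \<Longrightarrow> T v \<in> carrier W"
    "\<And>v w. \<lbrakk>v \<in> carrier V; w \<in> carrier V\<rbrakk> \<Longrightarrow> T (v \<oplus>\<^bsub>V\<^esub> w) = T v \<oplus>\<^bsub>W\<^esub> T w"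
    "\<And>c v. \<lbrakk>c \<in> carrier K; v \<in> carrier V\<rbrakk> \<Longrightarrow> T (c \<odot>\<^bsub>V\<^esub> v) = c \<odot>\<^bsub>W\<^esub> T v"
  shows "linear_map K V W T"
  using assms by (intro linear_map.intro mod_hom.intro mod_hom_axioms.intro)
    (simp_all add: vectorspace_def module_hom_def Pi_iff)

lemma linear_map_comp:
  assumes "linear_map K U V S" "linear_map K V W T"
  shows "linear_map K U W (\<lambda>x. T (S x))"
  using linear_mapD[OF assms(1)] linear_mapD[OF assms(2)] assms
  by (intro linear_mapI) (simp_all add: linear_map_def)

section \<open>From the Krull-Schmidt hypothesis to \<open>ks_category\<close>\<close>

context linear_category
begin

text \<open>Since \<open>hom_finite\<close> speaks of indecomposables only, spanning sets of the
  Hom(Y, X_k) are pushed along the injections to span Hom(Y, V).\<close>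

lemma fin_dim_biprod:
  assumes b: "biprod V Xs i p" and Y: "Y \<in> Ob C"
    and fd: "\<And>k. k < length Xs \<Longrightarrow> vectorspace.fin_dim K (Hom C Y (Xs ! k))"
  shows "vectorspace.fin_dim K (Hom C Y V)"
proof -
  note bD = biprodD[OF b]
  have o: "Xs ! k \<in> Ob C" if "k < length Xs" for k using bD(2) that nth_mem by blast
  have "\<exists>A. finite A \<and> A \<subseteq> Mor C Y (Xs ! k) \<and> module.span K (Hom C Y (Xs ! k)) A = Mor C Y (Xs ! k)"
    if "k < length Xs" for k
    using fd[OF that] vectorspace.fin_dim_def[OF vs[OF Y o[OF that]]] by simp
  then obtain A where A: "\<And>k. k < length Xs \<Longrightarrow> finite (A k)" "\<And>k. k < length Xs \<Longrightarrow> A k \<subseteq> Mor C Y (Xs ! k)"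
    "\<And>k. k < length Xs \<Longrightarrow> module.span K (Hom C Y (Xs ! k)) (A k) = Mor C Y (Xs ! k)"
    by metis
  define B where "B = (\<Union>k<length Xs. (\<lambda>f. i k \<star> f) ` A k)"
  interpret YV: vectorspace K "Hom C Y V" using vs[OF Y bD(1)] .
  have Bsub: "B \<subseteq> Mor C Y V"
  proof
    fix x assume "x \<in> B"
    then obtain k f where k: "k < length Xs" "f \<in> A k" "x = i k \<star> f" unfolding B_def by blast
    then have "ar Y (Xs ! k) f" using A(2) o Y by (auto simp: ar_def)
    then show "x \<in> Mor C Y V" using k(3) arD(3)[OF ar_cmp[OF bD(3)[OF k(1)]]] by simp
  qed
  have S: "submodule K (YV.span B) (Hom C Y V)" using YV.span_is_submodule[OF Bsub] .
  have "Mor C Y V \<subseteq> YV.span B"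
  proof
    fix f assume "f \<in> Mor C Y V"
    then have f: "ar Y V f" using Y bD(1) by (simp add: ar_def)
    show "f \<in> YV.span B"
    proof (rule biprod_mem[OF b f])
      show "YV.span B \<subseteq> Mor C Y V" "zr Y V \<in> YV.span B"
        "\<And>v w. v \<in> YV.span B \<Longrightarrow> w \<in> YV.span B \<Longrightarrow> pls Y V v w \<in> YV.span B"
        using S by (auto simp: submodule_def)
      fix k assume k: "k < length Xs"
      interpret L: linear_map K "Hom C Y (Xs ! k)" "Hom C Y V" "\<lambda>f. i k \<star> f"
        using lin_r[OF Y bD(3)[OF k]] .
      define N where "N = {g \<in> Mor C Y (Xs ! k). i k \<star> g \<in> YV.span B}"
      have "subspace K N (Hom C Y (Xs ! k))"
        using S by (intro subspaceI vs[OF Y o[OF k]]) (auto simp: N_def submodule_def)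
      then have N: "submodule K N (Hom C Y (Xs ! k))" by (simp add: subspace_def)
      have "A k \<subseteq> N" using A(2)[OF k] YV.in_own_span[OF Bsub] k by (auto simp: N_def B_def)
      then have "Mor C Y (Xs ! k) \<subseteq> N"
        using module.span_is_subset[OF Hom_module[OF Y o[OF k]] _ N] A(3)[OF k] by blast
      then show "i k \<star> (p k \<star> f) \<in> YV.span B"
        using arD(3)[OF ar_cmp[OF bD(4)[OF k] f]] by (auto simp: N_def)
    qed
  qed
  then have "YV.span B = Mor C Y V" using YV.span_is_subset2[OF Bsub] by blast
  moreover have "finite B" unfolding B_def using A(1) by auto
  ultimately show ?thesis using YV.fin_dim_def Bsub by blast
qed

lemma fin_dim_biprod_left:
  assumes b: "biprod V Xs i p" and Y: "Y \<in> Ob C"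
    and fd: "\<And>k. k < length Xs \<Longrightarrow> vectorspace.fin_dim K (Hom C (Xs ! k) Y)"
  shows "vectorspace.fin_dim K (Hom C V Y)"
  using linear_category.fin_dim_biprod[OF op_linear_category, of V Xs p i Y] assms
  by (simp add: biprod_op)

text \<open>Collects all summands but the first into one object, which makes the definition of
  indecomposability by binary sums applicable to a decomposition of any length.\<close>

lemma biprod_split:
  assumes b: "biprod V (X # Xs) i p" and b': "biprod B Xs i' p'"
  shows "direct_sum C V [X, B]"
proof -
  note D = biprodD[OF b] and D' = biprodD[OF b']
  have o: "V \<in> Ob C" "B \<in> Ob C" "X \<in> Ob C" using D(1,2) D'(1) by auto
  have i: "ar X V (i 0)" "ar V X (p 0)" "p 0 \<star> i 0 = Idt C X" using D(3-5)[of 0] by auto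
  have isk: "ar (Xs ! k) V (i (Suc k))" "ar V (Xs ! k) (p (Suc k))" if "k < length Xs" for k
    using D(3,4)[of "Suc k"] that by auto
  have p0i: "p 0 \<star> i (Suc k) = zr (Xs ! k) X" "p (Suc k) \<star> i 0 = zr X (Xs ! k)" if "k < length Xs" for k
    using D(6)[of 0 "Suc k"] D(6)[of "Suc k" 0] that by auto
  have pis: "p (Suc k) \<star> i (Suc l) = p' k \<star> i' l" if "k < length Xs" "l < length Xs" for k l
    using D(5)[of "Suc k"] D(6)[of "Suc k" "Suc l"] D'(5)[of k] D'(6)[of k l] that by (cases "k = l") auto
  obtain j where j: "ar B V j" "\<And>k. k < length Xs \<Longrightarrow> j \<star> i' k = i (Suc k)"
    using biprod_copair[OF b' o(1), of "\<lambda>k. i (Suc k)"] isk(1) by blast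
  obtain q where q: "ar V B q" "\<And>k. k < length Xs \<Longrightarrow> p' k \<star> q = p (Suc k)"
    using biprod_pair[OF b' o(1), of "\<lambda>k. p (Suc k)"] isk(2) by blast
  have pj: "p (Suc k) \<star> j = p' k" if k: "k < length Xs" for k
  proof (rule biprod_coeqI[OF b' ar_cmp[OF isk(2)[OF k] j(1)] D'(4)[OF k]])
    fix l assume l: "l < length Xs"
    show "p (Suc k) \<star> j \<star> i' l = p' k \<star> i' l"
      using cmp_assoc[OF D'(3)[OF l] j(1) isk(2)[OF k]] j(2)[OF l] pis[OF k l] by simp
  qed
  have p0j: "p 0 \<star> j = zr B X"
  proof (rule biprod_coeqI[OF b' ar_cmp[OF i(2) j(1)] ar_zr[OF o(2,3)]])
    fix l assume l: "l < length Xs"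
    show "p 0 \<star> j \<star> i' l = zr B X \<star> i' l"
      using cmp_assoc[OF D'(3)[OF l] j(1) i(2)] j(2)[OF l] p0i(1)[OF l] cmp_zr_l[OF D'(3)[OF l] o(3)] by simp
  qed
  have qj: "q \<star> j = Idt C B"
  proof (rule biprod_eqI[OF b' ar_cmp[OF q(1) j(1)] ar_id[OF o(2)]])
    fix k assume k: "k < length Xs"
    show "p' k \<star> (q \<star> j) = p' k \<star> Idt C B"
      using cmp_assoc[OF j(1) q(1) D'(4)[OF k]] q(2)[OF k] pj[OF k] D'(4)[OF k] by simp
  qed
  have qi: "q \<star> i 0 = zr X B"
  proof (rule biprod_eqI[OF b' ar_cmp[OF q(1) i(1)] ar_zr[OF o(3,2)]])
    fix k assume k: "k < length Xs"
    show "p' k \<star> (q \<star> i 0) = p' k \<star> zr X B"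
      using cmp_assoc[OF i(1) q(1) D'(4)[OF k]] q(2)[OF k] p0i(2)[OF k] cmp_zr_r[OF D'(4)[OF k] o(3)] by simp
  qed
  have ii: "ar V V (i 0 \<star> p 0)" "ar V V (j \<star> q)" using i j q by auto
  have s: "pls V V (i 0 \<star> p 0) (j \<star> q) = Idt C V"
  proof (rule biprod_eqI[OF b ar_pls[OF ii] ar_id[OF o(1)]])
    fix k assume k: "k < length (X # Xs)"
    show "p k \<star> pls V V (i 0 \<star> p 0) (j \<star> q) = p k \<star> Idt C V"
    proof (cases k)
      case 0
      have "p 0 \<star> (i 0 \<star> p 0) = p 0" "p 0 \<star> (j \<star> q) = zr V X"
        using cmp_assoc[OF i(2,1,2)] cmp_assoc[OF q(1) j(1) i(2)] p0j i cmp_zr_l[OF q(1) o(3)] by simp_all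
      then show ?thesis using 0 cmp_add_r[OF i(2) ii] i(2) by simp
    next
      case (Suc l)
      then have l: "l < length Xs" using k by simp
      have "p (Suc l) \<star> (i 0 \<star> p 0) = zr V (Xs ! l)"
        using cmp_assoc[OF i(2,1) isk(2)[OF l]] p0i(2)[OF l] cmp_zr_l[OF i(2) arD(2)[OF isk(2)[OF l]]] by simp
      moreover have "p (Suc l) \<star> (j \<star> q) = p (Suc l)"
        using cmp_assoc[OF q(1) j(1) isk(2)[OF l]] pj[OF l] q(2)[OF l] by simp
      ultimately show ?thesis using Suc cmp_add_r[OF isk(2)[OF l] ii] isk(2)[OF l] by simp
    qed
  qed
  define i2 where "i2 k = (if k = (0::nat) then i 0 else j)" for k
  define p2 where "p2 k = (if k = (0::nat) then p 0 else q)" for k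
  have am: "abelian_monoid (Hom C V V)" using Hom_group[OF o(1,1)] by (simp add: abelian_group_def)
  have "finsum (Hom C V V) (\<lambda>k. i2 k \<star> p2 k) {..<length [X, B]} = Idt C V"
  proof -
    have e: "{..<length [X, B]} = insert 0 (insert 1 {})" by auto
    have "finsum (Hom C V V) (\<lambda>k. i2 k \<star> p2 k) {..<length [X, B]} = pls V V (i 0 \<star> p 0) (j \<star> q)"
      unfolding e using ii add_zr(1)[OF ii(2)]
      by (simp add: abelian_monoid.finsum_insert[OF am] abelian_monoid.finsum_empty[OF am] i2_def p2_def Pi_iff ar_def)
    then show ?thesis using s by simp
  qed
  then have "biprod V [X, B] i2 p2"
    unfolding biprod_def using o i j(1) q(1) qj qi p0j by (auto simp: i2_def p2_def less_Suc_eq)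
  then show ?thesis using direct_sum_iff by blast
qed

lemma local_ringD:
  assumes l: "local_ring (End_ring C X)" and X: "X \<in> Ob C" and fg: "ar X X f" "ar X X g"
    and s: "is_iso C X X (pls X X f g)"
  shows "is_iso C X X f \<or> is_iso C X X g"
proof -
  have u: "h \<in> Units (End_ring C X) \<longleftrightarrow> is_iso C X X h" for h
    unfolding Units_def is_iso_def End_ring_def by auto
  have c: "carrier (End_ring C X) = Mor C X X" "add (End_ring C X) = add (Hom C X X)"
    by (simp_all add: End_ring_def)
  show ?thesis using l s fg unfolding local_ring_def c Ball_def Diff_iff u ar_def by blast
qed

lemma biprod_singleton:
  assumes b: "biprod V [X] i p"
  shows "ar X V (i 0)" "ar V X (p 0)" "p 0 \<star> i 0 = Idt C X" "i 0 \<star> p 0 = Idt C V"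
proof -
  show D: "ar X V (i 0)" "ar V X (p 0)" "p 0 \<star> i 0 = Idt C X" using biprodD(3-5)[OF b, of 0] by auto
  have "abelian_monoid (Hom C V V)" using Hom_group[OF biprodD(1)[OF b] biprodD(1)[OF b]] by (simp add: abelian_group_def)
  then have "finsum (Hom C V V) (\<lambda>k. i k \<star> p k) {..<length [X]} = i 0 \<star> p 0"
    using ar_cmp[OF D(1,2)] add_zr(1)[OF ar_cmp[OF D(1,2)]]
    by (simp add: lessThan_Suc abelian_monoid.finsum_insert abelian_monoid.finsum_empty Pi_iff ar_def)
  then show "i 0 \<star> p 0 = Idt C V" using b by (simp add: biprod_def)
qed

lemma local_End_transfer:
  assumes i: "ar X V i" "ar V X p" "p \<star> i = Idt C X" "i \<star> p = Idt C V"
    and l: "local_ring (End_ring C X)" and fg: "ar V V f" "ar V V g" and s: "is_iso C V V (pls V V f g)"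
  shows "is_iso C V V f \<or> is_iso C V V g"
proof -
  have o: "X \<in> Ob C" "V \<in> Ob C" using arD i by blast+
  have ii: "is_iso C X V i" "is_iso C V X p" using i is_isoI by auto
  have "is_iso C X X (p \<star> pls V V f g \<star> i)"
    using is_iso_cmp[OF ii(1) is_iso_cmp[OF s ii(2)]] o by simp
  moreover have "p \<star> pls V V f g \<star> i = pls X X (p \<star> f \<star> i) (p \<star> g \<star> i)"
    using cmp_add_r[OF i(2) fg] cmp_add_l[OF i(1) ar_cmp[OF i(2) fg(1)] ar_cmp[OF i(2) fg(2)]] by simp
  ultimately have "is_iso C X X (p \<star> f \<star> i) \<or> is_iso C X X (p \<star> g \<star> i)"
    using local_ringD[OF l o(1) ar_cmp[OF ar_cmp[OF i(2) fg(1)] i(1)] ar_cmp[OF ar_cmp[OF i(2) fg(2)] i(1)]] by simp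
  moreover have "is_iso C V V h" if h: "ar V V h" "is_iso C X X (p \<star> h \<star> i)" for h
  proof -
    have "is_iso C V V (i \<star> ((p \<star> h \<star> i) \<star> p))"
      using is_iso_cmp[OF is_iso_cmp[OF ii(2) h(2)] ii(1)] o by simp
    moreover have "(p \<star> h \<star> i) \<star> p = p \<star> h"
      using cmp_assoc[OF i(2,1) ar_cmp[OF i(2) h(1)]] i(4) id_r[OF ar_cmp[OF i(2) h(1)]] by simp
    moreover have "i \<star> (p \<star> h) = h" using cmp_assoc[OF h(1) i(2,1)] i(4) h by simp
    ultimately show ?thesis by simp
  qed
  ultimately show ?thesis using fg by blast
qed

end

text \<open>\<open>krull_schmidt\<close> gives local endomorphism rings only for the summands of
  some decomposition. For an indecomposable V the sum of all summands but the first must be zero, so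
  there is a single summand X, and locality passes from \<open>End X\<close> to \<open>End V\<close>
  by conjugation.\<close>

lemma (in triangulated_category) ks_categoryI:
  assumes hf: "hom_finite K C" and ks: "krull_schmidt C"
  shows "ks_category K C"
proof (intro ks_category.intro linear_category_axioms ks_category_axioms.intro)
  show "\<exists>Xs. direct_sum C V Xs \<and> (\<forall>X\<in>set Xs. indecomposable C X)" if "V \<in> Ob C" for V
    using ks that unfolding krull_schmidt_def by blast
  then have dec: "\<exists>Xs i p. biprod V Xs i p \<and> (\<forall>k<length Xs. indecomposable C (Xs ! k))" if "V \<in> Ob C" for V
    using that direct_sum_iff nth_mem by metis
  show "vectorspace.fin_dim K (Hom C X Y)" if XY: "X \<in> Ob C" "Y \<in> Ob C" for X Y
  proof -
    obtain Xs i p where X: "biprod X Xs i p" "\<forall>k<length Xs. indecomposable C (Xs ! k)" using dec[OF XY(1)] by blast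
    obtain Ys i' p' where Y: "biprod Y Ys i' p'" "\<forall>k<length Ys. indecomposable C (Ys ! k)" using dec[OF XY(2)] by blast
    have "vectorspace.fin_dim K (Hom C (Xs ! k) Y)" if k: "k < length Xs" for k
      using fin_dim_biprod[OF Y(1)] X(2) Y(2) k hf indecD(1) unfolding hom_finite_def by blast
    then show ?thesis using fin_dim_biprod_left[OF X(1) XY(2)] by blast
  qed
  fix V f g assume V: "indecomposable C V" and fg: "ar V V f" "ar V V g" "is_iso C V V (pls V V f g)"
  have Vo: "V \<in> Ob C" using indecD V by blast
  obtain Xs where Xs: "direct_sum C V Xs" "\<forall>X\<in>set Xs. indecomposable C X \<and> local_ring (End_ring C X)"
    using ks Vo unfolding krull_schmidt_def by blast
  obtain i p where b: "biprod V Xs i p" using Xs(1) direct_sum_iff by blast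
  show "is_iso C V V f \<or> is_iso C V V g"
  proof (cases Xs)
    case Nil
    have "abelian_monoid (Hom C V V)" using Hom_group[OF Vo Vo] by (simp add: abelian_group_def)
    then have "Idt C V = zr V V" using b Nil by (simp add: biprod_def abelian_monoid.finsum_empty)
    then show ?thesis using indecD(2)[OF V] by simp
  next
    case (Cons X Ys)
    have "set Ys \<subseteq> Ob C" using biprodD(2)[OF b] Cons by simp
    then obtain B where "direct_sum C B Ys" using additive by blast
    then obtain i' p' where b': "biprod B Ys i' p'" using direct_sum_iff by blast
    have "direct_sum C V [X, B]" using biprod_split[OF _ b'] b Cons by simp
    then have "zero_object C X \<or> zero_object C B" using V unfolding indecomposable_def by blast
    then have zB: "zero_object C B" using Xs(2) Cons by (auto simp: indecomposable_def)
    have "Ys = []"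
    proof (rule ccontr)
      assume "Ys \<noteq> []"
      then have l: "0 < length Ys" by simp
      have Y: "indecomposable C (Ys ! 0)" using Xs(2) Cons nth_mem[OF l] by simp
      have "p' 0 = zr B (Ys ! 0)" using zero_object_ar(2)[OF zB biprodD(4)[OF b' l]] .
      then have "Idt C (Ys ! 0) = zr (Ys ! 0) (Ys ! 0)"
        using biprodD(5)[OF b' l] cmp_zr_l[OF biprodD(3)[OF b' l] indecD(1)[OF Y]] by simp
      then show False using indecD(2)[OF Y] by simp
    qed
    then have b1: "biprod V [X] i p" using b Cons by simp
    show ?thesis
      using local_End_transfer[OF biprod_singleton[OF b1] _ fg] Xs(2) Cons by simp
  qed
qed

context linear_category
begin

abbreviation ng where "ng X Y f \<equiv> \<ominus>\<^bsub>Hom C X Y\<^esub> f"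

lemma ar_ng [intro]: "ar X Y f \<Longrightarrow> ar X Y (ng X Y f)"
  using abelian_group.a_inv_closed[OF Hom_group] by (simp add: ar_def)

lemma ng_ng: "ar X Y f \<Longrightarrow> ng X Y (ng X Y f) = f"
  using abelian_group.minus_minus[OF Hom_group] by (simp add: ar_def)

lemma ng_zr: "\<lbrakk>X \<in> Ob C; Y \<in> Ob C\<rbrakk> \<Longrightarrow> ng X Y (zr X Y) = zr X Y"
proof -
  assume "X \<in> Ob C" "Y \<in> Ob C"
  then interpret abelian_group "Hom C X Y" by (rule Hom_group)
  show ?thesis using r_neg[OF zero_closed] l_zero[OF a_inv_closed[OF zero_closed]] by simp
qed

lemma ng_eq: "\<lbrakk>ar X Y f; ar X Y g; ng X Y f = ng X Y g\<rbrakk> \<Longrightarrow> f = g"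
  using ng_ng by metis

lemma cmp_ng_r: "\<lbrakk>ar Y Z g; ar X Y f\<rbrakk> \<Longrightarrow> g \<star> ng X Y f = ng X Z (g \<star> f)"
proof -
  assume a: "ar Y Z g" "ar X Y f"
  then interpret linear_map K "Hom C X Y" "Hom C X Z" "\<lambda>f. g \<star> f" by (intro lin_r arD)
  show ?thesis using a(2) f_neg by (simp add: ar_def)
qed

lemma cmp_ng_l: "\<lbrakk>ar X Y f; ar Y Z g\<rbrakk> \<Longrightarrow> ng Y Z g \<star> f = ng X Z (g \<star> f)"
proof -
  assume a: "ar X Y f" "ar Y Z g"
  then interpret linear_map K "Hom C Y Z" "Hom C X Z" "\<lambda>g. g \<star> f" by (intro lin_l arD)
  show ?thesis using a(2) f_neg by (simp add: ar_def)
qed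

end

section \<open>Exactness and completion of triangles\<close>

context triangulated_category
begin

abbreviation SM where "SM \<equiv> ShM C"
abbreviation So where "So \<equiv> Sh C"

lemma Sh_ar [intro]: "ar X Y f \<Longrightarrow> ar (So X) (So Y) (SM X Y f)"
  using linear_mapD(1)[OF Sh_linear] Sh_Ob by (simp add: ar_def)

lemma Sh_cmp: "\<lbrakk>ar X Y f; ar Y Z g\<rbrakk> \<Longrightarrow> SM X Z (g \<star> f) = SM Y Z g \<star> SM X Y f"
  by (rule Sh_comp) (auto dest: arD)

lemma Sh_zr: "\<lbrakk>X \<in> Ob C; Y \<in> Ob C\<rbrakk> \<Longrightarrow> SM X Y (zr X Y) = zr (So X) (So Y)"
  using linear_mapD(5)[OF Sh_linear] .

lemma Sh_ng: "ar X Y f \<Longrightarrow> SM X Y (ng X Y f) = ng (So X) (So Y) (SM X Y f)"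
proof -
  assume a: "ar X Y f"
  then interpret linear_map K "Hom C X Y" "Hom C (So X) (So Y)" "SM X Y" by (intro Sh_linear arD)
  show ?thesis using a f_neg by (simp add: ar_def)
qed

lemma Sh_mns: "\<lbrakk>ar X Y f; ar X Y g\<rbrakk> \<Longrightarrow> SM X Y (mns X Y f g) = mns (So X) (So Y) (SM X Y f) (SM X Y g)"
  by (rule linear_mapD(3)[OF Sh_linear]) (auto dest: arD)

lemma Sh_inj: "\<lbrakk>ar X Y f; ar X Y g; SM X Y f = SM X Y g\<rbrakk> \<Longrightarrow> f = g"
  using Sh_fully_faithful[of X Y] unfolding bij_betw_def inj_on_def ar_def by blast

lemma Sh_surj: "\<lbrakk>X \<in> Ob C; Y \<in> Ob C; ar (So X) (So Y) h\<rbrakk> \<Longrightarrow> \<exists>f. ar X Y f \<and> h = SM X Y f"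
  using Sh_fully_faithful[of X Y] unfolding bij_betw_def ar_def by blast

lemma Sh_iso: "\<lbrakk>is_iso C X Y f; X \<in> Ob C; Y \<in> Ob C\<rbrakk> \<Longrightarrow> is_iso C (So X) (So Y) (SM X Y f)"
proof -
  assume a: "is_iso C X Y f" "X \<in> Ob C" "Y \<in> Ob C"
  obtain g where g: "ar X Y f" "ar Y X g" "g \<star> f = Idt C X" "f \<star> g = Idt C Y" using is_isoE[OF a] .
  show ?thesis
    using Sh_cmp[OF g(1,2)] Sh_cmp[OF g(2,1)] g(3,4) Sh_id a
    by (intro is_isoI[OF Sh_ar[OF g(1)] Sh_ar[OF g(2)]]) simp_all
qed

lemma Sh_zero: "zero_object C Z \<Longrightarrow> zero_object C (So Z)"
  unfolding zero_object_iff using Sh_zr Sh_id Sh_Ob by metis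

lemma zero_ex: "\<exists>Z. zero_object C Z"
proof -
  obtain V where "direct_sum C V []" using additive[of "[]"] by auto
  then obtain i p where b: "biprod V [] i p" using direct_sum_iff by blast
  have "abelian_monoid (Hom C V V)" using Hom_group[OF biprodD(1)[OF b] biprodD(1)[OF b]] by (simp add: abelian_group_def)
  then have "Idt C V = zr V V" using b by (simp add: biprod_def abelian_monoid.finsum_empty)
  then show ?thesis using biprodD(1)[OF b] zero_object_iff by blast
qed

lemma triD:
  assumes "(X, Y, Z, u, v, w) \<in> Tri C"
  shows "ar X Y u" "ar Y Z v" "ar Z (So X) w" "X \<in> Ob C" "Y \<in> Ob C" "Z \<in> Ob C"
  using triangle_type[OF assms] Sh_Ob by (auto simp: ar_def)

lemma rot: "(X, Y, Z, u, v, w) \<in> Tri C \<Longrightarrow> (Y, Z, So X, v, w, ng (So X) (So Y) (SM X Y u)) \<in> Tri C"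
  using TR2[of X Y Z u v w] triangle_type[of X Y Z u v w] by blast

lemma rot_back:
  "\<lbrakk>ar X Y u; ar Y Z v; ar Z (So X) w; (Y, Z, So X, v, w, ng (So X) (So Y) (SM X Y u)) \<in> Tri C\<rbrakk>
    \<Longrightarrow> (X, Y, Z, u, v, w) \<in> Tri C"
  using TR2[of X Y Z u v w] by (simp add: ar_def)

lemma tri_map:
  assumes "(X, Y, Z, u, v, w) \<in> Tri C" "(X', Y', Z', u', v', w') \<in> Tri C"
    "ar X X' f" "ar Y Y' g" "g \<star> u = u' \<star> f"
  obtains h where "ar Z Z' h" "h \<star> v = v' \<star> g" "SM X X' f \<star> w = w' \<star> h"
  using TR3[OF assms(1,2) arD(3)[OF assms(3)] arD(3)[OF assms(4)] assms(5)] triD[OF assms(1)] triD[OF assms(2)]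
  by (auto simp: ar_def)

lemma tri_zero: assumes t: "(X, Y, Z, u, v, w) \<in> Tri C" shows "v \<star> u = zr X Z"
proof -
  note D = triD[OF t]
  obtain N where z: "zero_object C N" using zero_ex by blast
  have Oo: "N \<in> Ob C" using z zero_object_iff by blast
  obtain h where "ar N Z h" "h \<star> zr X N = v \<star> u"
    using tri_map[OF TR1_id[OF D(4) z] t ar_id[OF D(4)] D(1)] by metis
  then show ?thesis using cmp_zr_r[OF _ D(4)] by metis
qed

text \<open>TR3 supplies the third morphism of a map of triangles, so both the identity triangle of
  M and the given one are rotated until the wanted map becomes the third. It then runs between
  shifts and descends by full faithfulness; the signs of the rotations cancel.\<close>

lemma tri_exact:
  assumes t: "(X, Y, Z, u, v, w) \<in> Tri C" and g: "ar M Y g" "v \<star> g = zr M Z"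
  shows "\<exists>h. ar M X h \<and> g = u \<star> h"
proof -
  note D = triD[OF t]
  have M: "M \<in> Ob C" using g arD by blast
  obtain N where z: "zero_object C N" using zero_ex by blast
  have Oo: "N \<in> Ob C" using z zero_object_iff by blast
  have c: "zr N Z \<star> zr M N = v \<star> g" using cmp_zr_l[OF ar_zr[OF M Oo] D(6)] g(2) by simp
  obtain h where h: "ar (So M) (So X) h"
    "SM M Y g \<star> ng (So M) (So M) (SM M M (Idt C M)) = ng (So X) (So Y) (SM X Y u) \<star> h"
    by (rule tri_map[OF rot[OF TR1_id[OF M z]] rot[OF t] g(1) ar_zr[OF Oo D(6)] c])
  obtain h' where h': "ar M X h'" "h = SM M X h'" using Sh_surj[OF M D(4) h(1)] by blast
  have "ng (So M) (So Y) (SM M Y g) = ng (So M) (So Y) (SM M Y (u \<star> h'))"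
    using h(2) cmp_ng_r[OF Sh_ar[OF g(1)] ar_id[OF Sh_Ob[OF M]]] cmp_ng_l[OF h(1) Sh_ar[OF D(1)]]
      id_r[OF Sh_ar[OF g(1)]] Sh_id[OF M] Sh_cmp[OF h'(1) D(1)] h'(2) by simp
  then have "g = u \<star> h'"
    using ng_eq[OF Sh_ar[OF g(1)] Sh_ar[OF ar_cmp[OF D(1) h'(1)]]] Sh_inj[OF g(1) ar_cmp[OF D(1) h'(1)]] by blast
  then show ?thesis using h' by blast
qed

text \<open>The wanted map out of Z is already the third one, so the given triangle is compared with
  0 \<rightarrow> M \<rightarrow> M, obtained by rotating an identity triangle backwards.\<close>

lemma tri_exact_op:
  assumes t: "(X, Y, Z, u, v, w) \<in> Tri C" and g: "ar Y M g" "g \<star> u = zr X M"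
  shows "\<exists>h. ar Z M h \<and> g = h \<star> v"
proof -
  note D = triD[OF t]
  have M: "M \<in> Ob C" using g arD by blast
  obtain N where z: "zero_object C N" using zero_ex by blast
  have Oo: "N \<in> Ob C" using z zero_object_iff by blast
  have "(M, M, So N, Idt C M, zr M (So N), ng (So N) (So M) (SM N M (zr N M))) \<in> Tri C"
    using TR1_id[OF M Sh_zero[OF z]] Sh_zr[OF Oo M] ng_zr Sh_Ob M Oo by simp
  then have t': "(N, M, M, zr N M, Idt C M, zr M (So N)) \<in> Tri C"
    by (rule rot_back[OF ar_zr[OF Oo M] ar_id[OF M] ar_zr[OF M Sh_Ob[OF Oo]]])
  have c: "g \<star> u = zr N M \<star> zr X N" using cmp_zr_l[OF ar_zr[OF D(4) Oo] M] g(2) by simp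
  obtain h where "ar Z M h" "h \<star> v = Idt C M \<star> g"
    by (rule tri_map[OF t t' ar_zr[OF D(4) Oo] g(1) c])
  then show ?thesis using id_l[OF g(1)] by metis
qed

text \<open>A prescribed third map h is completed by taking its cone and rotating back twice. The
  shift is only an equivalence, so the cone is first replaced by an isomorphic object
  \<open>Sh C B\<close>; a and b are chosen as preimages of negatives to absorb the signs of the two
  rotations.\<close>

lemma tri_extend:
  assumes W: "ar W (So X) h" and X: "X \<in> Ob C"
  shows "\<exists>B a b. (X, B, W, a, b, h) \<in> Tri C"
proof -
  have Wo: "W \<in> Ob C" using W arD by blast
  obtain Z p q where t: "(W, So X, Z, h, p, q) \<in> Tri C" using TR1_cone[OF Wo Sh_Ob[OF X] arD(3)[OF W]] by blast
  note D = triD[OF t]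
  obtain B where B: "B \<in> Ob C" "isomorphic C (So B) Z" using Sh_dense[OF D(6)] by blast
  obtain th where "is_iso C (So B) Z th" using B(2) isomorphic_def by metis
  then obtain ti where th: "ar (So B) Z th" "ar Z (So B) ti" "ti \<star> th = Idt C (So B)" "th \<star> ti = Idt C Z"
    "is_iso C Z (So B) ti"
    using is_isoE[OF _ Sh_Ob[OF B(1)] D(6)] by metis
  have SW: "So W \<in> Ob C" and SB: "So B \<in> Ob C" and SX: "So X \<in> Ob C" using Sh_Ob Wo B X by auto
  have t2: "(W, So X, So B, h, ti \<star> p, q \<star> th) \<in> Tri C"
  proof (rule TR1_iso[OF t Wo SX SB arD(3)[OF W] arD(3)[OF ar_cmp[OF th(2) D(2)]] arD(3)[OF ar_cmp[OF D(3) th(1)]]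
        is_iso_id[OF Wo] is_iso_id[OF SX] th(5)])
    show "Idt C (So X) \<star> h = h \<star> Idt C W" using W by simp
    show "ti \<star> p = ti \<star> p \<star> Idt C (So X)" using id_r[OF ar_cmp[OF th(2) D(2)]] by simp
    show "SM W W (Idt C W) \<star> q = q \<star> th \<star> ti"
      using cmp_assoc[OF th(2,1) D(3)] th(4) Sh_id[OF Wo] id_l[OF D(3)] id_r[OF D(3)] by simp
  qed
  note D2 = triD[OF t2]
  obtain a where a: "ar X B a" "ng (So X) (So B) (ti \<star> p) = SM X B a"
    using Sh_surj[OF X B(1) ar_ng[OF D2(2)]] by blast
  obtain b where b: "ar B W b" "ng (So B) (So W) (q \<star> th) = SM B W b"
    using Sh_surj[OF B(1) Wo ar_ng[OF D2(3)]] by blast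
  have "ng (So X) (So B) (SM X B a) = ti \<star> p" "ng (So B) (So W) (SM B W b) = q \<star> th"
    using a(2) b(2) ng_ng[OF D2(2)] ng_ng[OF D2(3)] by metis+
  then have "(B, W, So X, b, h, ng (So X) (So B) (SM X B a)) \<in> Tri C"
    using t2 by (intro rot_back[OF b(1) W ar_ng[OF Sh_ar[OF a(1)]]]) simp
  then have "(X, B, W, a, b, h) \<in> Tri C" by (rule rot_back[OF a(1) b(1) W])
  then show ?thesis by blast
qed

end

section \<open>Auslander-Reiten triangles and the translation\<close>

locale ks_triangulated = triangulated_category K C + ks_category K C
  for K :: "('k, 'r) ring_scheme" and C :: "('o, 'm, 'k, 'z) tri_cat_scheme"
begin

lemma AR_D:
  assumes "AR_triangle C (U, V, W, u, v, w)"
  shows "(U, V, W, u, v, w) \<in> Tri C" "indecomposable C U" "indecomposable C W" "w \<noteq> zr W (So U)"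
    "\<And>X f. f \<in> RE X W \<Longrightarrow> \<exists>g. ar X V g \<and> f = v \<star> g"
  using assms triD[of U V W u v w] unfolding AR_triangle_def RE_def ar_def by blast+

text \<open>Both splittings contradict w being nonzero: a section s of v gives w = w v s = 0, and a
  retraction of u gives the same from the vanishing of u[1] w.\<close>

lemma AR_RE:
  assumes t: "AR_triangle C (U, V, W, u, v, w)"
  shows "v \<in> RE V W" "u \<in> RM U V" "w \<star> v = zr V (So U)" "SM U V u \<star> w = zr W (So V)"
proof -
  note A = AR_D[OF t] note D = triD[OF A(1)]
  show wv: "w \<star> v = zr V (So U)" using tri_zero[OF rot[OF A(1)]] .
  have "ng (So U) (So V) (SM U V u) \<star> w = zr W (So V)" using tri_zero[OF rot[OF rot[OF A(1)]]] .
  then have "ng W (So V) (SM U V u \<star> w) = ng W (So V) (zr W (So V))"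
    using cmp_ng_l[OF D(3) Sh_ar[OF D(1)]] ng_zr[OF D(6) Sh_Ob[OF D(5)]] by simp
  then show uw: "SM U V u \<star> w = zr W (So V)"
    using ng_eq[OF ar_cmp[OF Sh_ar[OF D(1)] D(3)] ar_zr[OF D(6) Sh_Ob[OF D(5)]]] by blast
  have "\<not> split_epi C V W v"
  proof
    assume "split_epi C V W v"
    then obtain s where s: "ar W V s" "v \<star> s = Idt C W" using split_epiE[OF _ D(5,6)] by metis
    have "w = w \<star> (v \<star> s)" using s D(3) by simp
    also have "\<dots> = zr W (So U)" using cmp_assoc[OF s(1) D(2,3)] wv cmp_zr_l[OF s(1) Sh_Ob[OF D(4)]] by simp
    finally show False using A(4) by simp
  qed
  then show "v \<in> RE V W" using D by (simp add: RE_def)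
  have "\<not> split_mono C U V u"
  proof
    assume "split_mono C U V u"
    then obtain r where r: "ar V U r" "r \<star> u = Idt C U" using split_monoE[OF _ D(4,5)] by metis
    have "SM V U r \<star> SM U V u = Idt C (So U)" using Sh_cmp[OF D(1) r(1)] r(2) Sh_id[OF D(4)] by simp
    then have "w = SM V U r \<star> (SM U V u \<star> w)"
      using cmp_assoc[OF D(3) Sh_ar[OF D(1)] Sh_ar[OF r(1)]] D(3) by simp
    then have "w = zr W (So U)" using uw cmp_zr_r[OF Sh_ar[OF r(1)] D(6)] by simp
    then show False using A(4) by simp
  qed
  then show "u \<in> RM U V" using D by (simp add: RM_def)
qed

lemma AR_ras:
  assumes t: "AR_triangle C (U, V, W, u, v, w)"
  shows "ras U V W u v"
  unfolding ras_def
proof (intro conjI allI ballI impI)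
  show "\<exists>g. ar X V g \<and> f = v \<star> g" if "f \<in> RE X W" for X f using AR_D(5)[OF t that] .
  show "\<exists>h. ar X U h \<and> g = u \<star> h" if "ar X V g" "v \<star> g = zr X W" for X g
    using tri_exact[OF AR_D(1)[OF t] that] .
qed (use AR_D(2,3)[OF t] AR_RE(1,2)[OF t] tri_zero[OF AR_D(1)[OF t]] in auto)

text \<open>Exactness at U[1] turns factorisation through u into the vanishing of a single composite
  with w, which can be tested by computation.\<close>

lemma AR_shift_zero:
  assumes t: "AR_triangle C (U, V, W, u, v, w)" and f: "ar U X f"
  shows "SM U X f \<star> w = zr W (So X) \<longleftrightarrow> (\<exists>g. ar V X g \<and> f = g \<star> u)"
proof
  note A = AR_D[OF t] note D = triD[OF A(1)]
  have X: "X \<in> Ob C" using f arD by blast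
  {
    assume "\<exists>g. ar V X g \<and> f = g \<star> u"
    then obtain g where g: "ar V X g" "f = g \<star> u" by blast
    then show "SM U X f \<star> w = zr W (So X)"
      using Sh_cmp[OF D(1) g(1)] cmp_assoc[OF D(3) Sh_ar[OF D(1)] Sh_ar[OF g(1)]] AR_RE(4)[OF t]
        cmp_zr_r[OF Sh_ar[OF g(1)] D(6)] by simp
  }
  assume z: "SM U X f \<star> w = zr W (So X)"
  obtain h where h: "ar (So V) (So X) h" "SM U X f = h \<star> ng (So U) (So V) (SM U V u)"
    using tri_exact_op[OF rot[OF rot[OF A(1)]] Sh_ar[OF f] z] by blast
  obtain h' where h': "ar V X h'" "h = SM V X h'" using Sh_surj[OF D(5) X h(1)] by blast
  have "SM U X f = SM U X (ng U X (h' \<star> u))"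
    using h h' cmp_ng_r[OF h(1) Sh_ar[OF D(1)]] Sh_cmp[OF D(1) h'(1)] Sh_ng[OF ar_cmp[OF h'(1) D(1)]] by simp
  then have "f = ng U X (h' \<star> u)" using Sh_inj[OF f] h'(1) D(1) by blast
  then have "f = ng V X h' \<star> u" using cmp_ng_l[OF D(1) h'(1)] by simp
  then show "\<exists>g. ar V X g \<and> f = g \<star> u" using h'(1) by blast
qed

text \<open>If \<open>f\<close> does not factor through \<open>u\<close>, the triangle over \<open>f[1] w\<close> maps to the given one with the
  identity on \<open>W\<close>, which yields \<open>e\<close> in the local ring \<open>End U\<close> with \<open>e[1] w = w\<close> that factors
  through \<open>f\<close>.\<close>

lemma AR_left_factor:
  assumes t: "AR_triangle C (U, V, W, u, v, w)" and f: "f \<in> RM U X"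
  shows "\<exists>g. ar V X g \<and> f = g \<star> u"
proof (rule ccontr)
  assume nf: "\<not> ?thesis"
  note A = AR_D[OF t] note D = triD[OF A(1)]
  have fa: "ar U X f" using f by (simp add: RM_def)
  have X: "X \<in> Ob C" using fa arD by blast
  define h where "h = SM U X f \<star> w"
  have h: "ar W (So X) h" unfolding h_def using Sh_ar[OF fa] D(3) by blast
  have hz: "h \<noteq> zr W (So X)" using AR_shift_zero[OF t fa] nf h_def by simp
  obtain B a b where T: "(X, B, W, a, b, h) \<in> Tri C" using tri_extend[OF h X] by blast
  note DT = triD[OF T]
  have hb: "h \<star> b = zr B (So X)" using tri_zero[OF rot[OF T]] .
  have "\<not> split_epi C B W b"
  proof
    assume "split_epi C B W b"
    then obtain s where s: "ar W B s" "b \<star> s = Idt C W" using split_epiE[OF _ DT(5,6)] by metis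
    have "h = h \<star> (b \<star> s)" using s h by simp
    also have "\<dots> = zr W (So X)" using cmp_assoc[OF s(1) DT(2) h] hb cmp_zr_l[OF s(1) Sh_Ob[OF X]] by simp
    finally show False using hz by simp
  qed
  then have "b \<in> RE B W" using DT by (simp add: RE_def)
  then obtain c where c: "ar B V c" "b = v \<star> c" using A(5) by blast
  have e: "Idt C W \<star> b = v \<star> c" using c DT(2) by simp
  obtain k where k: "ar (So X) (So U) k" "k \<star> h = w \<star> Idt C W"
    by (rule tri_map[OF rot[OF T] rot[OF A(1)] c(1) ar_id[OF DT(6)] e])
  obtain k' where k': "ar X U k'" "k = SM X U k'" using Sh_surj[OF X D(4) k(1)] by blast
  define e where "e = k' \<star> f"
  have ea: "ar U U e" unfolding e_def using k'(1) fa by blast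
  have ew: "SM U U e \<star> w = w"
    using k(2) D(3) cmp_assoc[OF D(3) Sh_ar[OF fa] k(1)] Sh_cmp[OF fa k'(1)] k'(2)
    unfolding e_def h_def by simp
  have "is_iso C U U e"
  proof (rule ccontr)
    assume "\<not> is_iso C U U e"
    then have i: "is_iso C U U (mns U U (Idt C U) e)" using one_minus_iso[OF A(2) ea] by simp
    have "SM U U (mns U U (Idt C U) e) \<star> w = zr W (So U)"
      using Sh_mns[OF ar_id[OF D(4)] ea] cmp_minus_l[OF D(3) Sh_ar[OF ar_id[OF D(4)]] Sh_ar[OF ea]]
        Sh_id[OF D(4)] ew D(3) mns_self[OF D(3)] by simp
    moreover obtain q where q: "ar (So U) (So U) q" "q \<star> SM U U (mns U U (Idt C U) e) = Idt C (So U)"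
      using is_isoE[OF Sh_iso[OF i D(4) D(4)] Sh_Ob[OF D(4)] Sh_Ob[OF D(4)]] by metis
    ultimately have "w = zr W (So U)"
      using cmp_assoc[OF D(3) Sh_ar[OF ar_mns[OF ar_id[OF D(4)] ea]] q(1)] id_l[OF D(3)] cmp_zr_r[OF q(1) D(6)] by simp
    then show False using A(4) by simp
  qed
  then obtain q where q: "ar U U q" "q \<star> e = Idt C U" using is_isoE[OF _ D(4) D(4)] by metis
  then have "(q \<star> k') \<star> f = Idt C U" using cmp_assoc[OF fa k'(1) q(1)] unfolding e_def by simp
  then have "split_mono C U X f" using split_monoI[OF fa ar_cmp[OF q(1) k'(1)]] by blast
  then show False using f by (simp add: RM_def)
qed

lemma AR_las:
  assumes t: "AR_triangle C (U, V, W, u, v, w)"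
  shows "las U V W u v"
  unfolding las_def
proof (intro conjI allI ballI impI)
  show "\<exists>g. ar V X g \<and> f = g \<star> u" if "f \<in> RM U X" for X f using AR_left_factor[OF t that] .
  show "\<exists>h. ar W X h \<and> g = h \<star> v" if "ar V X g" "g \<star> u = zr U X" for X g
    using tri_exact_op[OF AR_D(1)[OF t] that] .
qed (use AR_D(2,3)[OF t] AR_RE(1,2)[OF t] tri_zero[OF AR_D(1)[OF t]] in auto)

text \<open>With \<open>AR_left_zero\<close> this says that the annihilator of w is the radical on
  either side; so w is a common yardstick for morphisms into W and morphisms out of U.\<close>

lemma AR_right_zero:
  assumes t: "AR_triangle C (U, V, W, u, v, w)" and f: "ar X W f"
  shows "w \<star> f = zr X (So U) \<longleftrightarrow> f \<in> RE X W"
proof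
  note A = AR_D[OF t] note D = triD[OF A(1)]
  have X: "X \<in> Ob C" using f arD by blast
  {
    assume "f \<in> RE X W"
    then obtain g where g: "ar X V g" "f = v \<star> g" using A(5) by blast
    then show "w \<star> f = zr X (So U)"
      using cmp_assoc[OF g(1) D(2,3)] AR_RE(3)[OF t] cmp_zr_l[OF g(1) Sh_Ob[OF D(4)]] by simp
  }
  assume z: "w \<star> f = zr X (So U)"
  have "\<not> split_epi C X W f"
  proof
    assume "split_epi C X W f"
    then obtain s where s: "ar W X s" "f \<star> s = Idt C W" using split_epiE[OF _ X D(6)] by metis
    have "w = w \<star> (f \<star> s)" using s D(3) by simp
    also have "\<dots> = zr W (So U)" using cmp_assoc[OF s(1) f D(3)] z cmp_zr_l[OF s(1) Sh_Ob[OF D(4)]] by simp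
    finally show False using A(4) by simp
  qed
  then show "f \<in> RE X W" using f by (simp add: RE_def)
qed

lemma AR_left_zero:
  assumes t: "AR_triangle C (U, V, W, u, v, w)" and f: "ar U X f"
  shows "SM U X f \<star> w = zr W (So X) \<longleftrightarrow> f \<in> RM U X"
proof -
  have "f \<in> RM U X" if "ar V X g" "f = g \<star> u" for g
    using RM_cmp[OF AR_RE(2)[OF t] that(1)] that(2) by simp
  then show ?thesis using AR_shift_zero[OF t f] AR_left_factor[OF t] by blast
qed

text \<open>The composite p v is no split epimorphism: otherwise p would be one, hence an
  isomorphism, and cancelling it would split v. So p v factors through v', and TR3 completes the
  square to a map of triangles.\<close>

lemma AR_right_to_left:
  assumes t: "AR_triangle C (U, V, W, u, v, w)" "AR_triangle C (U', V', W', u', v', w')" and p: "ar W W' p"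
  shows "\<exists>q. ar U U' q \<and> SM U U' q \<star> w = w' \<star> p"
proof -
  note A = AR_D[OF t(1)] note D = triD[OF A(1)]
  note A' = AR_D[OF t(2)] note D' = triD[OF A'(1)]
  have "p \<star> v \<in> RE V W'"
  proof -
    have "\<not> split_epi C V W' (p \<star> v)"
    proof
      assume "split_epi C V W' (p \<star> v)"
      then obtain s where s: "ar W' V s" "(p \<star> v) \<star> s = Idt C W'" using split_epiE[OF _ D(5) D'(6)] by metis
      have e: "p \<star> (v \<star> s) = Idt C W'" using cmp_assoc[OF s(1) D(2) p] s(2) by simp
      then have "split_epi C W W' p" using split_epiI[OF p ar_cmp[OF D(2) s(1)]] by blast
      then have "is_iso C W W' p" using split_epi_iso A(3) A'(3) by blast
      then obtain p' where p': "ar W' W p'" "p' \<star> p = Idt C W" using is_isoE[OF _ D(6) D'(6)] by metis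
      have vs: "ar W' W (v \<star> s)" using D(2) s(1) by blast
      have "v \<star> s = p'" using cmp_assoc[OF vs p p'(1)] e p' id_l[OF vs] id_r[OF p'(1)] by simp
      then have "v \<star> (s \<star> p) = Idt C W" using cmp_assoc[OF p s(1) D(2)] p'(2) by simp
      then have "split_epi C V W v" using split_epiI[OF D(2) ar_cmp[OF s(1) p]] by blast
      then show False using AR_RE(1)[OF t(1)] by (simp add: RE_def)
    qed
    then show ?thesis using ar_cmp[OF p D(2)] by (simp add: RE_def)
  qed
  then obtain c where c: "ar V V' c" "p \<star> v = v' \<star> c" using A'(5) by blast
  obtain k where k: "ar (So U) (So U') k" "k \<star> w = w' \<star> p"
    by (rule tri_map[OF rot[OF A(1)] rot[OF A'(1)] c(1) p c(2)])
  then show ?thesis using Sh_surj[OF D(4) D'(4)] by blast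
qed

lemma AR_left_to_right:
  assumes t: "AR_triangle C (U, V, W, u, v, w)" "AR_triangle C (U', V', W', u', v', w')" and q: "ar U U' q"
  shows "\<exists>p. ar W W' p \<and> SM U U' q \<star> w = w' \<star> p"
proof -
  note A = AR_D[OF t(1)] note D = triD[OF A(1)]
  note A' = AR_D[OF t(2)] note D' = triD[OF A'(1)]
  obtain c where c: "ar V V' c" "u' \<star> q = c \<star> u"
    using AR_left_factor[OF t(1) RM_precmp[OF A(2) A'(2) AR_RE(2)[OF t(2)] q]] by blast
  show ?thesis
    by (rule tri_map[OF A(1) A'(1) q c(1) c(2)[symmetric]]) blast
qed

text \<open>Morphisms p and q linked by q[1] w = w' p are radical simultaneously, and between
  indecomposables a morphism outside the radical is an isomorphism. This makes \<tau> well defined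
  and injective on isomorphism classes.\<close>

lemma AR_tau_iso:
  assumes t: "AR_triangle C (U, V, W, u, v, w)" "AR_triangle C (U', V', W', u', v', w')"
  shows "isomorphic C W W' \<longleftrightarrow> isomorphic C U U'"
proof
  note A = AR_D[OF t(1)] note D = triD[OF A(1)]
  note A' = AR_D[OF t(2)] note D' = triD[OF A'(1)]
  {
    assume "isomorphic C W W'"
    then obtain p where p: "is_iso C W W' p" unfolding isomorphic_def by blast
    then have pa: "ar W W' p" using is_isoE[OF _ D(6) D'(6)] by blast
    obtain q where q: "ar U U' q" "SM U U' q \<star> w = w' \<star> p" using AR_right_to_left[OF t pa] by blast
    have "p \<notin> RE W W'" using iso_split(2)[OF p] by (simp add: RE_def)
    then have "q \<notin> RM U U'"
      using AR_right_zero[OF t(2) pa] AR_left_zero[OF t(1) q(1)] q(2) by auto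
    then have "is_iso C U U' q" using split_mono_iso[OF A(2) A'(2)] q(1) by (auto simp: RM_def)
    then show "isomorphic C U U'" unfolding isomorphic_def by blast
  }
  assume "isomorphic C U U'"
  then obtain q where q: "is_iso C U U' q" unfolding isomorphic_def by blast
  then have qa: "ar U U' q" using is_isoE[OF _ D(4) D'(4)] by blast
  obtain p where p: "ar W W' p" "SM U U' q \<star> w = w' \<star> p" using AR_left_to_right[OF t qa] by blast
  have "q \<notin> RM U U'" using iso_split(1)[OF q] by (simp add: RM_def)
  then have "p \<notin> RE W W'"
    using AR_right_zero[OF t(2) p(1)] AR_left_zero[OF t(1) qa] p(2) by auto
  then have "is_iso C W W' p" using split_epi_iso[OF A(3) A'(3)] p(1) by (auto simp: RE_def)
  then show "isomorphic C W W'" unfolding isomorphic_def by blast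
qed

text \<open>Both \<open>End U\<close> and \<open>End W\<close> act on \<open>w\<close>; the two orbits agree and are the respective residue
  division rings as vector spaces.\<close>

lemma AR_dl:
  assumes t: "AR_triangle C (U, V, W, u, v, w)"
  shows "dl U = dl W"
proof -
  note A = AR_D[OF t] note D = triD[OF A(1)]
  have lm: "linear_map K (Hom C U U) (Hom C W (So U)) (\<lambda>q. SM U U q \<star> w)"
    using linear_map_comp[OF Sh_linear[OF D(4) D(4)] lin_l[OF Sh_Ob[OF D(4)] D(3)]] .
  have kU: "{q \<in> Mor C U U. SM U U q \<star> w = zr W (So U)} = RM U U"
    using AR_left_zero[OF t] D(4) by (auto simp: ar_def RM_def)
  have kW: "{p \<in> Mor C W W. w \<star> p = zr W (So U)} = RM W W"
    using AR_right_zero[OF t] D(6) RM_RE[OF A(3) A(3)] by (auto simp: ar_def RM_def)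
  have "(\<lambda>q. SM U U q \<star> w) ` Mor C U U = (\<lambda>p. w \<star> p) ` Mor C W W"
  proof (intro equalityI subsetI)
    fix x assume "x \<in> (\<lambda>q. SM U U q \<star> w) ` Mor C U U"
    then obtain q where q: "ar U U q" "x = SM U U q \<star> w" using D(4) by (auto simp: ar_def)
    then obtain p where "ar W W p" "x = w \<star> p" using AR_left_to_right[OF t t] by metis
    then show "x \<in> (\<lambda>p. w \<star> p) ` Mor C W W" using arD(3) by blast
  next
    fix x assume "x \<in> (\<lambda>p. w \<star> p) ` Mor C W W"
    then obtain p where p: "ar W W p" "x = w \<star> p" using D(6) by (auto simp: ar_def)
    then obtain q where "ar U U q" "x = SM U U q \<star> w" using AR_right_to_left[OF t t] by metis
    then show "x \<in> (\<lambda>q. SM U U q \<star> w) ` Mor C U U" using arD(3) by blast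
  qed
  moreover have "hd U U = sd W (So U) ((\<lambda>q. SM U U q \<star> w) ` Mor C U U) + rd U U"
    using linear_map.sdim_image_kernel(3)[OF lm fin_dim_Hom[OF D(4) D(4)] Mor_subspace[OF D(4) D(4)]]
    unfolding kU by (simp add: hd_def rd_def sd_def)
  moreover have "hd W W = sd W (So U) ((\<lambda>p. w \<star> p) ` Mor C W W) + rd W W"
    using sd_post(3)[OF D(3) Mor_subspace[OF D(6) D(6)] D(6)] unfolding kW by (simp add: hd_def rd_def)
  ultimately show ?thesis unfolding dl_def by simp
qed

end

section \<open>Finite stable components\<close>

context ks_category
begin

text \<open>The dimension of Hom/rad (X, Y) is counted once as a functor of Y and once, in the
  opposite category, as a functor of X.\<close>

lemma dl_iso:
  assumes i: "isomorphic C X Y" and X: "indecomposable C X" and Y: "indecomposable C Y"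
  shows "dl X = dl Y"
proof -
  have o: "X \<in> Ob C" "Y \<in> Ob C" using X Y indecD by auto
  have "hd X Y = rd X Y + dl X" using hd_rd_indec[OF X Y] i by simp
  moreover have "ks_category.hd K (op_cat C) Y X = ks_category.rd K (op_cat C) Y X + ks_category.dl K (op_cat C) Y"
    using ks_category.hd_rd_indec[OF op_ks, of Y X] X Y isomorphic_op[OF o(2,1)] isomorphic_sym[OF i o]
    by (simp add: indecomposable_op)
  ultimately show ?thesis using hd_op[of Y X] rd_op[OF Y X] dl_op[OF Y] by simp
qed

end

section \<open>The finite component as a valued translation quiver\<close>

locale stable_setup = ks_triangulated K C
  for K :: "('k, 'r) ring_scheme" and C :: "('o, 'm, 'k, 'z) tri_cat_scheme" +
  fixes \<Gamma> :: "'o set set"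
  assumes stable: "stable_component C \<Gamma>" and fin: "finite \<Gamma>"
begin

abbreviation cl where "cl \<equiv> iso_class C"
definition inG where "inG X \<longleftrightarrow> indecomposable C X \<and> cl X \<in> \<Gamma>"
definition rep where "rep x = (SOME X. indecomposable C X \<and> cl X = x)"

lemma cl_eq: "\<lbrakk>indecomposable C X; indecomposable C Y\<rbrakk> \<Longrightarrow> cl X = cl Y \<longleftrightarrow> isomorphic C X Y"
  using iso_class_eq_iff indecD(1) by blast

lemma comp: obtains x0 where "x0 \<in> qverts (AR_quiver C)" "\<Gamma> = (qarr (AR_quiver C) \<union> (qarr (AR_quiver C))\<inverse>)\<^sup>* `` {x0}"
  using stable unfolding stable_component_def quiver_component_def by blast

lemma arr_verts: "(x, y) \<in> qarr (AR_quiver C) \<Longrightarrow> x \<in> qverts (AR_quiver C) \<and> y \<in> qverts (AR_quiver C)"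
  unfolding AR_quiver_def by auto

lemma Gamma_verts: "\<Gamma> \<subseteq> qverts (AR_quiver C)"
proof
  fix x assume x: "x \<in> \<Gamma>"
  obtain x0 where x0: "x0 \<in> qverts (AR_quiver C)" "\<Gamma> = (qarr (AR_quiver C) \<union> (qarr (AR_quiver C))\<inverse>)\<^sup>* `` {x0}"
    using comp .
  then have "(x0, x) \<in> (qarr (AR_quiver C) \<union> (qarr (AR_quiver C))\<inverse>)\<^sup>*" using x by blast
  then show "x \<in> qverts (AR_quiver C)" using x0(1) arr_verts by (induct rule: rtrancl_induct) blast+
qed

lemma rep: "x \<in> \<Gamma> \<Longrightarrow> indecomposable C (rep x)" "x \<in> \<Gamma> \<Longrightarrow> cl (rep x) = x"
proof -
  assume "x \<in> \<Gamma>"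
  then have "\<exists>X. indecomposable C X \<and> cl X = x" using Gamma_verts unfolding AR_quiver_def by auto
  then have "indecomposable C (rep x) \<and> cl (rep x) = x" unfolding rep_def by (rule someI_ex)
  then show "indecomposable C (rep x)" "cl (rep x) = x" by auto
qed

lemma inG_rep: "x \<in> \<Gamma> \<Longrightarrow> inG (rep x)" using rep by (simp add: inG_def)

lemma rep_iso: "inG X \<Longrightarrow> isomorphic C X (rep (cl X))"
  using cl_eq[of X "rep (cl X)"] rep[of "cl X"] by (simp add: inG_def)

lemma inG_irreducible:
  "\<lbrakk>inG M; indecomposable C X; irreducible_mor C M X f \<or> irreducible_mor C X M f\<rbrakk> \<Longrightarrow> inG X"
  using stable unfolding stable_component_def inG_def by blast

lemma qtau_iff: "(x, y) \<in> qtau (AR_quiver C) \<longleftrightarrow>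
    (\<exists>U V W u v w. AR_triangle C (U, V, W, u, v, w) \<and> x = cl W \<and> y = cl U)"
  by (simp add: AR_quiver_def) blast

lemma qtau_eq: "\<lbrakk>(x, y) \<in> qtau (AR_quiver C); (x', y') \<in> qtau (AR_quiver C)\<rbrakk> \<Longrightarrow> x = x' \<longleftrightarrow> y = y'"
  unfolding qtau_iff using AR_tau_iso AR_D(2,3) cl_eq by metis

definition tau where "tau x = (SOME y. y \<in> \<Gamma> \<and> (x, y) \<in> qtau (AR_quiver C))"

lemma tau: "x \<in> \<Gamma> \<Longrightarrow> tau x \<in> \<Gamma>" "x \<in> \<Gamma> \<Longrightarrow> (x, tau x) \<in> qtau (AR_quiver C)"
proof -
  assume x: "x \<in> \<Gamma>"
  have "\<forall>n::int. \<exists>N\<in>\<Gamma>. (cl (rep x), N) \<in> tau_pow (AR_quiver C) n"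
    using stable[unfolded stable_component_def, THEN conjunct2, THEN spec, of "rep x"] rep[OF x] x by simp
  then have "\<exists>N\<in>\<Gamma>. (x, N) \<in> tau_pow (AR_quiver C) 1" using rep(2)[OF x] by metis
  then have "\<exists>y. y \<in> \<Gamma> \<and> (x, y) \<in> qtau (AR_quiver C)" by (auto simp: tau_pow_def)
  then have "tau x \<in> \<Gamma> \<and> (x, tau x) \<in> qtau (AR_quiver C)" unfolding tau_def by (rule someI_ex)
  then show "tau x \<in> \<Gamma>" "(x, tau x) \<in> qtau (AR_quiver C)" by auto
qed

text \<open>Injectivity is \<open>AR_tau_iso\<close> on classes; surjectivity then comes from
  finiteness of \<Gamma>.\<close>

lemma tau_bij: "bij_betw tau \<Gamma> \<Gamma>"
proof -
  have "inj_on tau \<Gamma>" using tau(2) qtau_eq unfolding inj_on_def by metis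
  moreover have "tau ` \<Gamma> \<subseteq> \<Gamma>" using tau(1) by blast
  ultimately show ?thesis using endo_inj_surj[OF fin] by (simp add: bij_betw_def)
qed

lemma tau_surj: "x \<in> \<Gamma> \<Longrightarrow> \<exists>z\<in>\<Gamma>. tau z = x"
  using tau_bij unfolding bij_betw_def by (metis imageE)

lemma AR_ex:
  assumes y: "y \<in> \<Gamma>"
  obtains U V W u v w where "AR_triangle C (U, V, W, u, v, w)" "cl W = y" "cl U = tau y"
    "indecomposable C U" "indecomposable C W" "V \<in> Ob C"
proof -
  obtain U V W u v w where A: "AR_triangle C (U, V, W, u, v, w)" "cl W = y" "cl U = tau y"
    using tau(2)[OF y] unfolding qtau_iff by metis
  show thesis using that[OF A AR_D(2,3)[OF A(1)] triD(5)[OF AR_D(1)[OF A(1)]]] .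
qed

text \<open>A single V has to serve all representatives of y on the right and all of
  \<open>tau y\<close> on the left. A multiplicity in it is then a label of an arrow into y and also
  of an arrow out of \<open>tau y\<close>.\<close>

lemma mid_ex:
  assumes y: "y \<in> \<Gamma>"
  shows "\<exists>V. V \<in> Ob C \<and> (\<forall>Y. indecomposable C Y \<longrightarrow> cl Y = y \<longrightarrow> (\<exists>U u v. ras U V Y u v \<and> cl U = tau y)) \<and>
    (\<forall>X. indecomposable C X \<longrightarrow> cl X = tau y \<longrightarrow> (\<exists>W u v. las X V W u v))"
proof -
  obtain U V W u v w where A: "AR_triangle C (U, V, W, u, v, w)" "cl W = y" "cl U = tau y"
    "indecomposable C U" "indecomposable C W" "V \<in> Ob C" using AR_ex[OF y] .
  have "\<exists>U u v. ras U V Y u v \<and> cl U = tau y" if "indecomposable C Y" "cl Y = y" for Y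
    using ras_iso[OF AR_ras[OF A(1)]] cl_eq[OF A(5) that(1)] that A(2,3) by metis
  moreover have "\<exists>W u v. las X V W u v" if "indecomposable C X" "cl X = tau y" for X
    using las_iso[OF AR_las[OF A(1)]] cl_eq[OF A(4) that(1)] that A(3) by metis
  ultimately show ?thesis using A(6) by blast
qed

definition mid where "mid y = (SOME V. V \<in> Ob C \<and>
    (\<forall>Y. indecomposable C Y \<longrightarrow> cl Y = y \<longrightarrow> (\<exists>U u v. ras U V Y u v \<and> cl U = tau y)) \<and>
    (\<forall>X. indecomposable C X \<longrightarrow> cl X = tau y \<longrightarrow> (\<exists>W u v. las X V W u v)))"

lemma mid:
  assumes "y \<in> \<Gamma>"
  shows "mid y \<in> Ob C" "\<lbrakk>indecomposable C Y; cl Y = y\<rbrakk> \<Longrightarrow> \<exists>U u v. ras U (mid y) Y u v \<and> cl U = tau y"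
    "\<lbrakk>indecomposable C X; cl X = tau y\<rbrakk> \<Longrightarrow> \<exists>W u v. las X (mid y) W u v"
  using someI_ex[OF mid_ex[OF assms]] unfolding mid_def[symmetric] by blast+

text \<open>\<open>dl\<close> is the dimension of the residue division ring of the endomorphism ring; both divisions are exact.\<close>

definition iq where "iq x y = irr (rep x) (rep y)"
definition al where "al x y = iq x y div dl (rep x)"
definition bl where "bl x y = iq x y div dl (rep y)"

lemma irr_mid:
  assumes Y: "inG Y" and X: "indecomposable C X" and n: "multiplicity_in C X (mid (cl Y)) n"
  shows "irr X Y = n * dl X"
  using mid(2)[of "cl Y" Y] ras_irr[OF _ X n] Y by (auto simp: inG_def)

lemma irr_mid_left:
  assumes y: "y \<in> \<Gamma>" and Z: "indecomposable C Z" "cl Z = tau y" and X: "indecomposable C X"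
    and n: "multiplicity_in C X (mid y) n"
  shows "irr Z X = n * dl X"
  using mid(3)[OF y Z] las_irr[OF _ X n] by blast

lemma irr_al: "\<lbrakk>inG X; inG Y\<rbrakk> \<Longrightarrow> irr X Y = al (cl X) (cl Y) * dl X"
proof -
  assume a: "inG X" "inG Y"
  define x y where "x = cl X" and "y = cl Y"
  have G: "x \<in> \<Gamma>" "y \<in> \<Gamma>" and i: "indecomposable C X" "indecomposable C Y" using a by (auto simp: inG_def x_def y_def)
  obtain n where n: "multiplicity_in C X (mid y) n" using multiplicity_ex mid(1)[OF G(2)] by blast
  have n': "multiplicity_in C (rep x) (mid y) n"
    using multiplicity_iso[OF n rep_iso[OF a(1), folded x_def]] indecD(1) i rep(1)[OF G(1)] by blast
  have "irr (rep x) (rep y) = n * dl (rep x)"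
    using irr_mid[OF inG_rep[OF G(2)] rep(1)[OF G(1)]] n' rep(2)[OF G(2)] by simp
  then have "al x y = n" using dl_pos[OF rep(1)[OF G(1)]] by (simp add: al_def iq_def)
  moreover have "irr X Y = n * dl X" using irr_mid[OF a(2) i(1)] n y_def by simp
  ultimately show ?thesis using x_def y_def by simp
qed

lemma irr_bl: "\<lbrakk>inG X; inG Y\<rbrakk> \<Longrightarrow> irr X Y = bl (cl X) (cl Y) * dl Y"
proof -
  assume a: "inG X" "inG Y"
  define x y where "x = cl X" and "y = cl Y"
  have G: "x \<in> \<Gamma>" "y \<in> \<Gamma>" and i: "indecomposable C X" "indecomposable C Y" using a by (auto simp: inG_def x_def y_def)
  \<comment> \<open>The second label is counted in the triangle starting at X, which is the one
    ending at \<tau>^-1 of its class.\<close>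
  obtain z where z: "z \<in> \<Gamma>" "tau z = x" using tau_surj[OF G(1)] by blast
  obtain n where n: "multiplicity_in C Y (mid z) n" using multiplicity_ex mid(1)[OF z(1)] by blast
  have n': "multiplicity_in C (rep y) (mid z) n"
    using multiplicity_iso[OF n rep_iso[OF a(2), folded y_def]] indecD(1) i rep(1)[OF G(2)] by blast
  have "irr (rep x) (rep y) = n * dl (rep y)"
    using irr_mid_left[OF z(1) rep(1)[OF G(1)] _ rep(1)[OF G(2)] n'] rep(2)[OF G(1)] z(2) by simp
  then have "bl x y = n" using dl_pos[OF rep(1)[OF G(2)]] by (simp add: bl_def iq_def)
  moreover have "irr X Y = n * dl Y" using irr_mid_left[OF z(1) i(1) _ i(2) n] z(2) x_def by simp
  ultimately show ?thesis using x_def y_def by simp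
qed

lemma irr_pos: "\<lbrakk>indecomposable C X; inG Y\<rbrakk> \<Longrightarrow> irr X Y \<noteq> 0 \<longleftrightarrow> (\<exists>f. irreducible_mor C X Y f)"
  using mid(2)[of "cl Y" Y] irr_pos_iff by (auto simp: inG_def)

text \<open>If n is the multiplicity of x in the middle term ending at y, both values of
  \<open>iq\<close> are n times \<open>dl (rep x)\<close>. With the equality of residue dimensions
  this gives the exchange of labels in \<open>al_tau\<close>.\<close>

lemma iq_tau:
  assumes "x \<in> \<Gamma>" "y \<in> \<Gamma>"
  shows "iq (tau y) x = iq x y" "dl (rep (tau y)) = dl (rep y)"
proof -
  note X = rep[OF assms(1)] and Y = rep[OF assms(2)] and T = rep[OF tau(1)[OF assms(2)]]
  obtain n where n: "multiplicity_in C (rep x) (mid y) n" using multiplicity_ex mid(1)[OF assms(2)] by blast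
  have "irr (rep x) (rep y) = n * dl (rep x)"
    using irr_mid[OF inG_rep[OF assms(2)] X(1)] n Y(2) by simp
  moreover have "irr (rep (tau y)) (rep x) = n * dl (rep x)"
    using irr_mid_left[OF assms(2) T X(1) n] .
  ultimately show "iq (tau y) x = iq x y" by (simp add: iq_def)
  obtain U V W u v w where A: "AR_triangle C (U, V, W, u, v, w)" "cl W = y" "cl U = tau y"
    "indecomposable C U" "indecomposable C W" using AR_ex[OF assms(2)] by metis
  have "isomorphic C (rep (tau y)) U" "isomorphic C W (rep y)" using cl_eq A T Y by metis+
  then show "dl (rep (tau y)) = dl (rep y)"
    using dl_iso[OF _ T(1) A(4)] dl_iso[OF _ A(5) Y(1)] AR_dl[OF A(1)] by simp
qed

lemma al_tau: "\<lbrakk>x \<in> \<Gamma>; y \<in> \<Gamma>\<rbrakk> \<Longrightarrow> al (tau y) x = bl x y" "\<lbrakk>x \<in> \<Gamma>; y \<in> \<Gamma>\<rbrakk> \<Longrightarrow> bl (tau y) x = al x y"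
  using iq_tau by (simp_all add: al_def bl_def)

lemma al_zero:
  assumes "x \<in> \<Gamma>" "y \<in> \<Gamma>"
  shows "al x y = 0 \<longleftrightarrow> iq x y = 0" "bl x y = 0 \<longleftrightarrow> iq x y = 0"
proof -
  have "iq x y = al x y * dl (rep x)"
    using irr_al[OF inG_rep[OF assms(1)] inG_rep[OF assms(2)]] rep(2) assms by (simp add: iq_def)
  then show "al x y = 0 \<longleftrightarrow> iq x y = 0" using dl_pos[OF rep(1)[OF assms(1)]] by simp
  have "iq x y = bl x y * dl (rep y)"
    using irr_bl[OF inG_rep[OF assms(1)] inG_rep[OF assms(2)]] rep(2) assms by (simp add: iq_def)
  then show "bl x y = 0 \<longleftrightarrow> iq x y = 0" using dl_pos[OF rep(1)[OF assms(2)]] by simp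
qed

lemma arr_iff:
  "(x, y) \<in> qarr (AR_quiver C) \<and> x \<in> \<Gamma> \<and> y \<in> \<Gamma> \<longleftrightarrow> x \<in> \<Gamma> \<and> y \<in> \<Gamma> \<and> al x y \<noteq> 0"
proof
  assume a: "(x, y) \<in> qarr (AR_quiver C) \<and> x \<in> \<Gamma> \<and> y \<in> \<Gamma>"
  then obtain X Y f where X: "x = cl X" "y = cl Y" "indecomposable C X" "indecomposable C Y" "irreducible_mor C X Y f"
    unfolding AR_quiver_def by auto
  then have g: "inG X" "inG Y" using a by (auto simp: inG_def)
  have "irr X Y \<noteq> 0" using irr_pos[OF X(3) g(2)] X(5) by blast
  then show "x \<in> \<Gamma> \<and> y \<in> \<Gamma> \<and> al x y \<noteq> 0" using irr_al[OF g] a X by auto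
next
  assume a: "x \<in> \<Gamma> \<and> y \<in> \<Gamma> \<and> al x y \<noteq> 0"
  have "irr (rep x) (rep y) \<noteq> 0" using a al_zero(1)[of x y] by (simp add: iq_def)
  then have "\<exists>f. irreducible_mor C (rep x) (rep y) f" using irr_pos[OF rep(1) inG_rep] a by blast
  then have "(cl (rep x), cl (rep y)) \<in> qarr (AR_quiver C)" using rep(1) a unfolding AR_quiver_def by auto
  then show "(x, y) \<in> qarr (AR_quiver C) \<and> x \<in> \<Gamma> \<and> y \<in> \<Gamma>" using a rep(2) by simp
qed

lemma qlabI:
  assumes "indecomposable C X" "indecomposable C Y" "irreducible_mor C X Y f"
    "AR_triangle C (U, V, Y, u, v, w)" "multiplicity_in C X V a"
    "AR_triangle C (X, V', W', u', v', w')" "multiplicity_in C Y V' b"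
  shows "(cl X, cl Y, a, b) \<in> qlab (AR_quiver C)"
proof -
  have "\<exists>U V u v w. AR_triangle C (U, V, Y, u, v, w) \<and> multiplicity_in C X V a"
    "\<exists>V W u v w. AR_triangle C (X, V, W, u, v, w) \<and> multiplicity_in C Y V b"
    using assms(4-7) by blast+
  then show ?thesis unfolding AR_quiver_def quiver.simps mem_Collect_eq using assms(1-3) by blast
qed

lemma lab_iff:
  "(x, y, a, b) \<in> qlab (AR_quiver C) \<and> x \<in> \<Gamma> \<and> y \<in> \<Gamma> \<longleftrightarrow>
    x \<in> \<Gamma> \<and> y \<in> \<Gamma> \<and> al x y \<noteq> 0 \<and> a = al x y \<and> b = bl x y"
proof
  assume h: "(x, y, a, b) \<in> qlab (AR_quiver C) \<and> x \<in> \<Gamma> \<and> y \<in> \<Gamma>"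
  then obtain X Y f U V u v w V' W' u' v' w' where X: "x = cl X" "y = cl Y" "indecomposable C X" "indecomposable C Y"
    "irreducible_mor C X Y f" "AR_triangle C (U, V, Y, u, v, w)" "multiplicity_in C X V a"
    "AR_triangle C (X, V', W', u', v', w')" "multiplicity_in C Y V' b"
    unfolding AR_quiver_def by auto
  then have g: "inG X" "inG Y" using h by (auto simp: inG_def)
  have "(x, y) \<in> qarr (AR_quiver C)" using X unfolding AR_quiver_def by auto
  then have "al x y \<noteq> 0" using arr_iff h by blast
  moreover have "a = al x y"
    using ras_irr[OF AR_ras[OF X(6)] X(3,7)] irr_al[OF g] X(1,2) dl_pos[OF X(3)] by simp
  moreover have "b = bl x y"
    using las_irr[OF AR_las[OF X(8)] X(4,9)] irr_bl[OF g] X(1,2) dl_pos[OF X(4)] by simp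
  ultimately show "x \<in> \<Gamma> \<and> y \<in> \<Gamma> \<and> al x y \<noteq> 0 \<and> a = al x y \<and> b = bl x y" using h by blast
next
  assume h: "x \<in> \<Gamma> \<and> y \<in> \<Gamma> \<and> al x y \<noteq> 0 \<and> a = al x y \<and> b = bl x y"
  obtain U V Y u v w where A: "AR_triangle C (U, V, Y, u, v, w)" "cl Y = y" "indecomposable C Y" "V \<in> Ob C"
    using AR_ex h by metis
  obtain z where z: "z \<in> \<Gamma>" "tau z = x" using tau_surj h by blast
  obtain X V' W' u' v' w' where B: "AR_triangle C (X, V', W', u', v', w')" "cl X = x" "indecomposable C X" "V' \<in> Ob C"
    using AR_ex z by metis
  have g: "inG X" "inG Y" using A B h by (auto simp: inG_def)
  obtain a' where a': "multiplicity_in C X V a'" using multiplicity_ex A(4) by blast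
  obtain b' where b': "multiplicity_in C Y V' b'" using multiplicity_ex B(4) by blast
  have "a' = a"
    using ras_irr[OF AR_ras[OF A(1)] B(3) a'] irr_al[OF g] A(2) B(2) dl_pos[OF B(3)] h by simp
  moreover have "b' = b"
    using las_irr[OF AR_las[OF B(1)] A(3) b'] irr_bl[OF g] A(2) B(2) dl_pos[OF A(3)] h by simp
  moreover have "irr X Y \<noteq> 0" using irr_al[OF g] A(2) B(2) h dl_pos[OF B(3)] by simp
  then have "\<exists>f. irreducible_mor C X Y f" using irr_pos[OF B(3) g(2)] by blast
  ultimately have "(x, y, a, b) \<in> qlab (AR_quiver C)"
    using qlabI[OF B(3) A(3) _ A(1) a' B(1) b'] A(2) B(2) by blast
  then show "(x, y, a, b) \<in> qlab (AR_quiver C) \<and> x \<in> \<Gamma> \<and> y \<in> \<Gamma>" using h by blast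
qed

text \<open>The form in which \<Gamma> is handed to the purely combinatorial
  \<open>finite_vtq\<close>.\<close>

lemma full_subquiver_eq:
  "full_subquiver (AR_quiver C) \<Gamma> =
    \<lparr>qverts = \<Gamma>, qarr = {(x, y). x \<in> \<Gamma> \<and> y \<in> \<Gamma> \<and> al x y \<noteq> 0},
     qlab = {(x, y, al x y, bl x y) | x y. x \<in> \<Gamma> \<and> y \<in> \<Gamma> \<and> al x y \<noteq> 0}, qtau = {(x, tau x) | x. x \<in> \<Gamma>}\<rparr>"
proof -
  have "qarr (AR_quiver C) \<inter> (\<Gamma> \<times> \<Gamma>) = {(x, y). x \<in> \<Gamma> \<and> y \<in> \<Gamma> \<and> al x y \<noteq> 0}"
    using arr_iff by blast
  moreover have "qlab (AR_quiver C) \<inter> (\<Gamma> \<times> \<Gamma> \<times> UNIV) = {(x, y, al x y, bl x y) | x y. x \<in> \<Gamma> \<and> y \<in> \<Gamma> \<and> al x y \<noteq> 0}"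
  proof (rule Set.set_eqI)
    fix t :: "'o set \<times> 'o set \<times> nat \<times> nat"
    obtain x y a b where "t = (x, y, a, b)" by (cases t)
    then show "t \<in> qlab (AR_quiver C) \<inter> (\<Gamma> \<times> \<Gamma> \<times> UNIV) \<longleftrightarrow>
        t \<in> {(x, y, al x y, bl x y) | x y. x \<in> \<Gamma> \<and> y \<in> \<Gamma> \<and> al x y \<noteq> 0}"
      using lab_iff[of x y a b] by auto
  qed
  moreover have "qtau (AR_quiver C) \<inter> (\<Gamma> \<times> \<Gamma>) = {(x, tau x) | x. x \<in> \<Gamma>}"
  proof -
    have "y = tau x" if "(x, y) \<in> qtau (AR_quiver C)" "x \<in> \<Gamma>" for x y
      using qtau_eq[OF that(1) tau(2)[OF that(2)]] by simp
    then show ?thesis using tau by fast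
  qed
  moreover have "qverts (AR_quiver C) \<inter> \<Gamma> = \<Gamma>" using Gamma_verts by blast
  ultimately show ?thesis unfolding full_subquiver_def by simp
qed

lemma Gamma_nonempty: "\<Gamma> \<noteq> {}"
proof -
  obtain x0 where "\<Gamma> = (qarr (AR_quiver C) \<union> (qarr (AR_quiver C))\<inverse>)\<^sup>* `` {x0}" using comp by metis
  then show ?thesis by auto
qed

lemma connected:
  fixes E defines "E \<equiv> {(x, y). x \<in> \<Gamma> \<and> y \<in> \<Gamma> \<and> al x y \<noteq> 0}"
  assumes "x \<in> \<Gamma>" "y \<in> \<Gamma>"
  shows "(x, y) \<in> (E \<union> E\<inverse>)\<^sup>*"
proof -
  let ?R = "qarr (AR_quiver C) \<union> (qarr (AR_quiver C))\<inverse>"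
  obtain x0 where x0: "\<Gamma> = ?R\<^sup>* `` {x0}" using comp by metis
  have *: "(x0, z) \<in> (E \<union> E\<inverse>)\<^sup>*" if "(x0, z) \<in> ?R\<^sup>*" for z
    using that
  proof (induct rule: rtrancl_induct)
    case (step y z)
    have "y \<in> \<Gamma>" "z \<in> \<Gamma>" unfolding x0 using step(1,2) by (auto intro: rtrancl_into_rtrancl)
    then have "(y, z) \<in> E \<union> E\<inverse>" using step(2) arr_iff unfolding E_def by blast
    then show ?case using step(3) by (rule rtrancl_into_rtrancl[rotated])
  qed simp
  have "sym ((E \<union> E\<inverse>)\<^sup>*)" by (rule sym_rtrancl) (auto simp: sym_def)
  then have "(x, x0) \<in> (E \<union> E\<inverse>)\<^sup>*" using * assms(2) x0 by (auto dest: symD)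
  then show ?thesis using * assms(3) x0 by (auto intro: rtrancl_trans)
qed

text \<open>Each summand X of the middle term has nonzero \<open>irr\<close> into y, hence an
  irreducible morphism into a representative of y, and stability puts X into \<Gamma>. So the sums
  below run over \<Gamma> alone.\<close>

lemma mid_decomp:
  assumes y: "y \<in> \<Gamma>"
  obtains Xs i p where "biprod (mid y) Xs i p" "\<forall>X\<in>set Xs. inG X"
    "\<forall>x\<in>\<Gamma>. al x y = card {k. k < length Xs \<and> cl (Xs ! k) = x}"
proof -
  obtain Xs where Xs: "direct_sum C (mid y) Xs" "\<forall>X\<in>set Xs. indecomposable C X"
    using decomp mid(1)[OF y] by blast
  obtain i p where b: "biprod (mid y) Xs i p" using Xs(1) direct_sum_iff by blast
  have m: "multiplicity_in C X (mid y) (length (filter (isomorphic C X) Xs))" for X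
    using Xs unfolding multiplicity_in_def by blast
  have irr: "irr X (rep y) = length (filter (isomorphic C X) Xs) * dl X" if "indecomposable C X" for X
    using irr_mid[OF inG_rep[OF y] that] m rep(2)[OF y] by simp
  have inG: "inG X" if X: "X \<in> set Xs" for X
  proof -
    have Xi: "indecomposable C X" using Xs X by blast
    have "X \<in> set (filter (isomorphic C X) Xs)" using X isomorphic_refl[OF indecD(1)[OF Xi]] by simp
    then have "length (filter (isomorphic C X) Xs) \<noteq> 0" by (metis length_pos_if_in_set less_irrefl)
    then have "irr X (rep y) \<noteq> 0" using irr[OF Xi] dl_pos[OF Xi] by simp
    then obtain f where "irreducible_mor C X (rep y) f" using irr_pos[OF Xi inG_rep[OF y]] by blast
    then show ?thesis using inG_irreducible[OF inG_rep[OF y] Xi] by blast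
  qed
  moreover have "al x y = card {k. k < length Xs \<and> cl (Xs ! k) = x}" if x: "x \<in> \<Gamma>" for x
  proof -
    have "al x y = length (filter (isomorphic C (rep x)) Xs)"
      using irr[OF rep(1)[OF x]] dl_pos[OF rep(1)[OF x]] by (simp add: al_def iq_def)
    moreover have "isomorphic C (rep x) (Xs ! k) \<longleftrightarrow> cl (Xs ! k) = x" if "k < length Xs" for k
      using cl_eq[OF rep(1)[OF x], of "Xs ! k"] Xs(2) that rep(2)[OF x] by auto
    ultimately show ?thesis by (auto simp: length_filter_conv_card intro!: arg_cong[where f = card])
  qed
  ultimately show thesis using that[OF b] by blast
qed

section \<open>The strictly subadditive function\<close>

definition gf where "gf y = (\<Sum>x\<in>\<Gamma>. hd (rep x) (rep y))"

lemma hd_mid: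
  assumes y: "y \<in> \<Gamma>" and M: "M \<in> Ob C"
  shows "hd M (mid y) = (\<Sum>x\<in>\<Gamma>. al x y * hd M (rep x))"
proof -
  obtain Xs i p where b: "biprod (mid y) Xs i p" "\<forall>X\<in>set Xs. inG X"
    "\<forall>x\<in>\<Gamma>. al x y = card {k. k < length Xs \<and> cl (Xs ! k) = x}" using mid_decomp[OF y] .
  have "hd M (mid y) = (\<Sum>k<length Xs. hd M (rep (cl (Xs ! k))))"
    unfolding hd_sum[OF b(1) M]
  proof (rule sum.cong)
    fix k assume "k \<in> {..<length Xs}"
    then have g: "inG (Xs ! k)" using b(2) by simp
    then show "hd M (Xs ! k) = hd M (rep (cl (Xs ! k)))"
      using hd_iso[OF rep_iso[OF g] M] indecD(1) rep(1) by (simp add: inG_def)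
  qed simp
  also have "\<dots> = (\<Sum>x\<in>\<Gamma>. \<Sum>k\<in>{k. k \<in> {..<length Xs} \<and> cl (Xs ! k) = x}. hd M (rep (cl (Xs ! k))))"
    using b(2) fin by (intro sum.group[symmetric]) (auto simp: inG_def)
  also have "\<dots> = (\<Sum>x\<in>\<Gamma>. al x y * hd M (rep x))"
    using b(3) by (intro sum.cong) auto
  finally show ?thesis .
qed

lemma gf_strict:
  assumes y: "y \<in> \<Gamma>"
  shows "(\<Sum>x\<in>\<Gamma>. al x y * gf x) < gf (tau y) + gf y"
proof -
  have le: "hd M (mid y) \<le> hd M (rep (tau y)) + hd M (rep y)"
    "M = rep y \<Longrightarrow> hd M (mid y) < hd M (rep (tau y)) + hd M (rep y)" if M: "M \<in> Ob C" for M
  proof -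
    obtain U u v where r: "ras U (mid y) (rep y) u v" "cl U = tau y" using mid(2)[OF y rep[OF y]] by blast
    have "isomorphic C (rep (tau y)) U" using cl_eq[OF rep(1)[OF tau(1)[OF y]] rasD(1)[OF r(1)]] r(2) rep(2)[OF tau(1)[OF y]] by simp
    then have "hd M U = hd M (rep (tau y))"
      using hd_iso[OF _ M] indecD(1) rep(1)[OF tau(1)[OF y]] rasD(6)[OF r(1)] by blast
    then show "hd M (mid y) \<le> hd M (rep (tau y)) + hd M (rep y)"
      "M = rep y \<Longrightarrow> hd M (mid y) < hd M (rep (tau y)) + hd M (rep y)"
      using ras_subadditive[OF r(1) M] by auto
  qed
  have "(\<Sum>x\<in>\<Gamma>. al x y * gf x) = (\<Sum>x\<in>\<Gamma>. \<Sum>m\<in>\<Gamma>. al x y * hd (rep m) (rep x))"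
    unfolding gf_def by (simp add: sum_distrib_left)
  also have "\<dots> = (\<Sum>m\<in>\<Gamma>. \<Sum>x\<in>\<Gamma>. al x y * hd (rep m) (rep x))" by (rule sum.swap)
  also have "\<dots> = (\<Sum>m\<in>\<Gamma>. hd (rep m) (mid y))"
    using hd_mid[OF y indecD(1)[OF rep(1)]] by simp
  also have "\<dots> < (\<Sum>m\<in>\<Gamma>. hd (rep m) (rep (tau y)) + hd (rep m) (rep y))"
    using le indecD(1)[OF rep(1)] y fin by (intro sum_strict_mono_ex1) auto
  also have "\<dots> = gf (tau y) + gf y" unfolding gf_def by (simp add: sum.distrib)
  finally show ?thesis .
qed

section \<open>Indecomposables outside the component\<close>

lemma no_maps:
  assumes Y: "indecomposable C Y" "cl Y \<notin> \<Gamma>" and Z: "inG Z"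
  shows "Mor C Y Z = {zr Y Z}" "Mor C Z Y = {zr Z Y}"
proof -
  let ?P = "{X. inG X}" and ?R = "rep ` \<Gamma>"
  have Yo: "Y \<in> Ob C" using Y indecD by blast
  have ne: "\<not> is_iso C Y Z f" "\<not> is_iso C Z Y f" if "inG Z" for Z f
    using that Y cl_eq[OF _ Y(1), of Z] cl_eq[OF Y(1), of Z] unfolding inG_def isomorphic_def by metis+
  have R: "finite ?R" "?R \<subseteq> ?P" using fin inG_rep by auto
  have Rr: "\<exists>Z'\<in>?R. isomorphic C Z' Z \<and> isomorphic C Z Z'" if "Z \<in> ?P" for Z
  proof -
    have g: "cl Z \<in> \<Gamma>" "indecomposable C Z" using that by (auto simp: inG_def)
    then show ?thesis
      using rep_iso[of Z] that isomorphic_sym[OF _ indecD(1)[OF g(2)] indecD(1)[OF rep(1)[OF g(1)]]] by blast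
  qed
  show "Mor C Y Z = {zr Y Z}"
  proof (rule nakayama[OF Yo _ _ R])
    fix Z assume "Z \<in> ?P"
    then have Z: "inG Z" "indecomposable C Z" "cl Z \<in> \<Gamma>" by (auto simp: inG_def)
    obtain U u v where r: "ras U (mid (cl Z)) Z u v" using mid(2)[OF Z(3,2)] by blast
    obtain Xs i p where b: "biprod (mid (cl Z)) Xs i p" "\<forall>X\<in>set Xs. inG X" using mid_decomp[OF Z(3)] by metis
    have "f \<in> RE Y Z" if "ar Y Z f" for f
      using that ne(1)[OF Z(1)] split_epi_iso[OF Y(1) Z(2)] by (auto simp: RE_def)
    then have "\<forall>f. ar Y Z f \<longrightarrow> (\<exists>g. ar Y (mid (cl Z)) g \<and> f = v \<star> g)" using rasD(9)[OF r] by blast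
    then show "\<exists>V Xs v. direct_sum C V Xs \<and> set Xs \<subseteq> ?P \<and> v \<in> RE V Z \<and>
      (\<forall>f. ar Y Z f \<longrightarrow> (\<exists>g. ar Y V g \<and> f = v \<star> g))"
      using b rasD(12)[OF r] direct_sum_iff by blast
  qed (use Rr Z in \<open>auto simp: inG_def\<close>)
  have "Mor (op_cat C) Y Z = {zero_mor (op_cat C) Y Z}"
  proof (rule ks_category.nakayama[OF op_ks, where P = ?P and R = ?R])
    fix Z assume "Z \<in> ?P"
    then have Z: "inG Z" "indecomposable C Z" "cl Z \<in> \<Gamma>" by (auto simp: inG_def)
    \<comment> \<open>In the opposite category the triangle starting at Z plays the role of the one
      ending at Z, so the middle term is taken at \<tau>^-1 of its class.\<close>
    obtain z where z: "z \<in> \<Gamma>" "tau z = cl Z" using tau_surj[OF Z(3)] by blast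
    obtain W u v where l: "las Z (mid z) W u v" using mid(3)[OF z(1) Z(2)] z(2) by metis
    obtain Xs i p where b: "biprod (mid z) Xs i p" "\<forall>X\<in>set Xs. inG X" using mid_decomp[OF z(1)] by metis
    have "f \<in> RM Z Y" if "ar Z Y f" for f
      using that ne(2)[OF Z(1)] split_mono_iso[OF Z(2) Y(1)] by (auto simp: RM_def)
    then have "\<forall>f. ar Z Y f \<longrightarrow> (\<exists>g. ar (mid z) Y g \<and> f = g \<star> u)" using l unfolding las_def by blast
    moreover have "u \<in> RM Z (mid z)" using l unfolding las_def by blast
    ultimately show "\<exists>V Xs v. direct_sum (op_cat C) V Xs \<and> set Xs \<subseteq> ?P \<and> v \<in> ks_category.RE (op_cat C) V Z \<and>
      (\<forall>f. linear_category.ar (op_cat C) Y Z f \<longrightarrow>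
        (\<exists>g. linear_category.ar (op_cat C) Y V g \<and> f = v \<cdot>\<^bsub>op_cat C\<^esub> g))"
      using b direct_sum_iff unfolding direct_sum_op RE_op ar_op op_cat_simps by blast
  next
    fix Z assume "Z \<in> ?P"
    then have Z: "Z \<in> Ob C" "cl Z \<in> \<Gamma>" "Z \<in> ?P" using indecD(1) by (auto simp: inG_def)
    then show "\<exists>Z'\<in>?R. isomorphic (op_cat C) Z' Z"
      using Rr[OF Z(3)] isomorphic_op indecD(1)[OF rep(1)] by blast
  qed (use R Z Yo in \<open>auto simp: inG_def indecomposable_op\<close>)
  then show "Mor C Z Y = {zr Z Y}" by simp
qed

lemma all_in_Gamma:
  assumes conn: "connected_category C" and X: "indecomposable C X"
  shows "cl X \<in> \<Gamma>"
proof (rule ccontr)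
  assume n: "cl X \<notin> \<Gamma>"
  let ?P = "{X. inG X}" and ?Q = "{X. indecomposable C X \<and> cl X \<notin> \<Gamma>}"
  have "?P \<noteq> {}" using Gamma_nonempty inG_rep by blast
  moreover have "?Q \<noteq> {}" using X n by blast
  moreover have "?P \<inter> ?Q = {}" "?P \<union> ?Q = {X. indecomposable C X}" by (auto simp: inG_def)
  moreover have "\<forall>X\<in>?P. \<forall>Y\<in>?Q. Mor C X Y = {zero_mor C X Y} \<and> Mor C Y X = {zero_mor C Y X}"
    using no_maps by simp
  ultimately have "\<exists>P Q. P \<noteq> {} \<and> Q \<noteq> {} \<and> P \<inter> Q = {} \<and> P \<union> Q = {X. indecomposable C X} \<and>
    (\<forall>X\<in>P. \<forall>Y\<in>Q. Mor C X Y = {zero_mor C X Y} \<and> Mor C Y X = {zero_mor C Y X})"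
    by (intro exI[of _ ?P] exI[of _ ?Q] conjI)
  then show False using conn unfolding connected_category_def by (rule notE[rotated])
qed

end

section \<open>Subadditive functions on valued trees\<close>

text \<open>The first difference is at most B and each later one is smaller by at least 1, so f k is
  at most B + k B - k (k - 1) / 2, which eventually is negative. Everything is doubled to stay in
  the integers.\<close>

lemma concave_bounded:
  fixes f :: "nat \<Rightarrow> int"
  assumes conc: "\<And>i. Suc (Suc i) < n \<Longrightarrow> f i + f (Suc (Suc i)) < 2 * f (Suc i)"
    and bd: "\<And>i. i < n \<Longrightarrow> 0 \<le> f i \<and> f i \<le> B" and B: "0 \<le> B"
  shows "int n \<le> 2 * B + 3"
proof (rule ccontr)
  assume "\<not> ?thesis"
  then have n: "2 * B + 3 < int n" by simp
  have diff: "f (Suc i) - f i \<le> B - int i" if "Suc i < n" for i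
    using that
  proof (induct i)
    case 0
    then show ?case using bd[of 0] bd[of 1] by simp
  next
    case (Suc i)
    then show ?case using conc[of i] by simp
  qed
  have sum: "2 * f k \<le> 2 * B + 2 * int k * B - int k * (int k - 1)" if "k < n" for k
    using that
  proof (induct k)
    case 0
    then show ?case using bd[of 0] by simp
  next
    case (Suc k)
    then have "2 * f (Suc k) \<le> 2 * f k + 2 * (B - int k)" using diff[of k] by simp
    then show ?case using Suc by (simp add: algebra_simps)
  qed
  \<comment> \<open>At this k the doubled bound equals 2 B - 2 k, which is negative.\<close>
  define k where "k = nat (2 * B + 3)"
  have k: "int k = 2 * B + 3" "k < n" using n B by (auto simp: k_def)
  have "2 * f k \<le> 2 * B + 2 * int k * B - int k * (int k - 1)" using sum k by blast
  also have "\<dots> = 2 * B - 2 * int k" using k by (simp add: algebra_simps)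
  also have "\<dots> < 0" using k B by simp
  finally show False using bd[OF k(2)] by simp
qed

locale subadditive_tree =
  fixes T :: "'v valued_graph" and d :: "'v \<Rightarrow> nat" and B :: nat
  assumes tree: "valued_tree T"
    and fin_nb: "y \<in> vverts T \<Longrightarrow> finite {x. (x, y) \<in> vadj T}"
    and strict: "y \<in> vverts T \<Longrightarrow> (\<Sum>x | (x, y) \<in> vadj T. vd T x y * d x) < 2 * d y"
    and bounded: "y \<in> vverts T \<Longrightarrow> d y \<le> B"
begin

abbreviation "V \<equiv> vverts T"
abbreviation "w \<equiv> vd T"
definition "adj x y \<longleftrightarrow> w x y \<noteq> 0"

lemma adj_sym: "adj x y \<Longrightarrow> adj y x"
  using tree unfolding valued_tree_def adj_def vadj_def sym_def by blast

lemma adj_irrefl: "\<not> adj x x"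
  using tree unfolding valued_tree_def adj_def vadj_def irrefl_def by blast

lemma adj_V: "adj x y \<Longrightarrow> x \<in> V" "adj x y \<Longrightarrow> y \<in> V"
  using tree unfolding valued_tree_def adj_def vadj_def by auto

lemma adj_pos: "adj x y \<Longrightarrow> 1 \<le> w x y" "adj x y \<Longrightarrow> 1 \<le> w y x"
  using adj_sym[of x y] by (auto simp: adj_def)

lemma no_cycle:
  assumes "length p \<ge> 3" "distinct p" "\<And>i. Suc i < length p \<Longrightarrow> adj (p ! i) (p ! Suc i)" "adj (last p) (hd p)"
  shows False
  using tree assms unfolding valued_tree_def adj_def vadj_def by blast

lemma connected: "x \<in> V \<Longrightarrow> y \<in> V \<Longrightarrow> (x, y) \<in> {(x, y). adj x y}\<^sup>*"
  using tree unfolding valued_tree_def adj_def vadj_def by blast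

definition "nb y = {x. adj x y}"

lemma nb: "finite (nb y)" "x \<in> nb y \<longleftrightarrow> adj x y"
proof -
  show "finite (nb y)"
  proof (cases "y \<in> V")
    case True
    then show ?thesis using fin_nb unfolding nb_def adj_def vadj_def by auto
  next
    case False
    then have "nb y = {}" using adj_V unfolding nb_def by blast
    then show ?thesis by simp
  qed
qed (simp add: nb_def)

lemma strict_nb: "y \<in> V \<Longrightarrow> (\<Sum>x\<in>nb y. w x y * d x) < 2 * d y"
  using strict unfolding nb_def adj_def vadj_def by simp

text \<open>Pairing \<open>c\<close> with the strictly subadditive \<open>d\<close> rules out every subgraph of extended Dynkin
  type; in the applications \<open>c\<close> is the corresponding null root.\<close>

lemma exclusion:
  assumes S: "finite S" "S \<subseteq> V" and pos: "x0 \<in> S" "c x0 > (0::nat)"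
    and c: "\<And>x. x \<in> S \<Longrightarrow> \<exists>N\<subseteq>S. 2 * c x \<le> (\<Sum>y\<in>N. w x y * c y)"
  shows False
proof -
  have c': "2 * c x \<le> (\<Sum>y\<in>S. w x y * c y)" if "x \<in> S" for x
  proof -
    obtain N where N: "N \<subseteq> S" "2 * c x \<le> (\<Sum>y\<in>N. w x y * c y)" using c[OF \<open>x \<in> S\<close>] by blast
    moreover have "(\<Sum>y\<in>N. w x y * c y) \<le> (\<Sum>y\<in>S. w x y * c y)" using N(1) S by (intro sum_mono2) auto
    ultimately show ?thesis by simp
  qed
  have s: "(\<Sum>x\<in>S. w x y * d x) < 2 * d y" if "y \<in> S" for y
  proof -
    have "(\<Sum>x\<in>S. w x y * d x) = (\<Sum>x\<in>S \<inter> nb y. w x y * d x)"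
      using S by (intro sum.mono_neutral_right) (auto simp: nb adj_def)
    also have "\<dots> \<le> (\<Sum>x\<in>nb y. w x y * d x)" using nb by (intro sum_mono2) auto
    also have "\<dots> < 2 * d y" using strict_nb that S by blast
    finally show ?thesis .
  qed
  have "(\<Sum>y\<in>S. c y * (\<Sum>x\<in>S. w x y * d x)) < (\<Sum>y\<in>S. c y * (2 * d y))"
  proof (rule sum_strict_mono_ex1)
    show "\<forall>y\<in>S. c y * (\<Sum>x\<in>S. w x y * d x) \<le> c y * (2 * d y)"
      using s by (meson less_imp_le_nat mult_le_mono2)
    show "\<exists>y\<in>S. c y * (\<Sum>x\<in>S. w x y * d x) < c y * (2 * d y)"
      using s[OF pos(1)] pos by (intro bexI[of _ x0]) auto
  qed (rule S)
  also have "(\<Sum>y\<in>S. c y * (2 * d y)) = (\<Sum>x\<in>S. d x * (2 * c x))"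
    by (intro sum.cong) auto
  also have "\<dots> \<le> (\<Sum>x\<in>S. d x * (\<Sum>y\<in>S. w x y * c y))"
    using c' by (intro sum_mono mult_le_mono2)
  also have "\<dots> = (\<Sum>x\<in>S. \<Sum>y\<in>S. d x * (w x y * c y))" by (simp add: sum_distrib_left)
  also have "\<dots> = (\<Sum>y\<in>S. \<Sum>x\<in>S. d x * (w x y * c y))" by (rule sum.swap)
  also have "\<dots> = (\<Sum>y\<in>S. c y * (\<Sum>x\<in>S. w x y * d x))"
    unfolding sum_distrib_left by (intro sum.cong) auto
  finally show False by simp
qed

text \<open>The form for explicit diagrams: vertices, coefficients and neighbours are lists
  addressed by position, so that the inequality at each vertex is a numeral computation.\<close>

lemma exclusion_list:
  assumes ys: "distinct ys" "set ys \<subseteq> V" and l: "length cs = length ys" "length nbs = length ys"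
    and pos: "k < length ys" "cs ! k > (0::nat)"
    and nbs: "\<And>i. i < length ys \<Longrightarrow> distinct (nbs ! i)"
      "\<And>i j. \<lbrakk>i < length ys; j \<in> set (nbs ! i)\<rbrakk> \<Longrightarrow> j < length ys"
      "\<And>i. i < length ys \<Longrightarrow> 2 * cs ! i \<le> (\<Sum>j\<leftarrow>nbs ! i. w (ys ! i) (ys ! j) * cs ! j)"
  shows False
proof -
  define pos_of where "pos_of = inv_into {..<length ys} ((!) ys)"
  have po: "pos_of (ys ! i) = i" if "i < length ys" for i
    unfolding pos_of_def using inj_on_nth[OF ys(1)] that by (intro inv_into_f_f) auto
  show False
  proof (rule exclusion[of "set ys" "ys ! k" "\<lambda>x. cs ! pos_of x"])
    fix x assume "x \<in> set ys"
    then obtain i where i: "i < length ys" "x = ys ! i" by (metis in_set_conv_nth)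
    let ?N = "(!) ys ` set (nbs ! i)"
    have inj: "inj_on ((!) ys) (set (nbs ! i))" using inj_on_nth[OF ys(1)] nbs(2)[OF i(1)] by blast
    have "(\<Sum>y\<in>?N. w x y * cs ! pos_of y) = (\<Sum>j\<in>set (nbs ! i). w x (ys ! j) * cs ! pos_of (ys ! j))"
      using inj by (simp add: sum.reindex)
    also have "\<dots> = (\<Sum>j\<in>set (nbs ! i). w x (ys ! j) * cs ! j)"
      using po nbs(2)[OF i(1)] by (intro sum.cong) auto
    also have "\<dots> = (\<Sum>j\<leftarrow>nbs ! i. w (ys ! i) (ys ! j) * cs ! j)"
      using nbs(1)[OF i(1)] i(2) by (simp add: sum_list_distinct_conv_sum_set)
    finally have "2 * cs ! pos_of x \<le> (\<Sum>y\<in>?N. w x y * cs ! pos_of y)"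
      using nbs(3)[OF i(1)] i po by simp
    moreover have "?N \<subseteq> set ys" using nbs(2)[OF i(1)] by auto
    ultimately show "\<exists>N\<subseteq>set ys. 2 * cs ! pos_of x \<le> (\<Sum>y\<in>N. w x y * cs ! pos_of y)" by blast
  qed (use ys pos po in auto)
qed

text \<open>The product of the two valuations makes a double bond count as two simple edges and a
  triple bond as three. This treats valued and simply laced configurations uniformly.\<close>

definition "wt q L = (\<Sum>e\<in>L. w q e * w e q)"

text \<open>The null root is 2 at q and w e q at a leaf e: the condition at a leaf is an equality,
  the one at q says that the weight is at least 4. Weight exactly 4 comprises extended D4 with its
  folded forms, for instance extended G2, and the rank two diagrams with valuation (2,2) or
  (1,4).\<close>

lemma wt_vertex:
  assumes L: "L \<subseteq> nb q" "4 \<le> wt q L"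
  shows False
proof (rule exclusion[of "insert q L" q "\<lambda>x. if x = q then 2 else w x q"])
  have fL: "finite L" using L nb finite_subset by blast
  then show "finite (insert q L)" by simp
  have "L \<noteq> {}" using L(2) by (auto simp: wt_def)
  then show "insert q L \<subseteq> V" using L(1) adj_V by (auto simp: nb)
  have qL: "q \<notin> L" using L(1) adj_irrefl nb(2) by blast
  fix x assume "x \<in> insert q L"
  then consider "x = q" | "x \<in> L" "x \<noteq> q" using qL by auto
  then show "\<exists>N\<subseteq>insert q L. 2 * (if x = q then 2 else w x q) \<le> (\<Sum>y\<in>N. w x y * (if y = q then 2 else w y q))"
  proof cases
    case 1
    have "(\<Sum>y\<in>L. w q y * (if y = q then 2 else w y q)) = wt q L"
      unfolding wt_def using qL by (intro sum.cong) auto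
    then show ?thesis using L(2) 1 by (intro exI[of _ L]) auto
  next
    case 2
    then show ?thesis by (intro exI[of _ "{q}"]) auto
  qed
qed auto

definition "path xs \<longleftrightarrow> xs \<noteq> [] \<and> distinct xs \<and> set xs \<subseteq> V \<and> (\<forall>i. Suc i < length xs \<longrightarrow> adj (xs ! i) (xs ! Suc i))"

lemma pathD: "path xs \<Longrightarrow> xs \<noteq> []" "path xs \<Longrightarrow> distinct xs" "path xs \<Longrightarrow> set xs \<subseteq> V"
  "\<lbrakk>path xs; Suc i < length xs\<rbrakk> \<Longrightarrow> adj (xs ! i) (xs ! Suc i)"
  by (auto simp: path_def)

lemma path_rev: "path xs \<Longrightarrow> path (rev xs)"
proof -
  assume p: "path xs"
  have "adj (rev xs ! i) (rev xs ! Suc i)" if i: "Suc i < length xs" for i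
  proof -
    have "length xs - Suc i = Suc (length xs - Suc (Suc i))" using i by simp
    then show ?thesis
      using pathD(4)[OF p, of "length xs - Suc (Suc i)"] i adj_sym by (simp add: rev_nth)
  qed
  then show ?thesis using p by (simp add: path_def)
qed

lemma path_Cons: "\<lbrakk>path xs; x \<notin> set xs; adj x (xs ! 0)\<rbrakk> \<Longrightarrow> path (x # xs)"
  unfolding path_def using adj_V(1) by (auto simp: nth_Cons split: nat.splits)

lemma path_seg:
  assumes p: "path xs" and ij: "i \<le> j" "j < length xs"
  shows "path (map ((!) xs) [i..<Suc j])"
proof -
  have "inj_on ((!) xs) {i..<Suc j}" using inj_on_nth[OF pathD(2)[OF p]] ij by auto
  then have "distinct (map ((!) xs) [i..<Suc j])" by (simp add: distinct_map del: upt_Suc)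
  moreover have "set (map ((!) xs) [i..<Suc j]) \<subseteq> V" using pathD(3)[OF p] ij by auto
  ultimately show ?thesis using pathD(4)[OF p] ij unfolding path_def by (auto simp del: upt_Suc)
qed

lemma chord:
  assumes p: "path xs" and ij: "i < j" "j < length xs" and a: "adj (xs ! i) (xs ! j)"
  shows "j = Suc i"
proof (rule ccontr)
  assume "j \<noteq> Suc i"
  then have l: "Suc (Suc i) \<le> j" using ij by simp
  let ?c = "map ((!) xs) [i..<Suc j]"
  have c: "path ?c" using path_seg[OF p _ ij(2)] ij by simp
  have "last ?c = xs ! j" and "hd ?c = xs ! i" using ij by (simp_all add: last_map hd_map del: upt_Suc)
  have "3 \<le> length ?c" using l by (simp del: upt_Suc)
  from no_cycle[OF this pathD(2)[OF c] pathD(4)[OF c]] show False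
    using adj_sym[OF a] \<open>last ?c = xs ! j\<close> \<open>hd ?c = xs ! i\<close> by simp
qed

lemma outside:
  assumes p: "path xs" and ij: "i < length xs" "j < length xs" and x: "x \<notin> set xs"
    and a: "adj x (xs ! i)" "adj x (xs ! j)"
  shows "i = j"
proof -
  have main: False if ij: "i < j" "j < length xs" and a: "adj x (xs ! i)" "adj x (xs ! j)" for i j
  proof -
    let ?c = "map ((!) xs) [i..<Suc j]"
    have c: "path ?c" using path_seg[OF p _ ij(2)] ij by simp
    have l: "last ?c = xs ! j" "?c ! 0 = xs ! i" using ij by (simp_all add: last_map del: upt_Suc)
    have xc: "x \<notin> set ?c" using x ij by auto
    then have c': "path (x # ?c)" using path_Cons[OF c xc] a(1) l(2) by simp
    have "3 \<le> length (x # ?c)" using ij by (simp del: upt_Suc)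
    from no_cycle[OF this pathD(2)[OF c'] pathD(4)[OF c']] show False
      using adj_sym[OF a(2)] l(1) pathD(1)[OF c] by (simp del: upt_Suc)
  qed
  show ?thesis using main[of i j] main[of j i] ij a by (cases i j rule: linorder_cases) auto
qed

lemma path_adj_iff:
  assumes p: "path xs" and ij: "i < length xs" "j < length xs"
  shows "adj (xs ! i) (xs ! j) \<longleftrightarrow> j = Suc i \<or> i = Suc j"
  using chord[OF p, of i j] chord[OF p, of j i] ij adj_irrefl adj_sym pathD(4)[OF p]
  by (cases i j rule: linorder_cases) blast+

text \<open>The null root is 2 along the path and w e q at an extra vertex e attached to an end q.
  Weight 2 at an end is a fork or a double bond, so the extended diagrams of types B, C and D and
  their mixtures are excluded together.\<close>

lemma wt_path:
  assumes p: "path xs" and l: "2 \<le> length xs"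
    and L: "L \<subseteq> nb (xs ! 0)" "2 \<le> wt (xs ! 0) L" "L \<inter> set xs = {}"
    and M: "M \<subseteq> nb (last xs)" "2 \<le> wt (last xs) M" "M \<inter> set xs = {}"
    and LM: "L \<inter> M = {}"
  shows False
proof -
  let ?q = "xs ! 0" and ?r = "last xs"
  let ?S = "set xs \<union> L \<union> M"
  define c where "c x = (if x \<in> set xs then 2 else if x \<in> L then w x ?q else w x ?r)" for x
  have f: "finite L" "finite M" using L M nb finite_subset by blast+
  have xs: "xs \<noteq> []" "distinct xs" using pathD[OF p] by auto
  have cx: "c (xs ! i) = 2" if "i < length xs" for i using that by (simp add: c_def)
  have lst: "?r = xs ! (length xs - 1)" using xs by (simp add: last_conv_nth)
  show False
  proof (rule exclusion[of ?S ?q c])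
    show "finite ?S" using f by simp
    show "?S \<subseteq> V" using pathD(3)[OF p] L(1) M(1) adj_V(1) by (auto simp: nb)
    show "?q \<in> ?S" using xs by simp
    show "0 < c ?q" using xs cx[of 0] by simp
    fix x assume "x \<in> ?S"
    then consider "x \<in> set xs" | "x \<in> L" "x \<notin> set xs" | "x \<in> M" "x \<notin> set xs" "x \<notin> L" by blast
    then show "\<exists>N\<subseteq>?S. 2 * c x \<le> (\<Sum>y\<in>N. w x y * c y)"
    proof cases
      case 1
      then obtain i where i: "i < length xs" "x = xs ! i" by (metis in_set_conv_nth)
      have nx: "2 \<le> w (xs ! i) (xs ! Suc i) * c (xs ! Suc i)" if "Suc i < length xs"
        using adj_pos(1)[OF pathD(4)[OF p that]] cx[OF that] by simp
      have pv: "2 \<le> w (xs ! i) (xs ! (i - 1)) * c (xs ! (i - 1))" if "0 < i"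
        using adj_pos(2)[OF pathD(4)[OF p, of "i - 1"]] cx[of "i - 1"] that i by simp
      have Lc: "(\<Sum>y\<in>L. w ?q y * c y) = wt ?q L"
        unfolding wt_def c_def using L(3) by (intro sum.cong) auto
      have Mc: "(\<Sum>y\<in>M. w ?r y * c y) = wt ?r M"
        unfolding wt_def c_def using M(3) LM by (intro sum.cong) auto
      consider "i = 0" | "0 < i" "Suc i < length xs" | "0 < i" "i = length xs - 1" using i by linarith
      then show ?thesis
      proof cases
        case 1
        then have s: "Suc i < length xs" "xs ! Suc i \<notin> L" using l L(3) nth_mem by auto
        have "4 \<le> (\<Sum>y\<in>insert (xs ! Suc i) L. w x y * c y)"
          using nx[OF s(1)] Lc L(2) 1 i(2) s(2) f(1) by simp
        then show ?thesis using cx i s(1) by (intro exI[of _ "insert (xs ! Suc i) L"]) auto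
      next
        case 2
        have "xs ! Suc i \<noteq> xs ! (i - 1)" using xs(2) 2 by (simp add: nth_eq_iff_index_eq)
        then have "4 \<le> (\<Sum>y\<in>{xs ! Suc i, xs ! (i - 1)}. w x y * c y)"
          using nx pv 2 i(2) by simp
        then show ?thesis using cx i 2 by (intro exI[of _ "{xs ! Suc i, xs ! (i - 1)}"]) auto
      next
        case 3
        then have s: "xs ! (i - 1) \<notin> M" using M(3) i nth_mem[of "i - 1" xs] by auto
        have "4 \<le> (\<Sum>y\<in>insert (xs ! (i - 1)) M. w x y * c y)"
          using pv[OF 3(1)] Mc M(2) 3 i(2) s f(2) lst by simp
        then show ?thesis using cx i 3 by (intro exI[of _ "insert (xs ! (i - 1)) M"]) auto
      qed
    next
      case 2
      then show ?thesis using cx[of 0] xs by (intro exI[of _ "{?q}"]) (auto simp: c_def)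
    next
      case 3
      then show ?thesis using cx[of "length xs - 1"] xs lst by (intro exI[of _ "{?r}"]) (auto simp: c_def)
    qed
  qed
qed

text \<open>Keeping only the two neighbours on the path and replacing their valuations by 1 weakens
  the strict inequality to strict concavity of d along the path.\<close>

lemma path_length_bound: "path xs \<Longrightarrow> length xs \<le> 2 * B + 3"
proof -
  assume p: "path xs"
  have "int (length xs) \<le> 2 * int B + 3"
  proof (rule concave_bounded)
    fix i assume i: "Suc (Suc i) < length xs"
    let ?x = "xs ! i" and ?y = "xs ! Suc i" and ?z = "xs ! Suc (Suc i)"
    have a: "adj ?x ?y" "adj ?z ?y" using pathD(4)[OF p] i adj_sym by auto
    have ne: "?x \<noteq> ?z" using pathD(2)[OF p] i by (simp add: nth_eq_iff_index_eq)
    have "1 * d ?x + 1 * d ?z \<le> w ?x ?y * d ?x + w ?z ?y * d ?z"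
      using adj_pos(1)[OF a(1)] adj_pos(1)[OF a(2)] by (intro add_mono mult_le_mono1)
    also have "\<dots> = (\<Sum>x\<in>{?x, ?z}. w x ?y * d x)" using ne by simp
    also have "\<dots> \<le> (\<Sum>x\<in>nb ?y. w x ?y * d x)" using nb a by (intro sum_mono2) auto
    also have "\<dots> < 2 * d ?y" using strict_nb adj_V(2)[OF a(1)] .
    finally show "int (d ?x) + int (d ?z) < 2 * int (d ?y)" by simp
  next
    fix i assume "i < length xs"
    then show "0 \<le> int (d (xs ! i)) \<and> int (d (xs ! i)) \<le> int B"
      using bounded[of "xs ! i"] pathD(3)[OF p] nth_mem by fastforce
  qed simp
  then show ?thesis by simp
qed

text \<open>The backbone of the classification: its end vertices have no neighbours off it, and its
  maximality limits the arms that branch off.\<close>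

definition "longest p \<longleftrightarrow> path p \<and> (\<forall>q. path q \<longrightarrow> length q \<le> length p)"

lemma longest_ex: "\<exists>p. longest p"
proof -
  obtain x where "x \<in> V" using tree unfolding valued_tree_def by blast
  then have "path [x]" by (simp add: path_def)
  moreover have "\<forall>q. path q \<longrightarrow> length q < 2 * B + 4" using path_length_bound by fastforce
  ultimately have "\<exists>p. path p \<and> (\<forall>q. path q \<longrightarrow> length q \<le> length p)"
    by (rule ex_has_greatest_nat[where P = path and f = length])
  then show ?thesis unfolding longest_def .
qed

lemma longest_rev: "longest p \<Longrightarrow> longest (rev p)"
  using path_rev by (simp add: longest_def)

lemma longest_nb_0: "\<lbrakk>longest p; adj x (p ! 0)\<rbrakk> \<Longrightarrow> x \<in> set p"
  using path_Cons[of p x] unfolding longest_def by fastforce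

lemma longest_nb_last: "\<lbrakk>longest p; adj x (p ! (length p - 1))\<rbrakk> \<Longrightarrow> x \<in> set p"
  using longest_nb_0[OF longest_rev, of p x] pathD(1)[of p] by (simp add: rev_nth longest_def)

lemma closed_covers:
  assumes "S \<noteq> {}" "S \<subseteq> V" "\<And>x y. \<lbrakk>x \<in> S; adj y x\<rbrakk> \<Longrightarrow> y \<in> S"
  shows "S = V"
proof -
  obtain x where x: "x \<in> S" using assms by blast
  have "y \<in> S" if "(x, y) \<in> {(x, y). adj x y}\<^sup>*" for y
    using that x assms(3) adj_sym by (induct rule: rtrancl_induct) auto
  then show ?thesis using connected x assms(2) by blast
qed

subsection \<open>Branching trees\<close>

text \<open>The vertices x and p ! (i - 1) already give weight 2 at p ! i. A second weight 2 at p !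
  j, from a neighbour off p together with p ! Suc j or from a multiple edge to p ! Suc j, is
  forbidden by \<open>wt_path\<close> on the segment in between. At the end of p it is maximality
  that rules out further neighbours.\<close>

lemma branch_right:
  assumes p: "longest p" and i: "0 < i" "i < j" "j < length p" and x: "x \<notin> set p" "adj x (p ! i)"
  shows "y \<in> nb (p ! j) \<Longrightarrow> y \<in> set p" "Suc j < length p \<Longrightarrow> w (p ! j) (p ! Suc j) * w (p ! Suc j) (p ! j) = 1"
proof -
  have pp: "path p" using p by (simp add: longest_def)
  have prod: "1 \<le> w y e * w e y" if "adj e y" for e y
    using mult_le_mono[OF adj_pos(2)[OF that] adj_pos(1)[OF that]] by simp
  have no: False if L: "M \<subseteq> nb (p ! j)" "p ! (j - 1) \<notin> M" "2 \<le> wt (p ! j) M" for M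
  proof -
    let ?q = "map ((!) p) [i..<Suc j]"
    have q: "path ?q" using path_seg[OF pp _ i(3)] i by simp
    have l: "last ?q = p ! j" "?q ! 0 = p ! i" "2 \<le> length ?q"
      using i by (simp_all add: last_map del: upt_Suc)
    have sq: "set ?q = (!) p ` {i..j}" by auto
    have x1: "x \<noteq> p ! (i - 1)" using x(1) i nth_mem[of "i - 1" p] by auto
    have a1: "adj (p ! (i - 1)) (p ! i)" using pathD(4)[OF pp, of "i - 1"] i by simp
    have wt: "2 \<le> wt (p ! i) {x, p ! (i - 1)}"
      using add_mono[OF prod[OF x(2)] prod[OF a1]] x1 by (simp add: wt_def)
    have "p ! (i - 1) \<noteq> p ! k" if "k \<in> {i..j}" for k
      using pathD(2)[OF pp] i that by (subst nth_eq_iff_index_eq) auto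
    moreover have "p ! k \<noteq> x" if "k \<in> {i..j}" for k using that x(1) i nth_mem[of k p] by auto
    ultimately have d1: "{x, p ! (i - 1)} \<inter> set ?q = {}" unfolding sq by blast
    have k1: "k = j - 1" if "k < j" "p ! k \<in> M" for k
      using chord[OF pp that(1) i(3)] L(1) that nb(2) by auto
    have "p ! j \<notin> M" using L(1) nb(2) adj_irrefl by blast
    then have "p ! k \<notin> M" if "k \<in> {i..j}" for k using L(2) k1[of k] that by (cases "k = j") auto
    then have d2: "M \<inter> set ?q = {}" unfolding sq by blast
    have "x \<notin> M" using outside[OF pp _ i(3) x(1) x(2)] L(1) nb(2) i by auto
    moreover have "p ! (i - 1) \<notin> M"
    proof
      assume "p ! (i - 1) \<in> M"
      then have "i - 1 = j - 1" using k1[of "i - 1"] i by simp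
      then show False using i by simp
    qed
    ultimately have d3: "{x, p ! (i - 1)} \<inter> M = {}" by blast
    show False
      using wt_path[OF q l(3), of "{x, p ! (i - 1)}" M] wt d1 d2 d3 L x(2) a1 l by (simp add: nb(2) del: upt_Suc)
  qed
  have next_adj: "adj (p ! Suc j) (p ! j)" if "Suc j < length p" using pathD(4)[OF pp that] adj_sym by blast
  have ne: "p ! (j - 1) \<noteq> p ! Suc j" if "Suc j < length p"
    using pathD(2)[OF pp] i that by (simp add: nth_eq_iff_index_eq)
  show "w (p ! j) (p ! Suc j) * w (p ! Suc j) (p ! j) = 1" if "Suc j < length p"
  proof (rule ccontr)
    assume "w (p ! j) (p ! Suc j) * w (p ! Suc j) (p ! j) \<noteq> 1"
    then have "2 \<le> w (p ! j) (p ! Suc j) * w (p ! Suc j) (p ! j)" using prod[OF next_adj[OF that]] by linarith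
    then have "2 \<le> wt (p ! j) {p ! Suc j}" by (simp add: wt_def)
    then show False using no[of "{p ! Suc j}"] next_adj[OF that] ne[OF that] by (simp add: nb(2))
  qed
  show "y \<in> set p" if y: "y \<in> nb (p ! j)"
  proof (rule ccontr)
    assume yp: "y \<notin> set p"
    have ya: "adj y (p ! j)" using y nb(2) by blast
    have s: "Suc j < length p"
    proof (rule ccontr)
      assume "\<not> Suc j < length p"
      then have "j = length p - 1" using i by simp
      then show False using longest_nb_last[OF p] ya yp by simp
    qed
    have "y \<noteq> p ! Suc j" "y \<noteq> p ! (j - 1)" using yp s i nth_mem by auto
    moreover have "2 \<le> wt (p ! j) {y, p ! Suc j}"
      using add_mono[OF prod[OF ya] prod[OF next_adj[OF s]]] calculation by (simp add: wt_def)
    ultimately show False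
      using no[of "{y, p ! Suc j}"] ya next_adj[OF s] ne[OF s]
      by (simp add: nb(2))
  qed
qed

lemma branch_left:
  assumes p: "longest p" and i: "j < i" "i < length p - 1" and x: "x \<notin> set p" "adj x (p ! i)"
  shows "y \<in> nb (p ! j) \<Longrightarrow> y \<in> set p" "0 < j \<Longrightarrow> w (p ! j) (p ! (j - 1)) * w (p ! (j - 1)) (p ! j) = 1"
proof -
  have r: "rev p ! (length p - Suc k) = p ! k" if "k < length p" for k using that by (simp add: rev_nth)
  have x': "x \<notin> set (rev p)" "adj x (rev p ! (length p - Suc i))" using x r[of i] i by auto
  note * = branch_right[OF longest_rev[OF p], of "length p - Suc i" "length p - Suc j", OF _ _ _ x']
  show "y \<in> nb (p ! j) \<Longrightarrow> y \<in> set p" using *(1) r[of j] i by simp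
  assume j: "0 < j"
  have "Suc (length p - Suc j) = length p - Suc (j - 1)" using i j by simp
  then show "w (p ! j) (p ! (j - 1)) * w (p ! (j - 1)) (p ! j) = 1"
    using *(2) r[of j] r[of "j - 1"] i j by simp
qed

end

text \<open>An isomorphism is given by listing the vertices; the shift by \<open>Suc\<close> is due
  to the Dynkin diagrams being numbered from 1.\<close>

lemma valued_graph_isoI:
  assumes ys: "distinct ys" "set ys = vverts T" and D: "vverts D = {1..length ys}"
    and e: "\<And>i j. \<lbrakk>i < length ys; j < length ys\<rbrakk> \<Longrightarrow> vd D (Suc i) (Suc j) = vd T (ys ! i) (ys ! j)"
  shows "valued_graph_iso T D"
proof -
  define pos where "pos = inv_into {..<length ys} ((!) ys)"
  have inj: "inj_on ((!) ys) {..<length ys}" using inj_on_nth[OF ys(1)] by blast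
  have pos: "pos (ys ! i) = i" if "i < length ys" for i
    unfolding pos_def using inj that by (intro inv_into_f_f) auto
  have im: "(!) ys ` {..<length ys} = vverts T" using ys(2) by (auto simp: set_conv_nth)
  have "bij_betw pos (vverts T) {..<length ys}"
    unfolding pos_def using inj im by (intro bij_betw_inv_into) (simp add: bij_betw_def)
  moreover have "bij_betw Suc {..<length ys} {1..length ys}"
    by (simp add: bij_betw_def image_Suc_lessThan)
  ultimately have "bij_betw (Suc \<circ> pos) (vverts T) (vverts D)" unfolding D by (rule bij_betw_trans)
  moreover have "vd D ((Suc \<circ> pos) x) ((Suc \<circ> pos) y) = vd T x y" if xy: "x \<in> vverts T" "y \<in> vverts T" for x y
  proof -
    obtain i j where "i < length ys" "x = ys ! i" "j < length ys" "y = ys ! j"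
      using xy ys(2) by (metis in_set_conv_nth)
    then show ?thesis using e pos by simp
  qed
  ultimately show ?thesis unfolding valued_graph_iso_def by blast
qed

context subadditive_tree
begin

lemma not_adj: "\<not> adj x y \<Longrightarrow> w x y = 0" by (simp add: adj_def)

lemma prod_pos: "adj e y \<Longrightarrow> 1 \<le> w y e * w e y"
  using mult_le_mono[OF adj_pos(2) adj_pos(1), of e y e y] by simp

lemma wt_insert: "\<lbrakk>finite L; e \<notin> L\<rbrakk> \<Longrightarrow> wt q (insert e L) = w q e * w e q + wt q L"
  by (simp add: wt_def)

lemma path_nth_eq: "\<lbrakk>path p; i < length p; j < length p\<rbrakk> \<Longrightarrow> p ! i = p ! j \<longleftrightarrow> i = j"
  using pathD(2) by (simp add: nth_eq_iff_index_eq)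

lemma rev_nth': "k < length p \<Longrightarrow> rev p ! (length p - Suc k) = p ! k"
  by (simp add: rev_nth)

text \<open>Three neighbours contribute at least 3 to the weight, which must stay below 4 by
  \<open>wt_vertex\<close>; so there is no fourth one and all three edges are simple.\<close>

lemma branch_center:
  assumes p: "path p" and i: "0 < i" "Suc i < length p" and x: "x \<notin> set p" "adj x (p ! i)"
  shows "adj y (p ! i) \<Longrightarrow> y = x \<or> y = p ! (i - 1) \<or> y = p ! Suc i"
    "\<And>e. e \<in> {x, p ! (i - 1), p ! Suc i} \<Longrightarrow> w (p ! i) e = 1 \<and> w e (p ! i) = 1"
proof -
  let ?a = "p ! (i - 1)" and ?b = "p ! Suc i" and ?c = "p ! i"
  have ab: "adj ?a ?c" "adj ?b ?c" using pathD(4)[OF p, of "i - 1"] pathD(4)[OF p i(2)] i adj_sym by auto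
  have ne: "x \<noteq> ?a" "x \<noteq> ?b" "?a \<noteq> ?b"
    using x(1) i nth_mem[of "i - 1" p] nth_mem[of "Suc i" p] path_nth_eq[OF p, of "i - 1" "Suc i"] by auto
  have wt3: "wt ?c {x, ?a, ?b} = w ?c x * w x ?c + w ?c ?a * w ?a ?c + w ?c ?b * w ?b ?c"
    using ne by (simp add: wt_def)
  note P = prod_pos[OF x(2)] prod_pos[OF ab(1)] prod_pos[OF ab(2)]
  show "y = x \<or> y = ?a \<or> y = ?b" if y: "adj y ?c"
  proof (rule ccontr)
    assume "\<not> ?thesis"
    then have "wt ?c (insert y {x, ?a, ?b}) = w ?c y * w y ?c + wt ?c {x, ?a, ?b}" by (intro wt_insert) auto
    then have "4 \<le> wt ?c (insert y {x, ?a, ?b})"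
      using add_mono[OF add_mono[OF P(1,2)] add_mono[OF P(3) prod_pos[OF y]]] wt3 by simp
    then show False using wt_vertex[of "insert y {x, ?a, ?b}" ?c] y x(2) ab by (simp add: nb(2))
  qed
  have "wt ?c {x, ?a, ?b} < 4" using wt_vertex[of "{x, ?a, ?b}" ?c] x(2) ab by (force simp: nb(2))
  then have "w ?c x * w x ?c = 1" "w ?c ?a * w ?a ?c = 1" "w ?c ?b * w ?b ?c = 1"
    using P unfolding wt3 by linarith+
  then show "w ?c e = 1 \<and> w e ?c = 1" if "e \<in> {x, ?a, ?b}" for e using that by auto
qed

text \<open>Entering p at p ! i through y and x gives a path with 2 more vertices in place of the
  first i vertices of p, so maximality of p forces i to be at least 2.\<close>

lemma branch_second:
  assumes p: "longest p" and i: "i < length p" and x: "x \<notin> set p" "adj x (p ! i)"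
    and y: "adj y x" "y \<notin> set p"
  shows "2 \<le> i"
proof -
  have pp: "path p" using p by (simp add: longest_def)
  let ?q = "map ((!) p) [i..<Suc (length p - 1)]"
  have q: "path ?q" using path_seg[OF pp, of i "length p - 1"] i by (simp del: upt_Suc)
  have q0: "?q ! 0 = p ! i" "set ?q \<subseteq> set p" using i by (auto simp del: upt_Suc)
  then have "x \<notin> set ?q" "adj x (?q ! 0)" using x by (auto simp del: upt_Suc)
  then have "path (x # ?q)" by (rule path_Cons[OF q])
  moreover have "y \<notin> set (x # ?q)" using y q0(2) adj_irrefl by auto
  ultimately have "path (y # x # ?q)" using path_Cons[of "x # ?q" y] y(1) by (simp del: upt_Suc)
  then have "length (y # x # ?q) \<le> length p" using p unfolding longest_def by blast
  then show ?thesis using i by (simp del: upt_Suc)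
qed

lemma index_cases: "i < 7 \<Longrightarrow> i = 0 \<or> i = 1 \<or> i = 2 \<or> i = 3 \<or> i = 4 \<or> i = 5 \<or> i = (6::nat)"
  "i < 8 \<Longrightarrow> i = 0 \<or> i = 1 \<or> i = 2 \<or> i = 3 \<or> i = 4 \<or> i = 5 \<or> i = 6 \<or> i = (7::nat)"
  "i < 9 \<Longrightarrow> i = 0 \<or> i = 1 \<or> i = 2 \<or> i = 3 \<or> i = 4 \<or> i = 5 \<or> i = 6 \<or> i = 7 \<or> i = (8::nat)"
  "i < 5 \<Longrightarrow> i = 0 \<or> i = 1 \<or> i = 2 \<or> i = 3 \<or> i = (4::nat)"
  by arith+

text \<open>The excluded configuration is the extended diagram of E6, three arms of length 2 at c,
  with its null root; likewise for the next three lemmas.\<close>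

lemma no_E6:
  assumes "distinct [c, x, y, a, a', b, b']"
    and a: "adj c x" "adj x y" "adj c a" "adj a a'" "adj c b" "adj b b'"
  shows False
proof (rule exclusion_list[of "[c, x, y, a, a', b, b']" "[3, 2, 1, 2, 1, 2, 1]"
      "[[1, 3, 5], [0, 2], [1], [0, 4], [3], [0, 6], [5]]" 0])
  fix i assume "i < length [c, x, y, a, a', b, b']"
  then have i: "i < 7" by simp
  show "distinct ([[1, 3, 5], [0, 2], [1], [0, 4], [3], [0, 6], [5::nat]] ! i)"
    using index_cases(1)[OF i] by (elim disjE) simp_all
  show "j < length [c, x, y, a, a', b, b']" if "j \<in> set ([[1, 3, 5], [0, 2], [1], [0, 4], [3], [0, 6], [5]] ! i)" for j
    using index_cases(1)[OF i] that by (elim disjE) auto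
  show "2 * [3, 2, 1, 2, 1, 2, 1] ! i \<le> (\<Sum>j\<leftarrow>[[1, 3, 5], [0, 2], [1], [0, 4], [3], [0, 6], [5]] ! i.
      w ([c, x, y, a, a', b, b'] ! i) ([c, x, y, a, a', b, b'] ! j) * [3, 2, 1, 2, 1, 2, 1] ! j)"
    using index_cases(1)[OF i] a[THEN adj_pos(1)] a[THEN adj_pos(2)] by (elim disjE) simp_all
qed (use assms(1) a[THEN adj_V(1)] a[THEN adj_V(2)] in auto)

text \<open>Arms of lengths 1, 3 and 3 at c, with the null root of extended E7.\<close>

lemma no_E7:
  assumes "distinct [c, x, a, a', a'', b, b', b'']"
    and a: "adj c x" "adj c a" "adj a a'" "adj a' a''" "adj c b" "adj b b'" "adj b' b''"
  shows False
proof (rule exclusion_list[of "[c, x, a, a', a'', b, b', b'']" "[4, 2, 3, 2, 1, 3, 2, 1]"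
      "[[1, 2, 5], [0], [0, 3], [2, 4], [3], [0, 6], [5, 7], [6]]" 0])
  fix i assume "i < length [c, x, a, a', a'', b, b', b'']"
  then have i: "i < 8" by simp
  show "distinct ([[1, 2, 5], [0], [0, 3], [2, 4], [3], [0, 6], [5, 7], [6::nat]] ! i)"
    using index_cases(2)[OF i] by (elim disjE) simp_all
  show "j < length [c, x, a, a', a'', b, b', b'']" if "j \<in> set ([[1, 2, 5], [0], [0, 3], [2, 4], [3], [0, 6], [5, 7], [6]] ! i)" for j
    using index_cases(2)[OF i] that by (elim disjE) auto
  show "2 * [4, 2, 3, 2, 1, 3, 2, 1] ! i \<le> (\<Sum>j\<leftarrow>[[1, 2, 5], [0], [0, 3], [2, 4], [3], [0, 6], [5, 7], [6]] ! i.
      w ([c, x, a, a', a'', b, b', b''] ! i) ([c, x, a, a', a'', b, b', b''] ! j) * [4, 2, 3, 2, 1, 3, 2, 1] ! j)"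
    using index_cases(2)[OF i] a[THEN adj_pos(1)] a[THEN adj_pos(2)] by (elim disjE) simp_all
qed (use assms(1) a[THEN adj_V(1)] a[THEN adj_V(2)] in auto)

text \<open>Arms of lengths 1, 2 and 5 at c, with the null root of extended E8.\<close>

lemma no_E8:
  assumes "distinct [c, x, a, a', b1, b2, b3, b4, b5]"
    and a: "adj c x" "adj c a" "adj a a'" "adj c b1" "adj b1 b2" "adj b2 b3" "adj b3 b4" "adj b4 b5"
  shows False
proof (rule exclusion_list[of "[c, x, a, a', b1, b2, b3, b4, b5]" "[6, 3, 4, 2, 5, 4, 3, 2, 1]"
      "[[1, 2, 4], [0], [0, 3], [2], [0, 5], [4, 6], [5, 7], [6, 8], [7]]" 0])
  fix i assume "i < length [c, x, a, a', b1, b2, b3, b4, b5]"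
  then have i: "i < 9" by simp
  show "distinct ([[1, 2, 4], [0], [0, 3], [2], [0, 5], [4, 6], [5, 7], [6, 8], [7::nat]] ! i)"
    using index_cases(3)[OF i] by (elim disjE) simp_all
  show "j < length [c, x, a, a', b1, b2, b3, b4, b5]" if "j \<in> set ([[1, 2, 4], [0], [0, 3], [2], [0, 5], [4, 6], [5, 7], [6, 8], [7]] ! i)" for j
    using index_cases(3)[OF i] that by (elim disjE) auto
  show "2 * [6, 3, 4, 2, 5, 4, 3, 2, 1] ! i \<le> (\<Sum>j\<leftarrow>[[1, 2, 4], [0], [0, 3], [2], [0, 5], [4, 6], [5, 7], [6, 8], [7]] ! i.
      w ([c, x, a, a', b1, b2, b3, b4, b5] ! i) ([c, x, a, a', b1, b2, b3, b4, b5] ! j) * [6, 3, 4, 2, 5, 4, 3, 2, 1] ! j)"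
    using index_cases(3)[OF i] a[THEN adj_pos(1)] a[THEN adj_pos(2)] by (elim disjE) simp_all
qed (use assms(1) a[THEN adj_V(1)] a[THEN adj_V(2)] in auto)

lemma no_F4:
  assumes "distinct [y0, y1, y2, y3, y4]" and a: "adj y0 y1" "adj y1 y2" "adj y3 y4"
    and dbl: "(w y2 y3, w y3 y2) = (1, 2) \<or> (w y2 y3, w y3 y2) = (2, 1)"
  shows False
proof -
  \<comment> \<open>This treats both orientations of the double bond: the coefficients are 1, 2, 3,
    4, 2 for k = 2 and 1, 2, 3, 2, 1 for k = 1.\<close>
  define k where "k = w y3 y2"
  have k: "k > 0" "w y2 y3 * k = 2" using dbl by (auto simp: k_def)
  have b: "adj y2 y3" using dbl by (auto simp: adj_def)
  show False
  proof (rule exclusion_list[of "[y0, y1, y2, y3, y4]" "[1, 2, 3, 2 * k, k]"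
      "[[1], [0, 2], [1, 3], [2, 4], [3]]" 0])
    fix i assume "i < length [y0, y1, y2, y3, y4]"
    then have i: "i < 5" by simp
    show "distinct ([[1], [0, 2], [1, 3], [2, 4], [3::nat]] ! i)"
      using index_cases(4)[OF i] by (elim disjE) simp_all
    show "j < length [y0, y1, y2, y3, y4]" if "j \<in> set ([[1], [0, 2], [1, 3], [2, 4], [3]] ! i)" for j
      using index_cases(4)[OF i] that by (elim disjE) auto
    show "2 * [1, 2, 3, 2 * k, k] ! i \<le> (\<Sum>j\<leftarrow>[[1], [0, 2], [1, 3], [2, 4], [3]] ! i.
      w ([y0, y1, y2, y3, y4] ! i) ([y0, y1, y2, y3, y4] ! j) * [1, 2, 3, 2 * k, k] ! j)"
      using index_cases(4)[OF i]
    proof (elim disjE)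
      assume i: "i = 2"
      have "w y2 y3 * (2 * k) = 4" using k(2) by (simp add: mult.left_commute)
      then have "6 \<le> w y2 y1 * 2 + w y2 y3 * (2 * k)" using adj_pos(2)[OF a(2)] by linarith
      then show ?thesis unfolding i by simp
    next
      assume i: "i = 3"
      have "k \<le> w y3 y4 * k" using adj_pos(1)[OF a(3)] by simp
      then show ?thesis using i by (simp add: k_def)
    next
      assume i: "i = 4"
      have "2 * k \<le> w y4 y3 * (2 * k)" using adj_pos(2)[OF a(3)] by simp
      then show ?thesis using i by simp
    qed (use a[THEN adj_pos(1)] a[THEN adj_pos(2)] in simp_all)
  qed (use assms(1) a[THEN adj_V(1)] a[THEN adj_V(2)] b[THEN adj_V(1)] in auto)
qed

text \<open>The exclusions at p ! i and on both sides of it leave only simple edges and no second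
  branching. If x had a further neighbour y, maximality of p would make both arms of p at p ! i at
  least 2 long, and with x and y they would form extended E6.\<close>

lemma branch_structure:
  assumes p: "longest p" and i: "i < length p" and x: "x \<notin> set p" "adj x (p ! i)"
  shows "0 < i" "Suc i < length p" "V = insert x (set p)"
    "\<And>j. Suc j < length p \<Longrightarrow> w (p ! j) (p ! Suc j) = 1 \<and> w (p ! Suc j) (p ! j) = 1"
    "w (p ! i) x = 1" "w x (p ! i) = 1" "\<And>y. adj y x \<Longrightarrow> y = p ! i"
proof -
  have pp: "path p" using p by (simp add: longest_def)
  show i0: "0 < i"
  proof (rule ccontr)
    assume "\<not> 0 < i"
    then show False using longest_nb_0[OF p, of x] x by simp
  qed
  show i1: "Suc i < length p"
  proof (rule ccontr)
    assume "\<not> Suc i < length p"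
    then have "i = length p - 1" using i by simp
    then show False using longest_nb_last[OF p, of x] x by simp
  qed
  note ctr = branch_center[OF pp i0 i1 x]
  show "w (p ! i) x = 1" "w x (p ! i) = 1" using ctr(2)[of x] by auto
  show edges: "w (p ! j) (p ! Suc j) = 1 \<and> w (p ! Suc j) (p ! j) = 1" if j: "Suc j < length p" for j
  proof -
    consider "i < j" | "j = i" | "Suc j = i" | "Suc j < i" by linarith
    then show ?thesis
    proof cases
      case 1
      then show ?thesis using branch_right(2)[OF p i0 1 _ x] j by simp
    next
      case 2
      then show ?thesis using ctr(2)[of "p ! Suc i"] by auto
    next
      case 3
      then show ?thesis using ctr(2)[of "p ! (i - 1)"] by auto
    next
      case 4
      then show ?thesis using branch_left(2)[OF p 4 _ x] i1 by simp
    qed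
  qed
  show nbx: "y = p ! i" if y: "adj y x" for y
  proof (rule ccontr)
    assume ne: "y \<noteq> p ! i"
    have yp: "y \<notin> set p"
    proof
      assume "y \<in> set p"
      then obtain k where k: "k < length p" "y = p ! k" by (metis in_set_conv_nth)
      then show False using outside[OF pp i k(1) x(1,2)] adj_sym[OF y] ne by simp
    qed
    have i2: "2 \<le> i" using branch_second[OF p i x y yp] .
    have "2 \<le> length p - Suc i"
      using branch_second[OF longest_rev[OF p], of "length p - Suc i" x y] i x y yp rev_nth'[OF i] by simp
    then have i3: "Suc (Suc i) < length p" by simp
    have yx: "y \<noteq> x" using y adj_irrefl by blast
    have "distinct [p ! i, p ! (i - 1), p ! (i - 2), p ! Suc i, p ! Suc (Suc i)]"
      using i2 i3 by (auto simp: path_nth_eq[OF pp])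
    moreover have "\<And>k. k < length p \<Longrightarrow> p ! k \<noteq> x \<and> p ! k \<noteq> y \<and> x \<noteq> p ! k \<and> y \<noteq> p ! k"
      using x(1) yp nth_mem by metis
    ultimately have d: "distinct [p ! i, x, y, p ! (i - 1), p ! (i - 2), p ! Suc i, p ! Suc (Suc i)]"
      using i2 i3 yx by simp
    have a: "adj (p ! i) (p ! (i - 1))" "adj (p ! (i - 1)) (p ! (i - 2))"
      using pathD(4)[OF pp, of "i - 1"] pathD(4)[OF pp, of "i - 2"] i2 i3 adj_sym
      by (auto simp: numeral_2_eq_2 Suc_diff_Suc)
    show False
      using no_E6[OF d adj_sym[OF x(2)] adj_sym[OF y] a pathD(4)[OF pp i1] pathD(4)[OF pp i3]] .
  qed
  show "V = insert x (set p)"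
  proof (rule closed_covers[symmetric])
    show "insert x (set p) \<subseteq> V" using pathD(3)[OF pp] adj_V(1)[OF x(2)] by blast
    fix z y assume z: "z \<in> insert x (set p)" and a: "adj y z"
    show "y \<in> insert x (set p)"
    proof (cases "z = x")
      case True
      then show ?thesis using nbx[of y] a nth_mem[OF i] by simp
    next
      case False
      then obtain j where j: "j < length p" "z = p ! j" using z by (metis in_set_conv_nth insertE)
      consider "i < j" | "j = i" | "j < i" by linarith
      then show ?thesis
      proof cases
        case 1
        then show ?thesis using branch_right(1)[OF p i0 1 j(1) x] a j(2) by (simp add: nb(2))
      next
        case 2
        then show ?thesis using ctr(1)[of y] a j(2) i1 by auto
      next
        case 3
        then show ?thesis using branch_left(1)[OF p 3 _ x] a j(2) i1 by (simp add: nb(2))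
      qed
    qed
  qed simp
qed

text \<open>Listing the backbone first and x last reproduces the numbering used by
  \<open>dynkin_D\<close> and \<open>dynkin_E\<close>.\<close>

lemma star_iso:
  assumes q: "path q" and k: "k < length q" and x: "x \<notin> set q" and V: "V = insert x (set q)"
    and e: "\<And>j. Suc j < length q \<Longrightarrow> w (q ! j) (q ! Suc j) = 1 \<and> w (q ! Suc j) (q ! j) = 1"
    and xk: "w (q ! k) x = 1" "w x (q ! k) = 1" and only: "\<And>y. adj y x \<Longrightarrow> y = q ! k"
  shows "valued_graph_iso T (simply_laced (Suc (length q)) (insert (Suc k, Suc (length q)) (path_edges (length q))))"
proof (rule valued_graph_isoI[of "q @ [x]"])
  let ?n = "length q"
  show "distinct (q @ [x])" using pathD(2)[OF q] x by simp
  show "set (q @ [x]) = V" using V by simp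
  show "vverts (simply_laced (Suc ?n) (insert (Suc k, Suc ?n) (path_edges ?n))) = {1..length (q @ [x])}"
    by (simp add: simply_laced_def)
  have qq: "w (q ! i) (q ! j) = (if j = Suc i \<or> i = Suc j then 1 else 0)" if "i < ?n" "j < ?n" for i j
    using e[of i] e[of j] path_adj_iff[OF q that] not_adj[of "q ! i" "q ! j"] that by auto
  have qx: "w (q ! i) x = (if i = k then 1 else 0)" "w x (q ! i) = (if i = k then 1 else 0)" if "i < ?n" for i
    using only[of "q ! i"] adj_sym[of x "q ! i"] not_adj xk path_nth_eq[OF q that k] by auto
  have xx: "w x x = 0" using not_adj adj_irrefl by blast
  fix i j assume "i < length (q @ [x])" "j < length (q @ [x])"
  then consider "i < ?n" "j < ?n" | "i < ?n" "j = ?n" | "i = ?n" "j < ?n" | "i = ?n" "j = ?n" by fastforce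
  then show "vd (simply_laced (Suc ?n) (insert (Suc k, Suc ?n) (path_edges ?n))) (Suc i) (Suc j) =
      w ((q @ [x]) ! i) ((q @ [x]) ! j)"
    using k by cases (auto simp: simply_laced_def path_edges_def nth_append qq qx xx)
qed

text \<open>The three arms have lengths 1, i and length p - 1 - i, the last being at least i. For i
  = 1 this is type D; for i = 2 the third arm is at most 4 by extended E8, leaving E6, E7 and E8; i
  at least 3 contains extended E7.\<close>

lemma dynkin_branch:
  assumes p: "longest p" and i: "i < length p" and x: "x \<notin> set p" "adj x (p ! i)"
    and half: "i \<le> length p - Suc i"
  shows "dynkin_diagram T"
proof -
  note S = branch_structure[OF p i x]
  have pp: "path p" using p by (simp add: longest_def)
  let ?n = "length p"
  have xne: "p ! k \<noteq> x" if "k < ?n" for k using that x(1) nth_mem by blast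
  then have xne': "x \<noteq> p ! k" if "k < ?n" for k using that by metis
  note A = pathD(4)[OF pp]
  have A': "adj (p ! Suc k) (p ! k)" if "Suc k < ?n" for k using A[OF that] adj_sym by blast
  consider "i = 1" | "i = 2" "?n \<le> 7" | "i = 2" "8 \<le> ?n" | "3 \<le> i" using S(1) by linarith
  then show ?thesis
  proof cases
    case 1
    \<comment> \<open>In \<open>dynkin_D\<close> the branch sits near the end of the numbering, so
      the backbone is read backwards.\<close>
    have e: "w (rev p ! j) (rev p ! Suc j) = 1 \<and> w (rev p ! Suc j) (rev p ! j) = 1" if "Suc j < ?n" for j
    proof -
      have "?n - Suc j = Suc (?n - Suc (Suc j))" using that by simp
      then show ?thesis using S(4)[of "?n - Suc (Suc j)"] that by (simp add: rev_nth)
    qed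
    have "rev p ! (?n - 2) = p ! i" using 1 rev_nth'[OF i] by (simp add: numeral_2_eq_2)
    then have "valued_graph_iso T (simply_laced (Suc ?n) (insert (Suc (?n - 2), Suc ?n) (path_edges ?n)))"
      using star_iso[OF path_rev[OF pp], of "?n - 2" x] S x(1) e by simp
    moreover have D: "Suc ?n - 2 = Suc (?n - 2)" using S(1,2) by simp
    have "simply_laced (Suc ?n) (insert (Suc (?n - 2), Suc ?n) (path_edges ?n)) = dynkin_D (Suc ?n)"
      unfolding dynkin_D_def D by simp
    ultimately have "valued_graph_iso T (dynkin_D (Suc ?n))" by simp
    moreover have "4 \<le> Suc ?n" using S(1,2) 1 by simp
    ultimately show ?thesis unfolding dynkin_diagram_def by blast
  next
    case 2
    have "valued_graph_iso T (simply_laced (Suc ?n) (insert (Suc 2, Suc ?n) (path_edges ?n)))"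
      using star_iso[OF pp, of 2 x] S x(1) 2(1) i by simp
    then have "valued_graph_iso T (dynkin_E (Suc ?n))" by (simp add: dynkin_E_def)
    moreover have "Suc ?n = 6 \<or> Suc ?n = 7 \<or> Suc ?n = 8" using 2 half by linarith
    ultimately show ?thesis unfolding dynkin_diagram_def by auto
  next
    case 3
    have "distinct [p ! 2, p ! 1, p ! 0, p ! 3, p ! 4, p ! 5, p ! 6, p ! 7]"
      using 3 pathD(1)[OF pp] by (auto simp: path_nth_eq[OF pp])
    then have d: "distinct [p ! 2, x, p ! 1, p ! 0, p ! 3, p ! 4, p ! 5, p ! 6, p ! 7]"
      using 3 xne xne' pathD(1)[OF pp] by simp
    have a: "adj (p ! 2) (p ! 1)" "adj (p ! 1) (p ! 0)"
      using A'[of 1] A'[of 0] 3 by (simp_all add: numeral_2_eq_2)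
    have b: "adj (p ! 2) (p ! 3)" "adj (p ! 3) (p ! 4)" "adj (p ! 4) (p ! 5)" "adj (p ! 5) (p ! 6)" "adj (p ! 6) (p ! 7)"
      using A[of 2] A[of 3] A[of 4] A[of 5] A[of 6] 3 by simp_all
    have "adj (p ! 2) x" using adj_sym[OF x(2)] 3(1) by simp
    from no_E8[OF d this a b] show ?thesis ..
  next
    case 4
    define m where "m = i - 3"
    have m: "i = Suc (Suc (Suc m))" using 4 by (simp add: m_def)
    have l: "m + 6 < ?n" using half m by simp
    have "distinct [p ! i, p ! Suc (Suc m), p ! Suc m, p ! m, p ! Suc i, p ! Suc (Suc i), p ! Suc (Suc (Suc i))]"
      using l m by (auto simp: path_nth_eq[OF pp])
    then have d: "distinct [p ! i, x, p ! Suc (Suc m), p ! Suc m, p ! m, p ! Suc i, p ! Suc (Suc i), p ! Suc (Suc (Suc i))]"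
      using l m xne xne' by simp
    have False
      using no_E7[OF d adj_sym[OF x(2)]] l m A'[of "Suc (Suc m)"] A'[of "Suc m"] A'[of m] A[of i] A[of "Suc i"] A[of "Suc (Suc i)"]
      by simp
    then show ?thesis ..
  qed
qed

subsection \<open>Linear trees\<close>

lemma path_iso:
  assumes q: "path q" and V: "V = set q"
    and e: "\<And>j. \<lbrakk>Suc j < length q; j \<noteq> k\<rbrakk> \<Longrightarrow> w (q ! j) (q ! Suc j) = 1 \<and> w (q ! Suc j) (q ! j) = 1"
    and k: "Suc k < length q"
  shows "valued_graph_iso T (revalue (dynkin_A (length q)) (Suc k) (Suc (Suc k)) (w (q ! k) (q ! Suc k), w (q ! Suc k) (q ! k)))"
proof (rule valued_graph_isoI[of q])
  let ?n = "length q"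
  have qq: "w (q ! i) (q ! j) = (if i = k \<and> j = Suc k then w (q ! k) (q ! Suc k)
      else if i = Suc k \<and> j = k then w (q ! Suc k) (q ! k)
      else if j = Suc i \<or> i = Suc j then 1 else 0)" if "i < ?n" "j < ?n" for i j
    using e[of i] e[of j] path_adj_iff[OF q that] not_adj[of "q ! i" "q ! j"] that by auto
  fix i j assume ij: "i < ?n" "j < ?n"
  then show "vd (revalue (dynkin_A ?n) (Suc k) (Suc (Suc k)) (w (q ! k) (q ! Suc k), w (q ! Suc k) (q ! k))) (Suc i) (Suc j) = w (q ! i) (q ! j)"
    unfolding qq[OF ij] by (auto simp: revalue_def dynkin_A_def simply_laced_def path_edges_def)
qed (use pathD(2)[OF q] V in \<open>simp_all add: revalue_def dynkin_A_def simply_laced_def\<close>)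

lemma path_iso_A:
  assumes q: "path q" and V: "V = set q"
    and e: "\<And>j. Suc j < length q \<Longrightarrow> w (q ! j) (q ! Suc j) = 1 \<and> w (q ! Suc j) (q ! j) = 1"
  shows "valued_graph_iso T (dynkin_A (length q))"
proof (rule valued_graph_isoI[of q])
  let ?n = "length q"
  have qq: "w (q ! i) (q ! j) = (if j = Suc i \<or> i = Suc j then 1 else 0)" if "i < ?n" "j < ?n" for i j
    using e[of i] e[of j] path_adj_iff[OF q that] not_adj[of "q ! i" "q ! j"] that by auto
  fix i j assume "i < ?n" "j < ?n"
  then show "vd (dynkin_A ?n) (Suc i) (Suc j) = w (q ! i) (q ! j)"
    by (auto simp: dynkin_A_def simply_laced_def path_edges_def qq)
qed (use pathD(2)[OF q] V in \<open>simp_all add: dynkin_A_def simply_laced_def\<close>)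

text \<open>Adjacent multiple edges give weight 4 at their common vertex; otherwise each gives
  weight 2 at an end of the path between them.\<close>

lemma multi_edge_unique:
  assumes q: "path q" and jk: "j < k" "Suc k < length q"
    and m: "2 \<le> w (q ! j) (q ! Suc j) * w (q ! Suc j) (q ! j)" "2 \<le> w (q ! k) (q ! Suc k) * w (q ! Suc k) (q ! k)"
  shows False
proof (cases "k = Suc j")
  case True
  have "q ! j \<noteq> q ! Suc k" using path_nth_eq[OF q] jk by simp
  then have "4 \<le> wt (q ! k) {q ! j, q ! Suc k}" using m True by (simp add: wt_def mult.commute)
  then show False
    using wt_vertex[of "{q ! j, q ! Suc k}" "q ! k"] pathD(4)[OF q, of j] pathD(4)[OF q jk(2)] adj_sym jk True
    by (simp add: nb(2))
next
  case False
  let ?c = "map ((!) q) [Suc j..<Suc k]"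
  have c: "path ?c" using path_seg[OF q] jk by simp
  have l: "last ?c = q ! k" "?c ! 0 = q ! Suc j" "2 \<le> length ?c" using jk False by (simp_all add: last_map del: upt_Suc)
  have sc: "set ?c = (!) q ` {Suc j..k}" by auto
  have "q ! j \<noteq> q ! i" "q ! Suc k \<noteq> q ! i" if "i \<in> {Suc j..k}" for i using path_nth_eq[OF q] that jk by auto
  then have "{q ! j} \<inter> set ?c = {}" "{q ! Suc k} \<inter> set ?c = {}" unfolding sc by blast+
  moreover have "{q ! j} \<inter> {q ! Suc k} = {}" using path_nth_eq[OF q] jk by simp
  moreover have "{q ! j} \<subseteq> nb (q ! Suc j)" "{q ! Suc k} \<subseteq> nb (q ! k)"
    using pathD(4)[OF q, of j] pathD(4)[OF q jk(2)] adj_sym jk by (simp_all add: nb(2))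
  moreover have "2 \<le> wt (q ! Suc j) {q ! j}" "2 \<le> wt (q ! k) {q ! Suc k}" using m by (simp_all add: wt_def mult.commute)
  ultimately show False using wt_path[OF c l(3), of "{q ! j}" "{q ! Suc k}"] unfolding l(1,2) by blast
qed

lemma dynkin_linear_aux:
  assumes q: "path q" and V: "V = set q" and k: "Suc k < length q"
    and e: "\<And>j. \<lbrakk>Suc j < length q; j \<noteq> k\<rbrakk> \<Longrightarrow> w (q ! j) (q ! Suc j) = 1 \<and> w (q ! Suc j) (q ! j) = 1"
    and ab: "w (q ! k) (q ! Suc k) = a" "w (q ! Suc k) (q ! k) = b"
    and cases: "(a, b) = (1, 3) \<and> length q = 2 \<or> (a, b) = (1, 2) \<and> k + 2 = length q \<or>
      (a, b) = (2, 1) \<and> k + 2 = length q \<and> 3 \<le> length q \<or> (a, b) = (1, 2) \<and> k = 1 \<and> length q = 4"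
  shows "dynkin_diagram T"
proof -
  note I = path_iso[OF q V e k, unfolded ab]
  from cases show ?thesis
  proof (elim disjE conjE)
    assume "(a, b) = (1, 3)" "length q = 2"
    then have "valued_graph_iso T dynkin_G2" using I k by (simp add: dynkin_G2_def eval_nat_numeral)
    then show ?thesis unfolding dynkin_diagram_def by blast
  next
    assume *: "(a, b) = (1, 2)" "k + 2 = length q"
    then have "Suc k = length q - 1" "Suc (Suc k) = length q" by simp_all
    then have "valued_graph_iso T (dynkin_B (length q))" using I * by (simp add: dynkin_B_def)
    moreover have "2 \<le> length q" using k by simp
    ultimately show ?thesis unfolding dynkin_diagram_def by blast
  next
    assume *: "(a, b) = (2, 1)" "k + 2 = length q" "3 \<le> length q"
    then have "Suc k = length q - 1" "Suc (Suc k) = length q" by simp_all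
    then have "valued_graph_iso T (dynkin_C (length q))" using I * by (simp add: dynkin_C_def)
    then show ?thesis using *(3) unfolding dynkin_diagram_def by blast
  next
    assume "(a, b) = (1, 2)" "k = 1" "length q = 4"
    then have "valued_graph_iso T dynkin_F4" using I by (simp add: dynkin_F4_def eval_nat_numeral)
    then show ?thesis unfolding dynkin_diagram_def by blast
  qed
qed

text \<open>At most one edge is multiple, and its product is 2 or 3. A product 3 leaves no room for
  a further edge, which is G2. A product 2 at an end is B or C; in the interior, extended F4 leaves
  only F4 itself.\<close>

lemma dynkin_linear:
  assumes q: "path q" and V: "V = set q"
  shows "dynkin_diagram T"
proof (cases "\<exists>k. Suc k < length q \<and> 2 \<le> w (q ! k) (q ! Suc k) * w (q ! Suc k) (q ! k)")
  case False
  have "w (q ! j) (q ! Suc j) = 1 \<and> w (q ! Suc j) (q ! j) = 1" if j: "Suc j < length q" for j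
  proof -
    have "1 \<le> w (q ! j) (q ! Suc j) * w (q ! Suc j) (q ! j)" using prod_pos[OF pathD(4)[OF q j]] by (simp add: mult.commute)
    moreover have "\<not> 2 \<le> w (q ! j) (q ! Suc j) * w (q ! Suc j) (q ! j)" using False j by blast
    ultimately have "w (q ! j) (q ! Suc j) * w (q ! Suc j) (q ! j) = 1" by linarith
    then show ?thesis by simp
  qed
  then have "valued_graph_iso T (dynkin_A (length q))" using path_iso_A[OF q V] by blast
  moreover have "1 \<le> length q" using pathD(1)[OF q] by (simp add: Suc_le_eq)
  ultimately show ?thesis unfolding dynkin_diagram_def by blast
next
  case True
  let ?n = "length q"
  obtain k where k: "Suc k < ?n" "2 \<le> w (q ! k) (q ! Suc k) * w (q ! Suc k) (q ! k)" using True by blast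
  define a b where "a = w (q ! k) (q ! Suc k)" and "b = w (q ! Suc k) (q ! k)"
  have e: "w (q ! j) (q ! Suc j) = 1 \<and> w (q ! Suc j) (q ! j) = 1" if j: "Suc j < ?n" "j \<noteq> k" for j
  proof -
    have "\<not> 2 \<le> w (q ! j) (q ! Suc j) * w (q ! Suc j) (q ! j)"
      using multi_edge_unique[OF q, of j k] multi_edge_unique[OF q, of k j] j k
      by (cases j k rule: linorder_cases) auto
    moreover have "1 \<le> w (q ! j) (q ! Suc j) * w (q ! Suc j) (q ! j)"
      using prod_pos[OF pathD(4)[OF q j(1)]] by (simp add: mult.commute)
    ultimately have "w (q ! j) (q ! Suc j) * w (q ! Suc j) (q ! j) = 1" by linarith
    then show ?thesis by simp
  qed
  have A: "adj (q ! k) (q ! Suc k)" "adj (q ! Suc k) (q ! k)" using pathD(4)[OF q k(1)] adj_sym by auto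
  have le3: "a * b \<le> 3"
  proof -
    have "wt (q ! k) {q ! Suc k} < 4" using wt_vertex[of "{q ! Suc k}" "q ! k"] A by (force simp: nb(2))
    then show ?thesis by (simp add: wt_def a_def b_def)
  qed
  have left: "a * b \<le> 2" if "0 < k"
  proof -
    have ne: "q ! (k - 1) \<noteq> q ! Suc k" using path_nth_eq[OF q] k that by simp
    have B: "adj (q ! (k - 1)) (q ! k)" using pathD(4)[OF q, of "k - 1"] k that by simp
    have "wt (q ! k) {q ! Suc k, q ! (k - 1)} < 4"
      using wt_vertex[of "{q ! Suc k, q ! (k - 1)}" "q ! k"] A B by (force simp: nb(2))
    then show ?thesis using ne prod_pos[OF B] by (simp add: wt_def a_def b_def del: One_nat_def)
  qed
  have right: "a * b \<le> 2" if s: "Suc (Suc k) < ?n"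
  proof -
    have ne: "q ! k \<noteq> q ! Suc (Suc k)" using path_nth_eq[OF q] s by simp
    have B: "adj (q ! Suc (Suc k)) (q ! Suc k)" using pathD(4)[OF q s] adj_sym by blast
    have "wt (q ! Suc k) {q ! k, q ! Suc (Suc k)} < 4"
      using wt_vertex[of "{q ! k, q ! Suc (Suc k)}" "q ! Suc k"] A B by (force simp: nb(2))
    then show ?thesis using ne prod_pos[OF B] by (simp add: wt_def a_def b_def mult.commute del: One_nat_def)
  qed
  have ab2: "2 \<le> a * b" using k by (simp add: a_def b_def)
  have ab_le: "a \<le> 3" "b \<le> 3" using le3 ab2 by (metis mult_is_0 mult_le_mono1 mult_le_mono2 nat_mult_1 nat_mult_1_right not_less_eq_eq le_trans le0 Suc_leI neq0_conv One_nat_def zero_neq_numeral le_0_eq)+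
  have ab: "(a, b) \<in> {(1, 2), (2, 1), (1, 3), (3, 1)}"
  proof -
    have "a = 0 \<or> a = 1 \<or> a = 2 \<or> a = 3" "b = 0 \<or> b = 1 \<or> b = 2 \<or> b = 3" using ab_le by linarith+
    then show ?thesis using le3 ab2 by (elim disjE) simp_all
  qed
  have three: "?n = 2 \<and> k = 0" if "a * b = 3" using left right k that by fastforce
  have mid: "?n = 4 \<and> k = 1" if two: "a * b = 2" "0 < k" "Suc (Suc k) < ?n"
  proof (rule ccontr)
    assume n: "\<not> ?thesis"
    have dbl: "(a, b) = (1, 2) \<or> (a, b) = (2, 1)" using ab two(1) by auto
    have C: "adj (q ! (k - 1)) (q ! k)" using pathD(4)[OF q, of "k - 1"] k two by simp
    have C': "adj (q ! Suc k) (q ! Suc (Suc k))" using pathD(4)[OF q two(3)] .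
    show False
    proof (cases "2 \<le> k")
      case True
      have d: "distinct [q ! (k - 2), q ! (k - 1), q ! k, q ! Suc k, q ! Suc (Suc k)]"
        using True two by (auto simp: path_nth_eq[OF q])
      have "adj (q ! (k - 2)) (q ! (k - 1))"
        using pathD(4)[OF q, of "k - 2"] k True by (simp add: numeral_2_eq_2 Suc_diff_Suc)
      then show False using no_F4[OF d _ C C'] dbl unfolding a_def b_def by blast
    next
      case False
      then have k1: "k = 1" using two by simp
      then have s: "Suc (Suc (Suc k)) < ?n" using n two by simp
      have d: "distinct [q ! Suc (Suc (Suc k)), q ! Suc (Suc k), q ! Suc k, q ! k, q ! (k - 1)]"
        using s k1 pathD(1)[OF q] by (auto simp: path_nth_eq[OF q])
      show False
        using no_F4[OF d adj_sym[OF pathD(4)[OF q s]] adj_sym[OF C'] adj_sym[OF C]] dbl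
        unfolding a_def b_def by auto
    qed
  qed
  have rq: "path (rev q)" "V = set (rev q)" using path_rev[OF q] V by simp_all
  \<comment> \<open>Reversing the path sends the edge with index k to the one with index length q -
    2 - k.\<close>
  have r: "rev q ! (?n - 2 - j) = q ! Suc j" "rev q ! Suc (?n - 2 - j) = q ! j" if "Suc j < ?n" for j
    using that by (simp_all add: rev_nth) (simp_all add: numeral_2_eq_2 Suc_diff_Suc)
  have re: "w (rev q ! j) (rev q ! Suc j) = 1 \<and> w (rev q ! Suc j) (rev q ! j) = 1"
    if j: "Suc j < length (rev q)" "j \<noteq> ?n - 2 - k" for j
  proof -
    define j' where "j' = ?n - 2 - j"
    have j': "Suc j' < ?n" "j' \<noteq> k" "j = ?n - 2 - j'" using j k(1) by (auto simp: j'_def)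
    show ?thesis using e[OF j'(1,2)] r[OF j'(1)] j'(3) by simp
  qed
  have rab: "w (rev q ! (?n - 2 - k)) (rev q ! Suc (?n - 2 - k)) = b" "w (rev q ! Suc (?n - 2 - k)) (rev q ! (?n - 2 - k)) = a"
    using r[OF k(1)] by (simp_all add: a_def b_def)
  have rk: "Suc (?n - 2 - k) < length (rev q)" using k by simp
  have fwd: "dynkin_diagram T"
    if "(a, b) = (1, 3) \<and> ?n = 2 \<or> (a, b) = (1, 2) \<and> k + 2 = ?n \<or>
      (a, b) = (2, 1) \<and> k + 2 = ?n \<and> 3 \<le> ?n \<or> (a, b) = (1, 2) \<and> k = 1 \<and> ?n = 4"
    by (rule dynkin_linear_aux[OF q V k(1) _ a_def[symmetric] b_def[symmetric] that]) (rule e)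
  have bwd: "dynkin_diagram T"
    if c: "(b, a) = (1, 3) \<and> ?n = 2 \<or> (b, a) = (1, 2) \<and> k = 0 \<or>
      (b, a) = (2, 1) \<and> k = 0 \<and> 3 \<le> ?n \<or> (b, a) = (1, 2) \<and> k = 1 \<and> ?n = 4"
  proof (rule dynkin_linear_aux[OF rq rk _ rab])
    show "(b, a) = (1, 3) \<and> length (rev q) = 2 \<or> (b, a) = (1, 2) \<and> ?n - 2 - k + 2 = length (rev q) \<or>
      (b, a) = (2, 1) \<and> ?n - 2 - k + 2 = length (rev q) \<and> 3 \<le> length (rev q) \<or>
      (b, a) = (1, 2) \<and> ?n - 2 - k = 1 \<and> length (rev q) = 4"
    proof -
      have "?n - 2 - k + 2 = ?n" if "k = 0" using k(1) that by simp
      moreover have "?n - 2 - k = 1" if "k = 1" "?n = 4" using that by simp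
      ultimately show ?thesis using c unfolding length_rev by blast
    qed
  qed (rule re)
  consider "a * b = 3" | "a * b = 2" "Suc (Suc k) = ?n" | "a * b = 2" "k = 0" "Suc (Suc k) < ?n"
    | "a * b = 2" "0 < k" "Suc (Suc k) < ?n"
  proof -
    have "a * b = 2 \<or> a * b = 3" using le3 ab2 by linarith
    then show thesis using that k(1) by (metis Suc_lessI neq0_conv)
  qed
  then show ?thesis
  proof cases
    case 1
    then have "(a, b) = (1, 3) \<or> (b, a) = (1, 3)" using ab by auto
    then show ?thesis using three[OF 1] fwd bwd by blast
  next
    case 2
    \<comment> \<open>In rank 2 types B and C coincide and \<open>dynkin_C\<close> starts at rank 3,
      so this diagram is read backwards as B2.\<close>
    show ?thesis
    proof (cases "(a, b) = (2, 1) \<and> ?n = 2")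
      case True
      then have "(b, a) = (1, 2) \<and> k = 0" using 2 by simp
      then show ?thesis using bwd by blast
    next
      case False
      have "(a, b) = (1, 2) \<or> (a, b) = (2, 1)" using ab 2 by auto
      moreover have "k + 2 = ?n" "?n \<noteq> 2 \<Longrightarrow> 3 \<le> ?n" using 2 k(1) by auto
      ultimately show ?thesis using False fwd by blast
    qed
  next
    case 3
    then have "(b, a) = (1, 2) \<or> (b, a) = (2, 1)" using ab by auto
    moreover have "3 \<le> ?n" using 3 by simp
    ultimately show ?thesis using bwd 3(2) by blast
  next
    case 4
    then have "(a, b) = (1, 2) \<or> (b, a) = (1, 2)" using ab by auto
    then show ?thesis using mid[OF 4] fwd bwd by blast
  qed
qed

theorem dynkin: "dynkin_diagram T"
proof -
  obtain p where p: "longest p" using longest_ex by blast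
  have pp: "path p" using p by (simp add: longest_def)
  show ?thesis
  proof (cases "V = set p")
    case True
    then show ?thesis using dynkin_linear[OF pp] by blast
  next
    case False
    then obtain z x where z: "z \<in> set p" "adj x z" "x \<notin> set p"
      using closed_covers[of "set p"] pathD(1,3)[OF pp] by blast
    then obtain i where i: "i < length p" "z = p ! i" by (metis in_set_conv_nth)
    show ?thesis
    proof (cases "i \<le> length p - Suc i")
      case True
      then show ?thesis using dynkin_branch[OF p i(1) z(3)] z(2) i(2) by simp
    next
      case False
      then show ?thesis
        using dynkin_branch[OF longest_rev[OF p], of "length p - Suc i" x] z i rev_nth'[OF i(1)] by simp
    qed
  qed
qed

end

section \<open>Coverings of finite valued translation quivers\<close>

text \<open>A finite valued translation quiver with a strictly subadditive function. The labels are
  total functions with value 0 off the arrows; \<open>al_tau\<close> and \<open>bl_tau\<close> say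
  that the arrow from \<tau> y to x carries the label of the arrow from x to y with its entries
  exchanged.\<close>

locale finite_vtq =
  fixes \<Gamma> :: "'v set" and tau :: "'v \<Rightarrow> 'v" and al bl :: "'v \<Rightarrow> 'v \<Rightarrow> nat" and gf :: "'v \<Rightarrow> nat"
  assumes fin: "finite \<Gamma>" and nonempty: "\<Gamma> \<noteq> {}" and tau_bij: "bij_betw tau \<Gamma> \<Gamma>"
    and al_bl: "\<lbrakk>x \<in> \<Gamma>; y \<in> \<Gamma>\<rbrakk> \<Longrightarrow> al x y = 0 \<longleftrightarrow> bl x y = 0"
    and al_tau: "\<lbrakk>x \<in> \<Gamma>; y \<in> \<Gamma>\<rbrakk> \<Longrightarrow> al (tau y) x = bl x y"
    and bl_tau: "\<lbrakk>x \<in> \<Gamma>; y \<in> \<Gamma>\<rbrakk> \<Longrightarrow> bl (tau y) x = al x y"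
    and strict: "y \<in> \<Gamma> \<Longrightarrow> (\<Sum>x\<in>\<Gamma>. al x y * gf x) < gf (tau y) + gf y"
    and connected: "\<lbrakk>x \<in> \<Gamma>; y \<in> \<Gamma>\<rbrakk> \<Longrightarrow>
      (x, y) \<in> ({(x, y). x \<in> \<Gamma> \<and> y \<in> \<Gamma> \<and> al x y \<noteq> 0} \<union> {(x, y). x \<in> \<Gamma> \<and> y \<in> \<Gamma> \<and> al x y \<noteq> 0}\<inverse>)\<^sup>*"
begin

definition "E = {(x, y). x \<in> \<Gamma> \<and> y \<in> \<Gamma> \<and> al x y \<noteq> 0}"

definition "Q = \<lparr>qverts = \<Gamma>, qarr = E, qlab = {(x, y, al x y, bl x y) | x y. (x, y) \<in> E},
  qtau = {(x, tau x) | x. x \<in> \<Gamma>}\<rparr>"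

lemma Q_simps [simp]: "qverts Q = \<Gamma>" "qarr Q = E"
  "(x, y, a, b) \<in> qlab Q \<longleftrightarrow> (x, y) \<in> E \<and> a = al x y \<and> b = bl x y"
  "(x, y) \<in> qtau Q \<longleftrightarrow> x \<in> \<Gamma> \<and> y = tau x"
  by (auto simp: Q_def)

lemma E_iff: "(x, y) \<in> E \<longleftrightarrow> x \<in> \<Gamma> \<and> y \<in> \<Gamma> \<and> al x y \<noteq> 0"
  by (simp add: E_def)

lemma tau_in: "x \<in> \<Gamma> \<Longrightarrow> tau x \<in> \<Gamma>"
  using tau_bij bij_betwE by blast

lemma al_tau_tau: "\<lbrakk>x \<in> \<Gamma>; y \<in> \<Gamma>\<rbrakk> \<Longrightarrow> al (tau x) (tau y) = al x y" "\<lbrakk>x \<in> \<Gamma>; y \<in> \<Gamma>\<rbrakk> \<Longrightarrow> bl (tau x) (tau y) = bl x y"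
  using al_tau bl_tau tau_in by metis+

lemma period_ex: "\<exists>P>0. \<forall>x\<in>\<Gamma>. (tau ^^ P) x = x"
proof -
  define f where "f x = (if x \<in> \<Gamma> then tau x else x)" for x
  have "bij_betw f \<Gamma> \<Gamma>" using tau_bij by (simp add: f_def cong: bij_betw_cong)
  then have "f permutes \<Gamma>" by (rule bij_imp_permutes) (simp add: f_def)
  then have "permutation f" using fin permutation_permutes by blast
  then obtain n where n: "f ^^ n = id" "n > 0" using permutation_is_nilpotent by blast
  have "(f ^^ k) x = (tau ^^ k) x \<and> (tau ^^ k) x \<in> \<Gamma>" if "x \<in> \<Gamma>" for x k
    using that by (induct k) (auto simp: f_def tau_in)
  then show ?thesis using n by (intro exI[of _ n]) (metis id_apply)
qed

definition "P = (SOME P. P > 0 \<and> (\<forall>x\<in>\<Gamma>. (tau ^^ P) x = x))"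

lemma P: "P > 0" "x \<in> \<Gamma> \<Longrightarrow> (tau ^^ P) x = x"
  using someI_ex[OF period_ex] unfolding P_def by blast+

lemma pow_in: "x \<in> \<Gamma> \<Longrightarrow> (tau ^^ k) x \<in> \<Gamma>"
  by (induct k) (auto simp: tau_in)

lemma pow_bij: "bij_betw (tau ^^ k) \<Gamma> \<Gamma>"
  using bij_betw_funpow tau_bij by blast

lemma pow_al: "\<lbrakk>x \<in> \<Gamma>; y \<in> \<Gamma>\<rbrakk> \<Longrightarrow> al ((tau ^^ k) x) ((tau ^^ k) y) = al x y"
  "\<lbrakk>x \<in> \<Gamma>; y \<in> \<Gamma>\<rbrakk> \<Longrightarrow> bl ((tau ^^ k) x) ((tau ^^ k) y) = bl x y"
  by (induct k) (auto simp: al_tau_tau pow_in)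

text \<open>The sum runs over one period P common to all vertices rather than over each orbit, since
  orbits may differ in length; the inequalities for the individual powers of \<open>tau\<close> can
  then be added term by term.\<close>

definition "gs y = (\<Sum>k<P. gf ((tau ^^ k) y))"

lemma gs_tau: "y \<in> \<Gamma> \<Longrightarrow> gs (tau y) = gs y"
proof -
  assume y: "y \<in> \<Gamma>"
  obtain m where m: "P = Suc m" using P(1) gr0_implies_Suc by blast
  have "gs (tau y) = (\<Sum>k<P. gf ((tau ^^ Suc k) y))" by (simp add: gs_def funpow_swap1)
  also have "\<dots> = (\<Sum>k<m. gf ((tau ^^ Suc k) y)) + gf ((tau ^^ 0) y)" using P(2)[OF y] m by simp
  also have "\<dots> = gs y" unfolding gs_def m by (subst sum.lessThan_Suc_shift) simp
  finally show ?thesis .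
qed

text \<open>The labels are invariant under \<open>tau\<close>, so the summand for k is the strict
  inequality at the k-th translate of y; invariance of \<open>gs\<close> turns gs (tau y) + gs y
  into 2 gs y.\<close>

lemma gs_strict:
  assumes y: "y \<in> \<Gamma>"
  shows "(\<Sum>x\<in>\<Gamma>. al x y * gs x) < 2 * gs y"
proof -
  have "(\<Sum>x\<in>\<Gamma>. al x y * gs x) = (\<Sum>k<P. \<Sum>x\<in>\<Gamma>. al x y * gf ((tau ^^ k) x))"
    unfolding gs_def sum_distrib_left by (rule sum.swap)
  also have "\<dots> = (\<Sum>k<P. \<Sum>x\<in>\<Gamma>. al x ((tau ^^ k) y) * gf x)"
  proof (rule sum.cong)
    fix k
    have "(\<Sum>x\<in>\<Gamma>. al x y * gf ((tau ^^ k) x)) = (\<Sum>x\<in>\<Gamma>. al ((tau ^^ k) x) ((tau ^^ k) y) * gf ((tau ^^ k) x))"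
      using y pow_al by (intro sum.cong) auto
    also have "\<dots> = (\<Sum>x\<in>\<Gamma>. al x ((tau ^^ k) y) * gf x)"
      by (rule sum.reindex_bij_betw[OF pow_bij])
    finally show "(\<Sum>x\<in>\<Gamma>. al x y * gf ((tau ^^ k) x)) = (\<Sum>x\<in>\<Gamma>. al x ((tau ^^ k) y) * gf x)" .
  qed simp
  also have "\<dots> < (\<Sum>k<P. gf (tau ((tau ^^ k) y)) + gf ((tau ^^ k) y))"
    using strict pow_in y P(1) by (intro sum_strict_mono) auto
  also have "\<dots> = gs (tau y) + gs y" by (simp add: gs_def sum.distrib funpow_swap1)
  finally show ?thesis using gs_tau[OF y] by simp
qed

subsection \<open>Tree classes are Dynkin diagrams\<close>

lemma Z_quiver_simps:
  "qverts (Z_quiver T A) = UNIV \<times> vverts T"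
  "((n, x), (m, y)) \<in> qarr (Z_quiver T A) \<longleftrightarrow> m = n \<and> (x, y) \<in> A \<or> m = n + 1 \<and> (y, x) \<in> A"
  "((n, x), (m, y), a, b) \<in> qlab (Z_quiver T A) \<longleftrightarrow>
    ((n, x), (m, y)) \<in> qarr (Z_quiver T A) \<and> a = vd T x y \<and> b = vd T y x"
  "((n, x), (m, y)) \<in> qtau (Z_quiver T A) \<longleftrightarrow> x \<in> vverts T \<and> y = x \<and> m = n - 1"
  by (auto simp: Z_quiver_def)

text \<open>\<open>gs\<close> does not see the level n of (n, s), so its pullback is a function on T
  alone. The bijection on predecessors identifies the neighbours of t with the predecessors of its
  image and also shows T to be locally finite.\<close>

theorem covering_dynkin:
  assumes T: "valued_tree T" and A: "orientation T A" and cov: "quiver_covering (Z_quiver T A) Q \<pi>"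
  shows "dynkin_diagram T"
proof -
  let ?Z = "Z_quiver T A"
  have Aadj: "(x, y) \<in> vadj T \<longleftrightarrow> (x, y) \<in> A \<or> (y, x) \<in> A" for x y
    using A unfolding orientation_def by blast
  have asym: "(x, y) \<in> A \<Longrightarrow> (y, x) \<notin> A" for x y using A unfolding orientation_def by blast
  have AV: "(x, y) \<in> A \<Longrightarrow> x \<in> vverts T \<and> y \<in> vverts T" for x y
    using T Aadj unfolding valued_tree_def by blast
  have ptau: "\<pi> (n - 1, x) = tau (\<pi> (n, x))" "\<pi> (n, x) \<in> \<Gamma>" if "x \<in> vverts T" for n x
  proof -
    have "((n, x), (n - 1, x)) \<in> qtau ?Z" using that by (simp add: Z_quiver_simps)
    then have "(\<pi> (n, x), \<pi> (n - 1, x)) \<in> qtau Q" using cov unfolding quiver_covering_def by blast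
    then show "\<pi> (n - 1, x) = tau (\<pi> (n, x))" "\<pi> (n, x) \<in> \<Gamma>" by auto
  qed
  have plab: "(\<pi> (n, x), \<pi> (m, y)) \<in> E \<and> vd T x y = al (\<pi> (n, x)) (\<pi> (m, y))"
    if "((n, x), (m, y)) \<in> qarr ?Z" for n x m y
  proof -
    have "((n, x), (m, y), vd T x y, vd T y x) \<in> qlab ?Z" using that by (simp add: Z_quiver_simps)
    then have "(\<pi> (n, x), \<pi> (m, y), vd T x y, vd T y x) \<in> qlab Q"
      using cov unfolding quiver_covering_def by blast
    then show ?thesis by simp
  qed
  define d where "d t = gs (\<pi> (0, t))" for t
  \<comment> \<open>The predecessor of (0, t) lying over s has level 0 or -1 according to the
    orientation of the edge.\<close>
  define pre where "pre t s = (if (s, t) \<in> A then 0 else - 1 :: int, s)" for t s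
  have bij: "bij_betw (\<lambda>s. \<pi> (pre t s)) {s. (s, t) \<in> vadj T} {x. (x, \<pi> (0, t)) \<in> E}" if t: "t \<in> vverts T" for t
  proof -
    have "bij_betw (pre t) {s. (s, t) \<in> vadj T} {p. (p, (0, t)) \<in> qarr ?Z}"
    proof (rule bij_betwI')
      fix p assume "p \<in> {p. (p, (0, t)) \<in> qarr ?Z}"
      then obtain n s where p: "p = (n, s)" "0 = n \<and> (s, t) \<in> A \<or> 0 = n + 1 \<and> (t, s) \<in> A"
        by (cases p) (auto simp: Z_quiver_simps)
      then have "(s, t) \<in> vadj T" "p = pre t s" using Aadj asym by (auto simp: pre_def)
      then show "\<exists>s\<in>{s. (s, t) \<in> vadj T}. p = pre t s" by blast
    qed (use Aadj in \<open>auto simp: pre_def Z_quiver_simps\<close>)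
    moreover have "bij_betw \<pi> {p. (p, (0, t)) \<in> qarr ?Z} {x. (x, \<pi> (0, t)) \<in> E}"
      using cov t unfolding quiver_covering_def by (simp add: Z_quiver_simps(1))
    ultimately show ?thesis using bij_betw_trans unfolding comp_def by blast
  qed
  have finE: "finite {x. (x, y) \<in> E}" for y
    using fin by (rule finite_subset[rotated]) (auto simp: E_iff)
  have key: "(\<Sum>s | (s, t) \<in> vadj T. vd T s t * d s) < 2 * d t" if t: "t \<in> vverts T" for t
  proof -
    let ?y = "\<pi> (0, t)"
    have "vd T s t * d s = al (\<pi> (pre t s)) ?y * gs (\<pi> (pre t s))" if s: "(s, t) \<in> vadj T" for s
    proof -
      have sV: "s \<in> vverts T" using s Aadj AV by blast
      have "(pre t s, (0, t)) \<in> qarr ?Z" using s Aadj by (auto simp: pre_def Z_quiver_simps)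
      then have "vd T s t = al (\<pi> (pre t s)) ?y" using plab unfolding pre_def by blast
      moreover have "gs (\<pi> (pre t s)) = d s"
        using ptau(1)[OF sV, of 0] gs_tau[OF ptau(2)[OF sV, of 0]] by (simp add: pre_def d_def)
      ultimately show ?thesis by simp
    qed
    then have "(\<Sum>s | (s, t) \<in> vadj T. vd T s t * d s) = (\<Sum>s | (s, t) \<in> vadj T. al (\<pi> (pre t s)) ?y * gs (\<pi> (pre t s)))"
      by (intro sum.cong) auto
    also have "\<dots> = (\<Sum>x | (x, ?y) \<in> E. al x ?y * gs x)"
      by (rule sum.reindex_bij_betw[OF bij[OF t]])
    also have "\<dots> \<le> (\<Sum>x\<in>\<Gamma>. al x ?y * gs x)" using fin by (intro sum_mono2) (auto simp: E_iff)
    also have "\<dots> < 2 * d t" unfolding d_def using gs_strict ptau(2)[OF t] .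
    finally show ?thesis .
  qed
  interpret subadditive_tree T d "\<Sum>y\<in>\<Gamma>. gs y"
  proof
    show "finite {x. (x, y) \<in> vadj T}" if "y \<in> vverts T" for y
      using bij_betw_finite[OF bij[OF that]] finE by blast
    show "d y \<le> (\<Sum>y\<in>\<Gamma>. gs y)" if "y \<in> vverts T" for y
      unfolding d_def using ptau(2)[OF that] fin by (intro member_le_sum) auto
  qed (use T key in auto)
  show ?thesis by (rule dynkin)
qed

corollary tree_class_dynkin: "tree_class Q T \<Longrightarrow> dynkin_diagram T"
  unfolding tree_class_def using covering_dynkin by blast

subsection \<open>Integer powers of the translation\<close>

text \<open>All integer powers of \<open>tau\<close> at once, via its period \<open>P\<close>.\<close>

definition "tp n y = (tau ^^ nat (n mod int P)) y"

lemma pow_mod: "y \<in> \<Gamma> \<Longrightarrow> (tau ^^ (k mod P)) y = (tau ^^ k) y"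
proof -
  assume y: "y \<in> \<Gamma>"
  have m: "(tau ^^ (P * j)) z = z" if "z \<in> \<Gamma>" for j z
    using that P(2) by (induct j) (simp_all add: funpow_add)
  have "(tau ^^ k) y = (tau ^^ (k mod P + P * (k div P))) y" by simp
  also have "\<dots> = (tau ^^ (k mod P)) y" unfolding funpow_add using m[OF y] by simp
  finally show ?thesis by simp
qed

lemma tp_0 [simp]: "tp 0 y = y" by (simp add: tp_def)

lemma tp_in: "y \<in> \<Gamma> \<Longrightarrow> tp n y \<in> \<Gamma>" by (simp add: tp_def pow_in)

lemma tp_tp: "y \<in> \<Gamma> \<Longrightarrow> tp n (tp m y) = tp (n + m) y"
proof -
  assume y: "y \<in> \<Gamma>"
  have "nat ((n + m) mod int P) = (nat (n mod int P) + nat (m mod int P)) mod P"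
  proof -
    have "int ((nat (n mod int P) + nat (m mod int P)) mod P) = (n + m) mod int P"
      using P(1) by (simp add: zmod_int mod_add_eq)
    then show ?thesis by (metis nat_int)
  qed
  then show ?thesis unfolding tp_def using pow_mod[OF y] by (simp add: funpow_add)
qed

lemma tp_1: "y \<in> \<Gamma> \<Longrightarrow> tp 1 y = tau y"
proof -
  assume y: "y \<in> \<Gamma>"
  have "nat (1 mod int P) = 1 mod P" using nat_mod_distrib[of 1 "int P"] by simp
  then show ?thesis unfolding tp_def using pow_mod[OF y, of 1] by simp
qed

lemma tp_Suc: "y \<in> \<Gamma> \<Longrightarrow> tp (n + 1) y = tau (tp n y)"
  using tp_tp[of y 1 n] tp_1[OF tp_in] by (simp add: add.commute)

lemma tp_inj: "\<lbrakk>x \<in> \<Gamma>; y \<in> \<Gamma>; tp n x = tp n y\<rbrakk> \<Longrightarrow> x = y"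
proof -
  assume a: "x \<in> \<Gamma>" "y \<in> \<Gamma>" "tp n x = tp n y"
  have "x = tp (- n) (tp n x)" using tp_tp[OF a(1), of "- n" n] by simp
  also have "\<dots> = tp (- n) (tp n y)" using a(3) by (rule arg_cong)
  also have "\<dots> = y" using tp_tp[OF a(2), of "- n" n] by simp
  finally show "x = y" .
qed

lemma tp_al: "\<lbrakk>x \<in> \<Gamma>; y \<in> \<Gamma>\<rbrakk> \<Longrightarrow> al (tp n x) (tp n y) = al x y"
  "\<lbrakk>x \<in> \<Gamma>; y \<in> \<Gamma>\<rbrakk> \<Longrightarrow> bl (tp n x) (tp n y) = bl x y"
  by (simp_all add: tp_def pow_al)

lemma E_tau: "\<lbrakk>x \<in> \<Gamma>; y \<in> \<Gamma>\<rbrakk> \<Longrightarrow> (tau y, x) \<in> E \<longleftrightarrow> (x, y) \<in> E"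
  using al_tau al_bl tau_in by (simp add: E_iff)

end

text \<open>The tree of reduced walks in \<open>\<Gamma>\<close> starting at \<open>x0\<close>: a vertex \<open>p\<close> stands for a walk ending at
  \<open>lab p\<close>, and \<open>par p\<close> is the walk without its last step.\<close>

locale walk_tree = finite_vtq +
  fixes x0 :: 'a and W :: "'w set" and root :: 'w and par :: "'w \<Rightarrow> 'w" and lab :: "'w \<Rightarrow> 'a" and depth :: "'w \<Rightarrow> nat"
  assumes x0: "x0 \<in> \<Gamma>" and root: "root \<in> W" "lab root = x0" "depth root = 0"
    and par: "\<lbrakk>p \<in> W; p \<noteq> root\<rbrakk> \<Longrightarrow> par p \<in> W \<and> depth p = Suc (depth (par p))"
    and lab: "\<lbrakk>p \<in> W; p \<noteq> root\<rbrakk> \<Longrightarrow> lab p \<in> \<Gamma> \<and> al (lab (par p)) (lab p) \<noteq> 0"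
    and reduced: "\<lbrakk>p \<in> W; p \<noteq> root; par p \<noteq> root\<rbrakk> \<Longrightarrow> tau (lab p) \<noteq> lab (par (par p))"
    and child: "\<lbrakk>p \<in> W; z \<in> \<Gamma>; al (lab p) z \<noteq> 0; p \<noteq> root \<Longrightarrow> tau z \<noteq> lab (par p)\<rbrakk>
      \<Longrightarrow> \<exists>q\<in>W. q \<noteq> root \<and> par q = p \<and> lab q = z"
    and child_unique: "\<lbrakk>p \<in> W; q \<in> W; p \<noteq> root; q \<noteq> root; par p = par q; lab p = lab q\<rbrakk> \<Longrightarrow> p = q"
begin

lemma lab_in: "p \<in> W \<Longrightarrow> lab p \<in> \<Gamma>"
  using lab root x0 by metis

lemma W_induct [consumes 1, case_names root child]:
  assumes "p \<in> W" "R root" "\<And>q. \<lbrakk>q \<in> W; q \<noteq> root; R (par q)\<rbrakk> \<Longrightarrow> R q"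
  shows "R p"
  using assms(1)
proof (induct "depth p" arbitrary: p)
  case 0
  then have "p = root" using par by fastforce
  then show ?case using assms(2) by simp
next
  case (Suc n)
  then have "p \<noteq> root" using root by auto
  then show ?case using assms(3) Suc par by fastforce
qed

definition "child_of p q \<longleftrightarrow> q \<in> W \<and> q \<noteq> root \<and> par q = p"

lemma child_ofD: "child_of p q \<Longrightarrow> p \<in> W \<and> q \<in> W \<and> depth q = Suc (depth p)"
  using par unfolding child_of_def by blast

text \<open>Walks follow arrows only: going back along x \<rightarrow> y is replaced by the arrow y
  \<rightarrow> \<tau>^-1 x. Every tree edge thus points away from the root and carries the label of
  its arrow, and returning to \<tau>^-1 of the last but one vertex is the backtracking that
  \<open>reduced\<close> forbids.\<close>

definition "T = \<lparr>vverts = W, vd = \<lambda>p q.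
  if child_of p q then al (lab p) (lab q) else if child_of q p then bl (lab q) (lab p) else 0\<rparr>"

definition "A = {(p, q). child_of p q}"

lemma T_simps: "vverts T = W"
  "child_of p q \<Longrightarrow> vd T p q = al (lab p) (lab q)" "child_of p q \<Longrightarrow> vd T q p = bl (lab p) (lab q)"
  using child_ofD[of p q] child_ofD[of q p] by (auto simp: T_def)

lemma child_al: "child_of p q \<Longrightarrow> al (lab p) (lab q) \<noteq> 0" "child_of p q \<Longrightarrow> bl (lab p) (lab q) \<noteq> 0"
proof -
  assume c: "child_of p q"
  then show "al (lab p) (lab q) \<noteq> 0" using lab unfolding child_of_def by blast
  then show "bl (lab p) (lab q) \<noteq> 0" using al_bl[of "lab p" "lab q"] lab_in[of p] lab_in[of q] child_ofD[OF c] by simp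
qed

lemma vadj_T: "(p, q) \<in> vadj T \<longleftrightarrow> child_of p q \<or> child_of q p"
  using child_al by (auto simp: vadj_def T_def)

lemma orientation_A: "orientation T A"
proof -
  have "child_of p q \<Longrightarrow> \<not> child_of q p" for p q using child_ofD[of p q] child_ofD[of q p] by auto
  then show ?thesis unfolding orientation_def A_def using vadj_T by auto
qed

text \<open>A vertex of maximal depth on a cycle would have both of its neighbours on the cycle
  equal to its parent, contradicting distinctness.\<close>

lemma valued_tree_T: "valued_tree T"
  unfolding valued_tree_def T_simps(1)
proof (intro conjI ballI)
  show "W \<noteq> {}" using root by blast
  show "vadj T \<subseteq> W \<times> W" using vadj_T child_ofD by auto
  show s: "sym (vadj T)" using vadj_T by (auto simp: sym_def)
  show "irrefl (vadj T)" using vadj_T child_ofD by (fastforce simp: irrefl_def)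
  have *: "(root, p) \<in> (vadj T)\<^sup>*" if "p \<in> W" for p
    using that
  proof (induct rule: W_induct)
    case (child q)
    then have "(par q, q) \<in> vadj T" using vadj_T by (simp add: child_of_def)
    with child(3) show ?case by (rule rtrancl_into_rtrancl)
  qed simp
  show "(x, y) \<in> (vadj T)\<^sup>*" if "x \<in> W" "y \<in> W" for x y
    using *[OF that(1)] *[OF that(2)] s by (meson rtrancl_trans symD sym_rtrancl)
  show "\<not> (\<exists>p. length p \<ge> 3 \<and> distinct p \<and>
        (\<forall>i. Suc i < length p \<longrightarrow> (p ! i, p ! Suc i) \<in> vadj T) \<and> (last p, hd p) \<in> vadj T)"
  proof
  assume "\<exists>p. length p \<ge> 3 \<and> distinct p \<and>
        (\<forall>i. Suc i < length p \<longrightarrow> (p ! i, p ! Suc i) \<in> vadj T) \<and> (last p, hd p) \<in> vadj T"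
  then obtain p where p: "length p \<ge> 3" "distinct p"
    "\<And>i. Suc i < length p \<Longrightarrow> (p ! i, p ! Suc i) \<in> vadj T" "(last p, hd p) \<in> vadj T" by blast
  let ?n = "length p"
  have cyc: "(p ! i, p ! (Suc i mod ?n)) \<in> vadj T" if "i < ?n" for i
  proof (cases "Suc i < ?n")
    case False
    then have i: "i = ?n - 1" "Suc i = ?n" using that by auto
    have "p \<noteq> []" using p(1) by auto
    then have "last p = p ! i" "hd p = p ! (Suc i mod ?n)" using i by (simp_all add: last_conv_nth hd_conv_nth)
    then show ?thesis using p(4) by simp
  qed (use p(3) in simp)
  obtain i where i: "i < ?n" "\<And>j. j < ?n \<Longrightarrow> depth (p ! j) \<le> depth (p ! i)"
  proof -
    have "finite {..<?n}" "{..<?n} \<noteq> {}" using p(1) by (auto simp: lessThan_empty_iff)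
    from finite_imageI[OF this(1), of "\<lambda>i. depth (p ! i)"] this(2)
    have "Max ((\<lambda>i. depth (p ! i)) ` {..<?n}) \<in> (\<lambda>i. depth (p ! i)) ` {..<?n}" by (intro Max_in) auto
    then obtain i where "i < ?n" "depth (p ! i) = Max ((\<lambda>i. depth (p ! i)) ` {..<?n})" by auto
    then show thesis using that[of i] by simp
  qed
  have up: "q = par (p ! i)" if "(q, p ! i) \<in> vadj T \<or> (p ! i, q) \<in> vadj T" "depth q \<le> depth (p ! i)" for q
    using that vadj_T child_ofD[of "p ! i" q] by (auto simp: child_of_def)
  define k where "k = (if i = 0 then ?n - 1 else i - 1)"
  have k: "k < ?n" "Suc k mod ?n = i" using i p(1) by (auto simp: k_def)
  define j where "j = Suc i mod ?n"
  have j: "j < ?n" unfolding j_def using i by (intro mod_less_divisor) auto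
  have "j \<noteq> k" unfolding j_def k_def using i p(1) by (cases "Suc i = ?n") auto
  moreover have "p ! j = par (p ! i)" using up[of "p ! j"] cyc[OF i(1)] i(2)[OF j] j_def by simp
  moreover have "p ! k = par (p ! i)" using up[of "p ! k"] cyc[OF k(1)] i(2)[OF k(1)] k(2) by simp
  ultimately have "j \<noteq> k" "p ! j = p ! k" by simp_all
  then show False using p(2) j k(1) by (simp add: nth_eq_iff_index_eq)
  qed
qed

abbreviation "Z \<equiv> Z_quiver T A"
definition "V = (UNIV :: int set) \<times> W"
definition "R = qarr Z"
definition sh :: "int \<Rightarrow> int \<times> 'w \<Rightarrow> int \<times> 'w" where "sh k v = (fst v + k, snd v)"
text \<open>The translation lowers the level by 1 and must become \<open>tau\<close>, whence the
  negative exponent.\<close>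

definition "pr v = tp (- fst v) (lab (snd v))"

lemma R_iff: "((n, p), (m, q)) \<in> R \<longleftrightarrow> m = n \<and> child_of p q \<or> m = n + 1 \<and> child_of q p"
  by (auto simp: R_def Z_quiver_simps A_def)

lemma R_V: "(s, t) \<in> R \<Longrightarrow> s \<in> V \<and> t \<in> V"
  using child_ofD by (cases s, cases t) (auto simp: R_iff V_def)

lemma pr_in: "v \<in> V \<Longrightarrow> pr v \<in> \<Gamma>"
  by (auto simp: V_def pr_def intro!: tp_in lab_in)

lemma sh_V [simp]: "sh k v \<in> V \<longleftrightarrow> v \<in> V" by (cases v) (simp add: V_def sh_def)
lemma sh_sh [simp]: "sh k (sh l v) = sh (k + l) v" by (simp add: sh_def)
lemma sh_0 [simp]: "sh 0 v = v" by (simp add: sh_def)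

lemma pr_sh: "v \<in> V \<Longrightarrow> pr (sh k v) = tp (- k) (pr v)"
proof -
  assume v: "v \<in> V"
  obtain n p where np: "v = (n, p)" "p \<in> W" using v by (auto simp: V_def)
  have e: "- (n + k) = - k + - n" by simp
  show ?thesis unfolding np(1) pr_def sh_def fst_conv snd_conv e tp_tp[OF lab_in[OF np(2)]] ..
qed

lemma R_sh [simp]: "(sh k s, sh k t) \<in> R \<longleftrightarrow> (s, t) \<in> R"
  by (cases s, cases t) (auto simp: R_iff sh_def)

text \<open>As \<open>sh 1\<close> is the inverse translation of Z, this is the mesh property; it
  reduces questions on predecessors to questions on successors.\<close>

lemma R_tau: "(s, sh 1 t) \<in> R \<longleftrightarrow> (t, s) \<in> R"
  by (cases s, cases t) (auto simp: R_iff sh_def)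

lemma R_lab:
  assumes "(s, t) \<in> R"
  shows "vd T (snd s) (snd t) = al (pr s) (pr t)" "vd T (snd t) (snd s) = bl (pr s) (pr t)" "(pr s, pr t) \<in> E"
proof -
  obtain n p m q where st: "s = (n, p)" "t = (m, q)" by (cases s, cases t)
  consider "m = n" "child_of p q" | "m = n + 1" "child_of q p" using assms st R_iff by blast
  then have "vd T p q = al (pr s) (pr t) \<and> vd T q p = bl (pr s) (pr t) \<and> al (pr s) (pr t) \<noteq> 0"
  proof cases
    case 1
    then have "lab p \<in> \<Gamma>" "lab q \<in> \<Gamma>" using child_ofD lab_in by blast+
    then show ?thesis using 1 st T_simps(2,3)[OF 1(2)] child_al(1)[OF 1(2)] by (simp add: pr_def tp_al)
  next
    case 2
    then have l: "lab p \<in> \<Gamma>" "lab q \<in> \<Gamma>" using child_ofD lab_in by blast+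
    have "tau (tp (- (n + 1)) (lab q)) = tp (- n) (lab q)" using tp_Suc[OF l(2), of "- (n + 1)"] by simp
    then have "bl (tp (- n) (lab p)) (tp (- (n + 1)) (lab q)) = al (lab q) (lab p)"
      "al (tp (- n) (lab p)) (tp (- (n + 1)) (lab q)) = bl (lab q) (lab p)"
      using al_tau[OF tp_in[OF l(1), of "- n"] tp_in[OF l(2), of "- (n + 1)"]]
        bl_tau[OF tp_in[OF l(1), of "- n"] tp_in[OF l(2), of "- (n + 1)"]] l by (simp_all add: tp_al)
    then show ?thesis using 2 st T_simps(2,3)[OF 2(2)] child_al[OF 2(2)] by (simp add: pr_def)
  qed
  then show "vd T (snd s) (snd t) = al (pr s) (pr t)" "vd T (snd t) (snd s) = bl (pr s) (pr t)" "(pr s, pr t) \<in> E"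
    using st R_V[OF assms] pr_in by (auto simp: E_iff)
qed

text \<open>The successors of (n, p) are the (n, q) for children q and, off the root, (n + 1, par
  p). Children with equal images coincide by \<open>child_unique\<close>; a child and the parent
  with equal images would be a backtracking step.\<close>

lemma succ_inj:
  assumes "(s, t) \<in> R" "(s, t') \<in> R" "pr t = pr t'"
  shows "t = t'"
proof -
  obtain n p where s: "s = (n, p)" by (cases s)
  have clash: False if c: "child_of p q" "child_of r p" and e: "pr (n, q) = pr (n + 1, r)" for q r
  proof -
    have l: "lab q \<in> \<Gamma>" "lab r \<in> \<Gamma>" using c child_ofD lab_in by blast+
    have "tp (- n) (tau (lab q)) = tau (tp (- n) (lab q))"
      using tp_tp[OF l(1), of "- n" 1] tp_Suc[OF l(1), of "- n"] tp_1[OF l(1)] by simp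
    also have "\<dots> = tau (tp (- (n + 1)) (lab r))" using e by (simp add: pr_def)
    also have "\<dots> = tp (- n) (lab r)" using tp_Suc[OF l(2), of "- (n + 1)"] by simp
    finally have "tau (lab q) = lab r" using tp_inj tau_in l by blast
    then show False using reduced[of q] c unfolding child_of_def by metis
  qed
  have same: "q = q'" if c: "child_of p q" "child_of p q'" and e: "pr (n, q) = pr (n, q')" for q q'
  proof -
    have "lab q = lab q'" using e tp_inj lab_in child_ofD[OF c(1)] child_ofD[OF c(2)] by (auto simp: pr_def)
    then show ?thesis using child_unique c unfolding child_of_def by metis
  qed
  have same': "q = q'" if c: "child_of q p" "child_of q' p" for q q' using c by (simp add: child_of_def)
  obtain m q m' q' where t: "t = (m, q)" "t' = (m', q')" by (cases t, cases t')
  show ?thesis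
    using assms clash[of q q'] clash[of q' q] same[of q q'] same'[of q q'] unfolding s t R_iff by metis
qed

text \<open>The arrow is lifted by appending a step to the walk, unless this would backtrack; in
  that case the parent, one level up, lies over y.\<close>

lemma succ_ex:
  assumes s: "s \<in> V" and y: "(pr s, y) \<in> E"
  shows "\<exists>t. (s, t) \<in> R \<and> pr t = y"
proof -
  obtain n p where sp: "s = (n, p)" "p \<in> W" using s by (cases s) (auto simp: V_def)
  define z where "z = tp n y"
  have yG: "y \<in> \<Gamma>" using y E_iff by blast
  have zG: "z \<in> \<Gamma>" and yz: "tp (- n) z = y" using yG tp_in tp_tp[of y "- n" n] by (auto simp: z_def)
  have az: "al (lab p) z \<noteq> 0"
  proof -
    have "al (lab p) z = al (tp (- n) (lab p)) (tp (- n) z)" using tp_al(1) lab_in sp(2) zG by simp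
    then show ?thesis using y yz sp(1) by (simp add: E_iff pr_def)
  qed
  show ?thesis
  proof (cases "p \<noteq> root \<and> tau z = lab (par p)")
    case True
    then have c: "child_of (par p) p" using sp(2) by (simp add: child_of_def)
    have "tp (- (n + 1)) (lab (par p)) = tp (- (n + 1)) (tp 1 z)" using True tp_1[OF zG] by simp
    also have "\<dots> = y" using tp_tp[OF zG, of "- (n + 1)" 1] yz by simp
    finally show ?thesis using c sp(1) by (intro exI[of _ "(n + 1, par p)"]) (simp add: R_iff pr_def)
  next
    case False
    then obtain q where "q \<in> W" "q \<noteq> root" "par q = p" "lab q = z" using child[OF sp(2) zG az] by blast
    then show ?thesis using sp(1) yz by (intro exI[of _ "(n, q)"]) (simp add: R_iff pr_def child_of_def)
  qed
qed

lemma pred_inj: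
  assumes "(t, s) \<in> R" "(t', s) \<in> R" "pr t = pr t'"
  shows "t = t'"
proof -
  have V: "t \<in> V" "t' \<in> V" using assms R_V by blast+
  have "sh 1 t = sh 1 t'"
    using succ_inj[of s "sh 1 t" "sh 1 t'"] assms R_tau pr_sh V by simp
  then have "sh (- 1) (sh 1 t) = sh (- 1) (sh 1 t')" by simp
  then show ?thesis by simp
qed

lemma pred_ex:
  assumes s: "s \<in> V" and y: "(y, pr s) \<in> E"
  shows "\<exists>t. (t, s) \<in> R \<and> pr t = y"
proof -
  have yG: "y \<in> \<Gamma>" using y E_iff by blast
  have y': "tau (tp (- 1) y) = y" using tp_Suc[OF yG, of "- 1"] by simp
  have "(pr s, tp (- 1) y) \<in> E" using E_tau[of "pr s" "tp (- 1) y"] y y' tp_in[OF yG] pr_in[OF s] by simp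
  then obtain t where t: "(s, t) \<in> R" "pr t = tp (- 1) y" using succ_ex[OF s] by blast
  have tV: "t \<in> V" using t R_V by blast
  have "(sh (- 1) t, s) \<in> R" using R_tau[of s "sh (- 1) t"] t(1) by simp
  moreover have "pr (sh (- 1) t) = y" using pr_sh[OF tV, of "- 1"] t(2) tp_1[OF tp_in[OF yG]] y' by simp
  ultimately show ?thesis by blast
qed

lemma pr_surj: "pr ` V = \<Gamma>"
proof
  show "pr ` V \<subseteq> \<Gamma>" using pr_in by blast
  have "x0 = pr (0, root)" using root by (simp add: pr_def)
  then have x0V: "x0 \<in> pr ` V" using root by (auto simp: V_def)
  show "\<Gamma> \<subseteq> pr ` V"
  proof
    fix y assume "y \<in> \<Gamma>"
    then have "(x0, y) \<in> (E \<union> E\<inverse>)\<^sup>*" using connected[OF x0] unfolding E_def by blast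
    then show "y \<in> pr ` V"
    proof (induct rule: rtrancl_induct)
      case (step y z)
      then obtain s where s: "s \<in> V" "y = pr s" by blast
      have "\<exists>t. t \<in> V \<and> pr t = z"
        using step(2) succ_ex[OF s(1), of z] pred_ex[OF s(1), of z] s(2) R_V by blast
      then show ?case by blast
    qed (rule x0V)
  qed
qed

lemma Z_lab: "(s, t, a, b) \<in> qlab Z \<longleftrightarrow> (s, t) \<in> R \<and> a = al (pr s) (pr t) \<and> b = bl (pr s) (pr t)"
proof -
  obtain n p m q where st: "s = (n, p)" "t = (m, q)" by (cases s, cases t)
  have "(s, t, a, b) \<in> qlab Z \<longleftrightarrow> (s, t) \<in> R \<and> a = vd T p q \<and> b = vd T q p"
    unfolding st R_def by (rule Z_quiver_simps(3))
  then show ?thesis using R_lab[of s t] st by auto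
qed

lemma Z_tau: "(s, t) \<in> qtau Z \<longleftrightarrow> s \<in> V \<and> t = sh (- 1) s"
  by (cases s, cases t) (auto simp: Z_quiver_simps V_def sh_def T_simps)

lemma Z_verts: "qverts Z = V"
  by (simp add: Z_quiver_simps V_def T_simps)

text \<open>Stated for every f that agrees with \<open>pr\<close> on the vertices, because the map
  tested in \<open>tree_class\<close> passes through orbits and is controlled only there.\<close>

lemma covering:
  assumes f: "\<And>v. v \<in> V \<Longrightarrow> f v = pr v"
  shows "quiver_covering Z Q f"
  unfolding quiver_covering_def Z_verts
proof (intro conjI allI impI ballI)
  show "f ` V = qverts Q" using f pr_surj by (simp cong: image_cong)
  show "(f x, f y) \<in> qarr Q" if "(x, y) \<in> qarr Z" for x y
    using that R_lab(3)[of x y] R_V[of x y] f unfolding R_def by simp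
  show "(f x, f y) \<in> qtau Q" if "(x, y) \<in> qtau Z" for x y
    using that f pr_sh[of x "- 1"] tp_1 pr_in unfolding Z_tau by simp
  show "(f x, f y, a, b) \<in> qlab Q" if "(x, y, a, b) \<in> qlab Z" for x y a b
    using that f R_lab(3)[of x y] R_V[of x y] unfolding Z_lab by simp
  fix s assume s: "s \<in> V"
  show "bij_betw f {y. (s, y) \<in> qarr Z} {y. (f s, y) \<in> qarr Q}"
    unfolding R_def[symmetric] Q_simps f[OF s]
  proof (rule bij_betwI')
    show "f x = f y \<longleftrightarrow> x = y" if "x \<in> {y. (s, y) \<in> R}" "y \<in> {y. (s, y) \<in> R}" for x y
      using that succ_inj[of s x y] f R_V by auto
    show "f x \<in> {y. (pr s, y) \<in> E}" if "x \<in> {y. (s, y) \<in> R}" for x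
      using that R_lab(3) f R_V by auto
    show "\<exists>x\<in>{y. (s, y) \<in> R}. y = f x" if "y \<in> {y. (pr s, y) \<in> E}" for y
    proof -
      obtain t where t: "(s, t) \<in> R" "pr t = y" using succ_ex[OF s, of y] \<open>y \<in> {y. (pr s, y) \<in> E}\<close> by blast
      then have "f t = y" using f R_V by blast
      then show ?thesis using t by blast
    qed
  qed
  show "bij_betw f {y. (y, s) \<in> qarr Z} {y. (y, f s) \<in> qarr Q}"
    unfolding R_def[symmetric] Q_simps f[OF s]
  proof (rule bij_betwI')
    show "f x = f y \<longleftrightarrow> x = y" if "x \<in> {y. (y, s) \<in> R}" "y \<in> {y. (y, s) \<in> R}" for x y
      using that pred_inj[of x s y] f R_V by auto
    show "f x \<in> {y. (y, pr s) \<in> E}" if "x \<in> {y. (y, s) \<in> R}" for x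
      using that R_lab(3) f R_V by auto
    show "\<exists>x\<in>{y. (y, s) \<in> R}. y = f x" if "y \<in> {y. (y, pr s) \<in> E}" for y
    proof -
      obtain t where t: "(t, s) \<in> R" "pr t = y" using pred_ex[OF s, of y] \<open>y \<in> {y. (y, pr s) \<in> E}\<close> by blast
      then have "f t = y" using f R_V by blast
      then show ?thesis using t by blast
    qed
  qed
qed

end

section \<open>Quiver isomorphisms and orbit quivers\<close>

lemma quiver_iso_inv:
  assumes "quiver_iso Q R \<phi>"
  shows "quiver_iso R Q (inv_into (qverts Q) \<phi>)"
proof -
  let ?i = "inv_into (qverts Q) \<phi>"
  have b: "bij_betw \<phi> (qverts Q) (qverts R)" using assms by (simp add: quiver_iso_def)
  have i: "?i y \<in> qverts Q" "\<phi> (?i y) = y" if "y \<in> qverts R" for y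
    using b that bij_betw_inv_into_right[OF b that] by (auto simp: bij_betw_def inv_into_into)
  show ?thesis
    unfolding quiver_iso_def
  proof (intro conjI ballI allI)
    show "bij_betw ?i (qverts R) (qverts Q)" using bij_betw_inv_into[OF b] .
    fix x y assume xy: "x \<in> qverts R" "y \<in> qverts R"
    note * = assms[unfolded quiver_iso_def, THEN conjunct2, rule_format, OF i(1)[OF xy(1)] i(1)[OF xy(2)], unfolded i(2)[OF xy(1)] i(2)[OF xy(2)]]
    show "(x, y) \<in> qarr R \<longleftrightarrow> (?i x, ?i y) \<in> qarr Q" "(x, y) \<in> qtau R \<longleftrightarrow> (?i x, ?i y) \<in> qtau Q"
      "(x, y, a, b) \<in> qlab R \<longleftrightarrow> (?i x, ?i y, a, b) \<in> qlab Q" for a b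
      using * by blast+
  qed
qed

lemma quiver_iso_comp:
  assumes "quiver_iso Q R f" "quiver_iso R S g"
  shows "quiver_iso Q S (\<lambda>x. g (f x))"
proof -
  have b: "bij_betw f (qverts Q) (qverts R)" "bij_betw g (qverts R) (qverts S)" using assms by (auto simp: quiver_iso_def)
  have f: "f x \<in> qverts R" if "x \<in> qverts Q" for x using b(1) that bij_betwE by blast
  have "bij_betw (\<lambda>x. g (f x)) (qverts Q) (qverts S)" using bij_betw_trans[OF b] by (simp add: comp_def)
  then show ?thesis using assms f unfolding quiver_iso_def by simp
qed

lemma quiver_iso_cong:
  assumes "quiver_iso Q R f" "\<And>x. x \<in> qverts Q \<Longrightarrow> g x = f x"
  shows "quiver_iso Q R g"
  using assms bij_betw_cong[of "qverts Q" g f "qverts R"] unfolding quiver_iso_def by simp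

lemma quiver_iso_id: "quiver_iso Q Q (\<lambda>x. x)"
  unfolding quiver_iso_def using bij_betw_id[of "qverts Q"] by (simp add: id_def)

text \<open>The automorphisms of \<open>Z\<close> over \<open>p\<close> form a group; if it acts transitively on the fibres of \<open>p\<close>,
  its orbits are exactly these fibres.\<close>

definition deck_group :: "'v quiver \<Rightarrow> ('v \<Rightarrow> 'w) \<Rightarrow> ('v \<Rightarrow> 'v) set"
  where "deck_group Z p = {g \<in> Bij (qverts Z). quiver_iso Z Z g \<and> (\<forall>v\<in>qverts Z. p (g v) = p v)}"

lemma automorphism_group_deck: "automorphism_group Z (deck_group Z p)"
proof -
  let ?V = "qverts Z" and ?G = "deck_group Z p"
  interpret B: group "BijGroup ?V" by (rule group_BijGroup)
  have car: "carrier (BijGroup ?V) = Bij ?V" by (simp add: BijGroup_def)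
  have one: "\<one>\<^bsub>BijGroup ?V\<^esub> = (\<lambda>x\<in>?V. x)" by (simp add: BijGroup_def)
  have mult: "g \<otimes>\<^bsub>BijGroup ?V\<^esub> f = compose ?V g f" if "g \<in> Bij ?V" "f \<in> Bij ?V" for g f
    using that by (simp add: BijGroup_def)
  have mem: "g v \<in> ?V" if "g \<in> Bij ?V" "v \<in> ?V" for g v
    using that by (auto simp: Bij_def bij_betw_def)
  have "subgroup ?G (BijGroup ?V)"
  proof (rule B.subgroupI)
    show "?G \<subseteq> carrier (BijGroup ?V)" by (auto simp: deck_group_def car)
    have "(\<lambda>x\<in>?V. x) \<in> ?G"
      using B.one_closed quiver_iso_cong[OF quiver_iso_id, of Z "\<lambda>x\<in>?V. x"]
      by (auto simp: deck_group_def car one)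
    then show "?G \<noteq> {}" by blast
  next
    fix g assume g: "g \<in> ?G"
    then have gB: "g \<in> Bij ?V" and gi: "quiver_iso Z Z g" and gp: "\<And>v. v \<in> ?V \<Longrightarrow> p (g v) = p v"
      by (auto simp: deck_group_def)
    have i: "inv\<^bsub>BijGroup ?V\<^esub> g = (\<lambda>x\<in>?V. inv_into ?V g x)" using inv_BijGroup[OF gB] .
    have b: "bij_betw g ?V ?V" using gB by (simp add: Bij_def)
    have "p (inv_into ?V g v) = p v" if "v \<in> ?V" for v
      using gp[of "inv_into ?V g v"] bij_betw_inv_into_right[OF b that] bij_betwE[OF bij_betw_inv_into[OF b]] that by auto
    moreover have "quiver_iso Z Z (\<lambda>x\<in>?V. inv_into ?V g x)"
      using quiver_iso_cong[OF quiver_iso_inv[OF gi]] by simp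
    moreover have "inv\<^bsub>BijGroup ?V\<^esub> g \<in> Bij ?V" using B.inv_closed gB car by simp
    ultimately show "inv\<^bsub>BijGroup ?V\<^esub> g \<in> ?G" unfolding i by (simp add: deck_group_def)
    fix h assume h: "h \<in> ?G"
    then have hB: "h \<in> Bij ?V" and hi: "quiver_iso Z Z h" and hp: "\<And>v. v \<in> ?V \<Longrightarrow> p (h v) = p v"
      by (auto simp: deck_group_def)
    have "quiver_iso Z Z (compose ?V g h)"
      using quiver_iso_cong[OF quiver_iso_comp[OF hi gi]] by (simp add: compose_def)
    moreover have "compose ?V g h \<in> Bij ?V" using B.m_closed[of g h] gB hB mult car by simp
    ultimately show "g \<otimes>\<^bsub>BijGroup ?V\<^esub> h \<in> ?G"
      unfolding mult[OF gB hB] using gp hp mem[OF hB] by (simp add: deck_group_def compose_def)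
  qed
  then show ?thesis by (auto simp: automorphism_group_def deck_group_def)
qed

text \<open>Under \<open>trans\<close> the orbits are the fibres of p, hence correspond to the
  vertices of Q. An arrow of Q is lifted at the chosen v by bijectivity on successors; the end of
  the lift may differ from the chosen w, but it lies in the same orbit.\<close>

lemma tree_classI:
  fixes T :: "'v valued_graph" and A and Q :: "'w quiver" and p
  defines "Z \<equiv> Z_quiver T A"
  assumes T: "valued_tree T" and A: "orientation T A"
    and cov: "\<And>f. (\<And>v. v \<in> qverts Z \<Longrightarrow> f v = p v) \<Longrightarrow> quiver_covering Z Q f"
    and lab: "\<And>s t a b. \<lbrakk>(s, t) \<in> qarr Z; (p s, p t, a, b) \<in> qlab Q\<rbrakk> \<Longrightarrow> (s, t, a, b) \<in> qlab Z"
    and wf: "\<And>x y. (x, y) \<in> qarr Q \<Longrightarrow> x \<in> qverts Q \<and> y \<in> qverts Q"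
      "\<And>x y a b. (x, y, a, b) \<in> qlab Q \<Longrightarrow> (x, y) \<in> qarr Q"
      "\<And>s t. (s, t) \<in> qarr Z \<Longrightarrow> s \<in> qverts Z \<and> t \<in> qverts Z"
      "\<And>s t. (s, t) \<in> qtau Z \<Longrightarrow> s \<in> qverts Z \<and> t \<in> qverts Z"
      "\<And>s t a b. (s, t, a, b) \<in> qlab Z \<Longrightarrow> (s, t) \<in> qarr Z"
    and tau: "\<And>s y. \<lbrakk>s \<in> qverts Z; (p s, y) \<in> qtau Q\<rbrakk> \<Longrightarrow> \<exists>t. (s, t) \<in> qtau Z \<and> p t = y"
    and trans: "\<And>v v'. \<lbrakk>v \<in> qverts Z; v' \<in> qverts Z; p v = p v'\<rbrakk> \<Longrightarrow> \<exists>g\<in>deck_group Z p. g v = v'"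
  shows "tree_class Q T"
proof -
  let ?V = "qverts Z"
  define G where "G = deck_group Z p"
  have c: "quiver_covering Z Q p" using cov by blast
  have pV: "p ` ?V = qverts Q" using c by (simp add: quiver_covering_def)
  have cD: "(s, t) \<in> qarr Z \<Longrightarrow> (p s, p t) \<in> qarr Q" "(s, t) \<in> qtau Z \<Longrightarrow> (p s, p t) \<in> qtau Q"
    "(s, t, a, b) \<in> qlab Z \<Longrightarrow> (p s, p t, a, b) \<in> qlab Q" for s t a b
    using c unfolding quiver_covering_def by blast+
  have orb: "orbit_of G v = {v' \<in> ?V. p v' = p v}" if v: "v \<in> ?V" for v
  proof -
    have "g v \<in> ?V \<and> p (g v) = p v" if "g \<in> G" for g
      using that v by (auto simp: G_def deck_group_def Bij_def bij_betw_def)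
    moreover have "v' \<in> orbit_of G v" if "v' \<in> ?V" "p v' = p v" for v'
      using trans[OF v that(1)] that(2) unfolding G_def orbit_of_def by auto
    ultimately show ?thesis unfolding orbit_of_def by auto
  qed
  have oI: "(s, t) \<in> qarr Z \<Longrightarrow> (orbit_of G s, orbit_of G t) \<in> qarr (orbit_quiver Z G)"
    "(s, t) \<in> qtau Z \<Longrightarrow> (orbit_of G s, orbit_of G t) \<in> qtau (orbit_quiver Z G)"
    "(s, t, a, b) \<in> qlab Z \<Longrightarrow> (orbit_of G s, orbit_of G t, a, b) \<in> qlab (orbit_quiver Z G)" for s t a b
    unfolding orbit_quiver_def quiver.simps by blast+
  \<comment> \<open>The choice of a representative is harmless because p is constant on
    orbits.\<close>
  define \<phi> where "\<phi> O1 = p (SOME v. v \<in> O1)" for O1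
  have phi: "\<phi> (orbit_of G v) = p v" if v: "v \<in> ?V" for v
  proof -
    have "\<exists>v'. v' \<in> orbit_of G v" using orb[OF v] v by blast
    then have "(SOME v'. v' \<in> orbit_of G v) \<in> orbit_of G v" by (rule someI_ex)
    then show ?thesis unfolding \<phi>_def using orb[OF v] by simp
  qed
  have orb_eq: "orbit_of G v = orbit_of G v' \<longleftrightarrow> p v = p v'" if "v \<in> ?V" "v' \<in> ?V" for v v'
    using orb that phi by metis
  have "quiver_iso (orbit_quiver Z G) Q \<phi>"
    unfolding quiver_iso_def
  proof (intro conjI ballI allI)
    show "bij_betw \<phi> (qverts (orbit_quiver Z G)) (qverts Q)"
      unfolding bij_betw_def
    proof
      show "inj_on \<phi> (qverts (orbit_quiver Z G))"
      proof (rule inj_onI)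
        fix x y assume "x \<in> qverts (orbit_quiver Z G)" "y \<in> qverts (orbit_quiver Z G)" "\<phi> x = \<phi> y"
        then obtain v w where "v \<in> ?V" "x = orbit_of G v" "w \<in> ?V" "y = orbit_of G w" "p v = p w"
          using phi by (auto simp: orbit_quiver_def)
        then show "x = y" using orb_eq[of v w] by simp
      qed
      show "\<phi> ` qverts (orbit_quiver Z G) = qverts Q"
        using phi pV by (simp add: orbit_quiver_def image_image cong: image_cong)
    qed
    fix x y assume xy: "x \<in> qverts (orbit_quiver Z G)" "y \<in> qverts (orbit_quiver Z G)"
    then obtain v w where v: "v \<in> ?V" "x = orbit_of G v" and w: "w \<in> ?V" "y = orbit_of G w"
      by (auto simp: orbit_quiver_def)
    have arr: "\<exists>t. (v, t) \<in> qarr Z \<and> t \<in> ?V \<and> orbit_of G t = y" if "(p v, p w) \<in> qarr Q"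
    proof -
      have "bij_betw p {t. (v, t) \<in> qarr Z} {y. (p v, y) \<in> qarr Q}"
        using c v(1) unfolding quiver_covering_def by simp
      then have "p w \<in> p ` {t. (v, t) \<in> qarr Z}" using \<open>(p v, p w) \<in> qarr Q\<close> by (simp add: bij_betw_def)
      then obtain t where t: "(v, t) \<in> qarr Z" "p w = p t" by blast
      have tV: "t \<in> ?V" using wf(3)[OF t(1)] by (rule conjunct2)
      then have "orbit_of G t = y" using t(2) orb_eq[OF _ w(1), of t] w(2) by simp
      then show ?thesis using t(1) tV by blast
    qed
    show "(x, y) \<in> qarr (orbit_quiver Z G) \<longleftrightarrow> (\<phi> x, \<phi> y) \<in> qarr Q"
    proof
      assume "(x, y) \<in> qarr (orbit_quiver Z G)"
      then obtain s t where st: "(s, t) \<in> qarr Z" "x = orbit_of G s" "y = orbit_of G t" by (auto simp: orbit_quiver_def)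
      then show "(\<phi> x, \<phi> y) \<in> qarr Q" using cD(1)[OF st(1)] wf(3)[OF st(1)] phi by simp
    next
      assume "(\<phi> x, \<phi> y) \<in> qarr Q"
      then obtain t where "(v, t) \<in> qarr Z" "orbit_of G t = y" using arr phi v w by auto
      then show "(x, y) \<in> qarr (orbit_quiver Z G)" using v(2) oI(1) by blast
    qed
    show "(x, y) \<in> qtau (orbit_quiver Z G) \<longleftrightarrow> (\<phi> x, \<phi> y) \<in> qtau Q"
    proof
      assume "(x, y) \<in> qtau (orbit_quiver Z G)"
      then obtain s t where st: "(s, t) \<in> qtau Z" "x = orbit_of G s" "y = orbit_of G t" by (auto simp: orbit_quiver_def)
      then show "(\<phi> x, \<phi> y) \<in> qtau Q" using cD(2)[OF st(1)] wf(4)[OF st(1)] phi by simp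
    next
      assume "(\<phi> x, \<phi> y) \<in> qtau Q"
      then have "(p v, p w) \<in> qtau Q" using phi[OF v(1)] phi[OF w(1)] v(2) w(2) by simp
      then obtain t where t: "(v, t) \<in> qtau Z" "p t = p w" using tau[OF v(1)] by blast
      have "t \<in> ?V" using wf(4)[OF t(1)] by (rule conjunct2)
      then have "orbit_of G t = y" using orb_eq[OF _ w(1)] t(2) w(2) by simp
      then show "(x, y) \<in> qtau (orbit_quiver Z G)" using v(2) oI(2) t(1) by blast
    qed
    fix a b
    show "(x, y, a, b) \<in> qlab (orbit_quiver Z G) \<longleftrightarrow> (\<phi> x, \<phi> y, a, b) \<in> qlab Q"
    proof
      assume "(x, y, a, b) \<in> qlab (orbit_quiver Z G)"
      then obtain s t where st: "(s, t, a, b) \<in> qlab Z" "x = orbit_of G s" "y = orbit_of G t" by (auto simp: orbit_quiver_def)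
      then show "(\<phi> x, \<phi> y, a, b) \<in> qlab Q"
        using cD(3)[OF st(1)] wf(3)[OF wf(5)[OF st(1)]] phi by simp
    next
      assume l: "(\<phi> x, \<phi> y, a, b) \<in> qlab Q"
      then obtain t where t: "(v, t) \<in> qarr Z" "t \<in> ?V" "orbit_of G t = y"
        using arr wf(2)[OF l] phi v w by auto
      have "(p v, p t, a, b) \<in> qlab Q" using l t phi[OF v(1)] phi[OF t(2)] v(2) by simp
      then have "(v, t, a, b) \<in> qlab Z" using lab t(1) by blast
      then show "(x, y, a, b) \<in> qlab (orbit_quiver Z G)" using v(2) oI(3) t(3) by blast
    qed
  qed
  moreover have "quiver_covering Z Q (\<phi> \<circ> orbit_of G)" using phi by (intro cov) simp
  ultimately show ?thesis
    unfolding tree_class_def using T A automorphism_group_deck[of Z p] unfolding G_def Z_def by blast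
qed

section \<open>Lifting morphisms and transitivity of the deck group\<close>

context walk_tree
begin

text \<open>Endomorphisms of Z over \<Gamma> commuting with the translation. Bijectivity is left out
  because lifting constructs only such maps; \<open>mor_invertible\<close> derives it.\<close>

definition "mor f \<longleftrightarrow> (\<forall>v\<in>V. f v \<in> V \<and> pr (f v) = pr v) \<and> (\<forall>s t. (s, t) \<in> R \<longrightarrow> (f s, f t) \<in> R) \<and>
  (\<forall>v\<in>V. \<forall>k. f (sh k v) = sh k (f v))"

lemma morD: "mor f \<Longrightarrow> v \<in> V \<Longrightarrow> f v \<in> V" "mor f \<Longrightarrow> v \<in> V \<Longrightarrow> pr (f v) = pr v"
  "mor f \<Longrightarrow> (s, t) \<in> R \<Longrightarrow> (f s, f t) \<in> R" "mor f \<Longrightarrow> v \<in> V \<Longrightarrow> f (sh k v) = sh k (f v)"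
  unfolding mor_def by blast+

lemma mor_comp: "\<lbrakk>mor f; mor g\<rbrakk> \<Longrightarrow> mor (\<lambda>v. g (f v))"
  unfolding mor_def[of "\<lambda>v. g (f v)"] by (simp add: morD)

text \<open>Closure under \<open>sh\<close> is asked for separately: if the tree is a single vertex,
  there are no arrows to join the levels.\<close>

lemma V_connected:
  assumes "s \<in> V" "t \<in> V" "\<And>s t. \<lbrakk>(s, t) \<in> R; Pr s\<rbrakk> \<Longrightarrow> Pr t" "\<And>s t. \<lbrakk>(s, t) \<in> R; Pr t\<rbrakk> \<Longrightarrow> Pr s"
    "\<And>s k. \<lbrakk>s \<in> V; Pr s\<rbrakk> \<Longrightarrow> Pr (sh k s)" "Pr s"
  shows "Pr t"
proof -
  have "Pr (n, p) \<longleftrightarrow> Pr (n, root)" if "p \<in> W" for n p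
    using that
  proof (induct rule: W_induct)
    case (child q)
    then have "((n, par q), (n, q)) \<in> R" by (simp add: R_iff child_of_def)
    then show ?case using child assms(3,4) by blast
  qed simp
  moreover have "Pr (m, root)" if "Pr (n, root)" for n m
    using assms(5)[OF _ that, of "m - n"] root by (simp add: V_def sh_def)
  ultimately show ?thesis using assms(1,2,6) by (auto simp: V_def)
qed

text \<open>Parallel lifting: a morphism over \<open>\<Gamma>\<close> is determined by its value at any single vertex, and its
  values at two vertices correspond.\<close>

lemma parallel:
  assumes s: "s \<in> V" "s' \<in> V" "pr s = pr s'" and t: "t \<in> V"
  shows "\<exists>t'\<in>V. pr t = pr t' \<and> (\<forall>f. mor f \<longrightarrow> (f s = s' \<longleftrightarrow> f t = t'))"
proof (rule V_connected[OF s(1) t, where Pr = "\<lambda>t. \<exists>t'\<in>V. pr t = pr t' \<and> (\<forall>f. mor f \<longrightarrow> (f s = s' \<longleftrightarrow> f t = t'))"])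
  fix x y assume R: "(x, y) \<in> R" and "\<exists>t'\<in>V. pr x = pr t' \<and> (\<forall>f. mor f \<longrightarrow> (f s = s' \<longleftrightarrow> f x = t'))"
  then obtain x' where x': "x' \<in> V" "pr x = pr x'" "\<And>f. mor f \<Longrightarrow> f s = s' \<longleftrightarrow> f x = x'" by blast
  obtain y' where y': "(x', y') \<in> R" "pr y' = pr y" using succ_ex[OF x'(1), of "pr y"] R_lab(3)[OF R] x'(2) by auto
  have V: "x \<in> V" "y \<in> V" "y' \<in> V" using R R_V y'(1) by blast+
  have "f x = x' \<longleftrightarrow> f y = y'" if f: "mor f" for f
  proof -
    have 1: "(f x, f y) \<in> R" using morD(3)[OF f R] .
    have 2: "pr (f x) = pr x'" "pr (f y) = pr y'" using morD(2)[OF f] V x'(2) y'(2) by simp_all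
    show ?thesis using succ_inj[of x' "f y" y'] pred_inj[of "f x" y' x'] 1 2 y'(1) by auto
  qed
  then show "\<exists>t'\<in>V. pr y = pr t' \<and> (\<forall>f. mor f \<longrightarrow> (f s = s' \<longleftrightarrow> f y = t'))"
    using x'(3) y'(2) V(3) by (intro bexI[of _ y']) auto
next
  fix y x assume R: "(y, x) \<in> R" and "\<exists>t'\<in>V. pr x = pr t' \<and> (\<forall>f. mor f \<longrightarrow> (f s = s' \<longleftrightarrow> f x = t'))"
  then obtain x' where x': "x' \<in> V" "pr x = pr x'" "\<And>f. mor f \<Longrightarrow> f s = s' \<longleftrightarrow> f x = x'" by blast
  obtain y' where y': "(y', x') \<in> R" "pr y' = pr y" using pred_ex[OF x'(1), of "pr y"] R_lab(3)[OF R] x'(2) by auto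
  have V: "x \<in> V" "y \<in> V" "y' \<in> V" using R R_V y'(1) by blast+
  have "f x = x' \<longleftrightarrow> f y = y'" if f: "mor f" for f
  proof -
    have 1: "(f y, f x) \<in> R" using morD(3)[OF f R] .
    have 2: "pr (f x) = pr x'" "pr (f y) = pr y'" using morD(2)[OF f] V x'(2) y'(2) by simp_all
    show ?thesis using pred_inj[of "f y" x' y'] succ_inj[of y' "f x" x'] 1 2 y'(1) by auto
  qed
  then show "\<exists>t'\<in>V. pr y = pr t' \<and> (\<forall>f. mor f \<longrightarrow> (f s = s' \<longleftrightarrow> f y = t'))"
    using x'(3) y'(2) V(3) by (intro bexI[of _ y']) auto
next
  fix x k assume x: "x \<in> V" and "\<exists>t'\<in>V. pr x = pr t' \<and> (\<forall>f. mor f \<longrightarrow> (f s = s' \<longleftrightarrow> f x = t'))"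
  then obtain x' where x': "x' \<in> V" "pr x = pr x'" "\<And>f. mor f \<Longrightarrow> f s = s' \<longleftrightarrow> f x = x'" by blast
  have inj: "sh k u = sh k v \<longleftrightarrow> u = v" for u v by (cases u, cases v) (auto simp: sh_def)
  show "\<exists>t'\<in>V. pr (sh k x) = pr t' \<and> (\<forall>f. mor f \<longrightarrow> (f s = s' \<longleftrightarrow> f (sh k x) = t'))"
  proof (intro bexI conjI allI impI)
    show "pr (sh k x) = pr (sh k x')" using x' x pr_sh by simp
    show "f s = s' \<longleftrightarrow> f (sh k x) = sh k x'" if "mor f" for f
      using x'(3)[OF that] morD(4)[OF that x] inj by simp
  qed (use x' in simp)
next
  show "\<exists>t'\<in>V. pr s = pr t' \<and> (\<forall>f. mor f \<longrightarrow> (f s = s' \<longleftrightarrow> f s = t'))" using s by blast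
qed

lemma mor_unique:
  assumes "mor f" "mor g" "s \<in> V" "f s = g s" "t \<in> V"
  shows "f t = g t"
proof -
  obtain t' where "\<forall>h. mor h \<longrightarrow> (h s = f s \<longleftrightarrow> h t = t')"
    using parallel[OF assms(3) morD(1)[OF assms(1,3)] _ assms(5)] morD(2)[OF assms(1,3)] by metis
  then show ?thesis using assms(1,2,4) by metis
qed

text \<open>The image of (0, p) under a morphism sending (0, root) to w, computed along the walk
  from the root to p.\<close>

inductive lift for w where
  lift_root: "lift w root w"
| lift_child: "\<lbrakk>lift w p u; child_of p q; (u, t) \<in> R; pr t = lab q\<rbrakk> \<Longrightarrow> lift w q t"

text \<open>Each tree vertex is reached from the root by exactly one walk, so lifting it step by
  step meets no consistency condition; the other levels are filled in by \<open>sh\<close>.\<close>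

lemma mor_ex:
  assumes w: "w \<in> V" "pr w = x0"
  shows "\<exists>f. mor f \<and> f (0, root) = w"
proof -
  have ex: "\<exists>t. lift w p t" and pr: "lift w p t \<Longrightarrow> t \<in> V \<and> pr t = lab p" if "p \<in> W" for p t
  proof -
    have pr: "t \<in> V \<and> pr t = lab p" if "lift w p t" for p t
      using that by (induct rule: lift.induct) (use w root R_V in auto)
    then show "lift w p t \<Longrightarrow> t \<in> V \<and> pr t = lab p" .
    from that show "\<exists>t. lift w p t"
    proof (induct rule: W_induct)
      case root
      show ?case using lift_root by blast
    next
      case (child q)
      then obtain u where u: "lift w (par q) u" by blast
      have c: "child_of (par q) q" using child by (simp add: child_of_def)
      have "(lab (par q), lab q) \<in> E" using child_al(1)[OF c] lab_in child_ofD[OF c] by (simp add: E_iff)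
      then obtain t where "(u, t) \<in> R" "pr t = lab q" using succ_ex[of u "lab q"] pr[OF u] by auto
      then show ?case using lift_child[OF u c] by blast
    qed
  qed
  have uniq: "t = t'" if "p \<in> W" "lift w p t" "lift w p t'" for p t t'
    using that
  proof (induct arbitrary: t t' rule: W_induct)
    case root
    have "t = w" if "lift w root t" for t using that by cases (auto simp: child_of_def)
    then show ?case using root by metis
  next
    case (child q)
    have inv: "\<exists>u. lift w (par q) u \<and> (u, t) \<in> R \<and> pr t = lab q" if "lift w q t" for t
      using that child(2) by cases (auto simp: child_of_def)
    obtain u u' where u: "lift w (par q) u" "(u, t) \<in> R" "pr t = lab q" "lift w (par q) u'" "(u', t') \<in> R" "pr t' = lab q"
      using inv[OF child(4)] inv[OF child(5)] by blast
    have "u = u'" using child(3)[OF u(1,4)] .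
    then show ?case using succ_inj[of u t t'] u by simp
  qed
  define L where "L p = (THE t. lift w p t)" for p
  have L: "lift w p (L p)" if "p \<in> W" for p
  proof -
    have "\<exists>!t. lift w p t" using ex[OF that] uniq[OF that] by blast
    then show ?thesis unfolding L_def by (rule theI')
  qed
  have LV: "L p \<in> V" "pr (L p) = lab p" if "p \<in> W" for p using pr[OF that L[OF that]] by auto
  have Lroot: "L root = w" using uniq[OF root(1) L[OF root(1)] lift_root] .
  have Lch: "(L p, L q) \<in> R" if c: "child_of p q" for p q
  proof -
    have W: "p \<in> W" "q \<in> W" using child_ofD[OF c] by auto
    have "(lab p, lab q) \<in> E" using child_al(1)[OF c] lab_in W by (simp add: E_iff)
    then obtain t where t: "(L p, t) \<in> R" "pr t = lab q" using succ_ex[of "L p" "lab q"] LV[OF W(1)] by auto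
    then have "lift w q t" using lift_child[OF L[OF W(1)] c] by blast
    then show ?thesis using uniq[OF W(2) L[OF W(2)]] t(1) by metis
  qed
  define f where "f v = sh (fst v) (L (snd v))" for v
  have "mor f"
    unfolding mor_def
  proof (intro conjI ballI allI impI)
    fix v assume v: "v \<in> V"
    then have p: "snd v \<in> W" by (auto simp: V_def)
    show "f v \<in> V" using LV(1)[OF p] by (simp add: f_def)
    show "pr (f v) = pr v" using pr_sh[OF LV(1)[OF p]] LV(2)[OF p] by (simp add: f_def pr_def[of v])
    show "f (sh k v) = sh k (f v)" for k by (simp add: f_def sh_def[of k v] add.commute)
  next
    fix s t assume st: "(s, t) \<in> R"
    obtain n p m q where e: "s = (n, p)" "t = (m, q)" by (cases s, cases t)
    consider "m = n" "child_of p q" | "m = n + 1" "child_of q p" using st e R_iff by blast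
    then show "(f s, f t) \<in> R"
    proof cases
      case 1
      then show ?thesis using Lch e by (simp add: f_def)
    next
      case 2
      have "(sh n (L p), sh n (sh 1 (L q))) \<in> R" unfolding R_sh R_tau using Lch[OF 2(2)] .
      then show ?thesis using 2 e by (simp add: f_def)
    qed
  qed
  moreover have "f (0, root) = w" using Lroot by (simp add: f_def)
  ultimately show ?thesis by blast
qed

lemma root_V: "(0, root) \<in> V" "pr (0, root) = x0"
  using root by (simp_all add: V_def pr_def)

text \<open>With w the image of the root, \<open>parallel\<close> finds t' such that a morphism
  sends w to the root exactly if it sends the root to t'. The morphism g with the latter value
  undoes f at the root, hence everywhere by uniqueness, and f undoes g in the same way, compared at
  w.\<close>

lemma mor_invertible:
  assumes f: "mor f"
  shows "\<exists>g. mor g \<and> (\<forall>v\<in>V. g (f v) = v) \<and> (\<forall>v\<in>V. f (g v) = v)"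
proof -
  let ?r = "(0, root)"
  define w where "w = f ?r"
  have w: "w \<in> V" "pr w = x0" using morD(1,2)[OF f root_V(1)] root_V(2) by (auto simp: w_def)
  obtain t' where t': "t' \<in> V" "pr ?r = pr t'" "\<And>h. mor h \<Longrightarrow> h w = ?r \<longleftrightarrow> h ?r = t'"
    using parallel[OF w(1) root_V(1) _ root_V(1)] w(2) root_V(2) by auto
  obtain g where g: "mor g" "g ?r = t'" using mor_ex[OF t'(1)] t'(2) root_V(2) by auto
  have gw: "g w = ?r" using t'(3)[OF g(1)] g(2) by simp
  have id: "mor (\<lambda>v. v)" by (simp add: mor_def)
  have "g (f v) = v" if "v \<in> V" for v
    using mor_unique[OF mor_comp[OF f g(1)] id root_V(1) _ that] gw w_def by simp
  moreover have "f (g v) = v" if "v \<in> V" for v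
    using mor_unique[OF mor_comp[OF g(1) f] id w(1) _ that] gw w_def by simp
  ultimately show ?thesis using g(1) by blast
qed

lemma mor_deck:
  assumes f: "mor f"
  shows "restrict f V \<in> deck_group Z pr"
proof -
  obtain g where g: "mor g" "\<And>v. v \<in> V \<Longrightarrow> g (f v) = v" "\<And>v. v \<in> V \<Longrightarrow> f (g v) = v"
    using mor_invertible[OF f] by blast
  have b: "bij_betw f V V"
    using g morD(1)[OF f] morD(1)[OF g(1)] by (intro bij_betw_byWitness[where f' = g]) auto
  have Rf: "(s, t) \<in> R \<longleftrightarrow> (f s, f t) \<in> R" if "s \<in> V" "t \<in> V" for s t
    using morD(3)[OF f, of s t] morD(3)[OF g(1), of "f s" "f t"] g(2) that by auto
  have "quiver_iso Z Z f"
    unfolding quiver_iso_def Z_verts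
  proof (intro conjI ballI allI)
    fix x y assume xy: "x \<in> V" "y \<in> V"
    show "(x, y) \<in> qarr Z \<longleftrightarrow> (f x, f y) \<in> qarr Z" using Rf[OF xy] by (simp add: R_def)
    have "f y = sh (- 1) (f x) \<longleftrightarrow> y = sh (- 1) x"
      using b xy morD(4)[OF f xy(1), of "- 1"] unfolding bij_betw_def inj_on_def by (metis sh_V)
    then show "(x, y) \<in> qtau Z \<longleftrightarrow> (f x, f y) \<in> qtau Z" using xy morD(1)[OF f] by (auto simp: Z_tau)
    show "(x, y, a, b) \<in> qlab Z \<longleftrightarrow> (f x, f y, a, b) \<in> qlab Z" for a b
      using Rf[OF xy] xy morD(2)[OF f] by (simp add: Z_lab)
  qed (rule b)
  then have "quiver_iso Z Z (restrict f V)" by (rule quiver_iso_cong) (simp add: Z_verts)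
  moreover have "restrict f V \<in> Bij V" using b by (simp add: Bij_def cong: bij_betw_cong)
  ultimately show ?thesis using morD(2)[OF f] by (simp add: deck_group_def Z_verts)
qed

theorem tree_class_T: "tree_class Q T"
proof (rule tree_classI[OF valued_tree_T orientation_A, where p = pr])
  show "quiver_covering Z Q f" if "\<And>v. v \<in> qverts Z \<Longrightarrow> f v = pr v" for f
    using covering that by (simp add: Z_verts)
  show "(s, t, a, b) \<in> qlab Z" if "(s, t) \<in> qarr Z" "(pr s, pr t, a, b) \<in> qlab Q" for s t a b
    using that by (simp add: Z_lab R_def)
  show "\<exists>t. (s, t) \<in> qtau Z \<and> pr t = y" if "s \<in> qverts Z" "(pr s, y) \<in> qtau Q" for s y
    using that pr_sh[of s "- 1"] tp_1[OF pr_in] by (simp add: Z_tau Z_verts)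
  show "\<exists>g\<in>deck_group Z pr. g v = v'" if vv: "v \<in> qverts Z" "v' \<in> qverts Z" "pr v = pr v'" for v v'
  proof -
    have V: "v \<in> V" "v' \<in> V" using vv Z_verts by auto
    \<comment> \<open>The condition that v is sent to v' is transported to the root, where
      \<open>mor_ex\<close> produces a morphism with any prescribed value in the fibre.\<close>
    obtain t' where t': "t' \<in> V" "pr (0, root) = pr t'" "\<And>h. mor h \<Longrightarrow> h v = v' \<longleftrightarrow> h (0, root) = t'"
      using parallel[OF V vv(3) root_V(1)] by blast
    obtain f where f: "mor f" "f (0, root) = t'" using mor_ex[OF t'(1)] t'(2) root_V(2) by auto
    then show ?thesis using mor_deck[OF f(1)] t'(3)[OF f(1)] V(1) by (intro bexI[of _ "restrict f V"]) auto
  qed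
qed (use R_V in \<open>auto simp: E_iff R_def Z_lab Z_tau Z_verts\<close>)

end

section \<open>Existence of a tree class\<close>

context finite_vtq
begin

text \<open>Walks are stored with the latest vertex first, so that the end of a walk is
  \<open>hd\<close> and dropping the last step is \<open>tl\<close>.\<close>

inductive walk for x0 where
  walk_root: "walk x0 [x0]"
| walk_step: "\<lbrakk>walk x0 (y # ys); z \<in> \<Gamma>; al y z \<noteq> 0; ys \<noteq> [] \<Longrightarrow> tau z \<noteq> hd ys\<rbrakk> \<Longrightarrow> walk x0 (z # y # ys)"

lemma walk_lists: "walk x0 p \<Longrightarrow> x0 \<in> \<Gamma> \<Longrightarrow> p \<in> lists \<Gamma>"
  by (induct rule: walk.induct) auto

theorem tree_class_ex: "\<exists>T :: nat valued_graph. tree_class Q T"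
proof -
  obtain x0 where x0: "x0 \<in> \<Gamma>" using nonempty by blast
  \<comment> \<open>The tree is to have natural numbers as vertices, so walks, being lists over a
    finite set, are encoded injectively.\<close>
  define c where "c = to_nat_on (lists \<Gamma>)"
  have "countable (lists \<Gamma>)" using fin by (intro countable_lists countable_finite)
  then have inj: "inj_on c (lists \<Gamma>)" unfolding c_def by (rule inj_on_to_nat_on)
  define dec where "dec = inv_into (lists \<Gamma>) c"
  have dec: "dec (c p) = p" if "walk x0 p" for p
    unfolding dec_def using inv_into_f_f[OF inj walk_lists[OF that x0]] .
  have tl: "walk x0 (tl p) \<and> p = hd p # hd (tl p) # tl (tl p) \<and> hd p \<in> \<Gamma> \<and> al (hd (tl p)) (hd p) \<noteq> 0 \<and>
      (tl (tl p) \<noteq> [] \<longrightarrow> tau (hd p) \<noteq> hd (tl (tl p)))" if "walk x0 p" "p \<noteq> [x0]" for p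
    using that by (cases rule: walk.cases) auto
  have ne: "p \<noteq> []" if "walk x0 p" for p using that by (cases rule: walk.cases) auto
  have single: "p = [x0]" if "walk x0 p" "tl p = []" for p using that by (cases rule: walk.cases) auto
  have c_eq: "c p = c q \<longleftrightarrow> p = q" if "walk x0 p" "walk x0 q" for p q
    using dec that by metis
  \<comment> \<open>A walk is a nonempty list that includes its starting vertex, so the depth is its
    length minus 1.\<close>
  interpret walk_tree \<Gamma> tau al bl gf x0 "c ` {p. walk x0 p}" "c [x0]" "\<lambda>n. c (tl (dec n))" "\<lambda>n. hd (dec n)" "\<lambda>n. length (dec n) - 1"
  proof (unfold_locales, goal_cases)
    case 1 then show ?case by (rule x0)
  next
    case 2 then show ?case using walk_root by blast
  next
    case 3 then show ?case by (simp add: dec[OF walk_root])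
  next
    case 4 then show ?case by (simp add: dec[OF walk_root])
  next
    case (5 n)
    then obtain p where p: "walk x0 p" "n = c p" "p \<noteq> [x0]" by auto
    have "p = hd p # hd (tl p) # tl (tl p)" using tl[OF p(1,3)] by blast
    then have "length p - 1 = Suc (length (tl p) - 1)" by (metis One_nat_def diff_Suc_1 length_Cons list.sel(3))
    then show ?case using tl[OF p(1,3)] p(2) dec[OF p(1)] dec[of "tl p"] by simp
  next
    case (6 n)
    then obtain p where p: "walk x0 p" "n = c p" "p \<noteq> [x0]" by auto
    then show ?case using tl[OF p(1,3)] dec[OF p(1)] dec[of "tl p"] by simp
  next
    case (7 n)
    then obtain p where p: "walk x0 p" "n = c p" "p \<noteq> [x0]" by auto
    have t: "walk x0 (tl p)" using tl[OF p(1,3)] by blast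
    then have "tl p \<noteq> [x0]" using 7(3) p dec by auto
    then have "tl (tl p) \<noteq> []" using single[OF t] by blast
    moreover have "walk x0 (tl (tl p))" using tl[OF t \<open>tl p \<noteq> [x0]\<close>] by blast
    ultimately show ?case using tl[OF p(1,3)] dec[OF p(1)] dec[OF t] dec[of "tl (tl p)"] p(2) by simp
  next
    case (8 n z)
    then obtain p where p: "walk x0 p" "n = c p" by auto
    obtain y ys where ys: "p = y # ys" using ne[OF p(1)] by (cases p) auto
    have "tau z \<noteq> hd ys" if "ys \<noteq> []"
    proof -
      have "p \<noteq> [x0]" using ys that by auto
      then have "n \<noteq> c [x0]" "walk x0 ys" using c_eq[OF p(1) walk_root] p(2) tl[OF p(1)] ys by auto
      then show ?thesis using 8(4) p ys dec by simp
    qed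
    then have w: "walk x0 (z # p)" unfolding ys using p(1) 8(2,3) dec p ys by (intro walk_step) auto
    show ?case
    proof (intro bexI conjI)
      show "c (z # p) \<noteq> c [x0]" using c_eq[OF w walk_root] ys by simp
      show "c (tl (dec (c (z # p)))) = n" "hd (dec (c (z # p))) = z" using dec[OF w] p(2) by simp_all
    qed (use w in blast)
  next
    case (9 m n)
    then obtain p q where p: "walk x0 p" "m = c p" "p \<noteq> [x0]" "walk x0 q" "n = c q" "q \<noteq> [x0]" by auto
    then have "c (tl p) = c (tl q)" "hd p = hd q" using 9 dec by auto
    moreover have "walk x0 (tl p)" "walk x0 (tl q)" using tl p by blast+
    ultimately have "tl p = tl q" "hd p = hd q" using c_eq by auto
    then have "p = q" using ne[OF p(1)] ne[OF p(4)] by (metis list.collapse)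
    then show ?case using p by simp
  qed
  show ?thesis using tree_class_T by blast
qed

end

theorem corollary1p2:
  fixes K :: "('k, 'r) ring_scheme" and C :: "('o, 'm, 'k) tri_cat" and \<Gamma> :: "'o set set"
  assumes "field K"
    and "triangulated_category K C"
    and "hom_finite K C"
    and "krull_schmidt C"
    and "connected_category C"
    and "stable_component C \<Gamma>"
    and "finite \<Gamma>"
  shows "(\<exists>T :: nat valued_graph.
            tree_class (full_subquiver (AR_quiver C) \<Gamma>) T \<and> dynkin_diagram T) \<and>
         (\<forall>T :: 'v valued_graph.
            tree_class (full_subquiver (AR_quiver C) \<Gamma>) T \<longrightarrow> dynkin_diagram T) \<and>
         (\<forall>X. indecomposable C X \<longrightarrow> iso_class C X \<in> \<Gamma>)"
proof -
  interpret stable_setup K C \<Gamma>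
    using assms triangulated_category.ks_categoryI
    by (intro stable_setup.intro ks_triangulated.intro stable_setup_axioms.intro)
  interpret F: finite_vtq \<Gamma> tau al bl gf
    by unfold_locales
      ((erule (1) connected | simp add: fin Gamma_nonempty tau_bij al_zero al_tau gf_strict)+)
  have Q: "full_subquiver (AR_quiver C) \<Gamma> = F.Q"
    unfolding full_subquiver_eq F.Q_def F.E_def by (auto simp: F.E_def)
  obtain T :: "nat valued_graph" where "tree_class F.Q T" using F.tree_class_ex by blast
  then show ?thesis
    unfolding Q using all_in_Gamma[OF assms(5)]
    by (intro conjI exI[of _ T] allI impI) (assumption | erule F.tree_class_dynkin)+
qed

end
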